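(* Let $(E,q,[\![\cdot,\cdot]\!])$ be a Lie algebroid over a manifold $M$ and let $D$ be the derivation of degree $1$ of $\Gamma(\Lambda^\bullet E^* )$ determined by $$Df(A)=(qA)(f),\qquad D\alpha(A,B)=qA(\alpha(B))-qB(\alpha(A))-\alpha([\![A,B]\!])$$ for $f\in C^\infty(M)$, $\alpha\in\Gamma(E^* )$, $A,B\in\Gamma(E)$. Then, given any linear connection $\nabla$ on $E$, $D$ can be written as $$D=\nabla_q+\imath_{L^\nabla},$$ where $L^\nabla\in\Gamma(\Lambda^2E^*\otimes E)$, the torsion of the $E$-connection $\delta^\nabla$, is given by $$L^\nabla(A,B)=\nabla_{qA}B-\nabla_{qB}A-[\![A,B]\!]$$ for $A,B\in\Gamma(E)$.
   Context: A Lie algebroid on $M$ is a triple $(E,q,[\![\cdot,\cdot]\!])$: a vector bundle $E\to M$, a vector bundle map $q:E\to TM$ over the identity (the anchor), and a Lie bracket on $\Gamma(E)$ with $[\![A,fB]\!]=f[\![A,B]\!]+(qA)(f)\,B$. The linear connection $\nabla$ on $E$ induces the dual connection on $E^*$ and, as derivations of degree $0$, operators $\nabla_X$ on $\Gamma(\Lambda^\bullet E^* )$. For a bundle map $K:E\to TM$, viewed as $K\in\Gamma(E^*\otimes TM)$, $\nabla_K$ is the derivation of degree $1$ of $\Gamma(\Lambda^\bullet E^* )$ given by $\nabla_{\eta\otimes X}\omega=\eta\wedge\nabla_X\omega$, extended additively (locally, $K=\sum K^j_c\,\eta^c\otimes\partial_j$ gives $\nabla_K=\sum K^j_c\,\eta^c\wedge\nabla_{\partial_j}$).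 For $L\in\Gamma(\Lambda^2E^*\otimes E)$, $\imath_L$ is the derivation of degree $1$ of $\Gamma(\Lambda^\bullet E^* )$ that vanishes on functions and satisfies $(\imath_L\alpha)(A,B)=\alpha(L(A,B))$ for $\alpha\in\Gamma(E^* )$. An $E$-connection (on $E$) is an $\mathbb{R}$-bilinear map $\delta:\Gamma(E)\times\Gamma(E)\to\Gamma(E)$ with $\delta_{fA}B=f\delta_AB$ and $\delta_A(fB)=(qA)(f)B+f\delta_AB$; its torsion is $\mathrm{Tor}\,\delta(A,B)=\delta_AB-\delta_BA-[\![A,B]\!]$. The $E$-connection $\delta^\nabla$ determined by $\nabla$ is $\delta^\nabla_AB=\nabla_{qA}B$. *)

theory Defs
  imports "HOL-Analysis.Analysis"
begin

section \<open>Smooth manifolds\<close>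

text \<open>For a finite-dimensional domain and open \<open>S\<close>, \<open>Ck_on k S f\<close> says that \<open>f\<close> is of class
  \<open>C\<^sup>k\<close> on \<open>S\<close>.\<close>

primrec Ck_on :: "nat \<Rightarrow> 'a::real_normed_vector set \<Rightarrow> ('a \<Rightarrow> 'c::real_normed_vector) \<Rightarrow> bool" where
  "Ck_on 0 S f \<longleftrightarrow> continuous_on S f"
| "Ck_on (Suc k) S f \<longleftrightarrow>
     (\<forall>x\<in>S. f differentiable (at x)) \<and>
     (\<forall>v. Ck_on k S (\<lambda>x. frechet_derivative f (at x) v))"

definition smooth_on :: "'a::real_normed_vector set \<Rightarrow> ('a \<Rightarrow> 'c::real_normed_vector) \<Rightarrow> bool" where
  "smooth_on S f \<longleftrightarrow> (\<forall>k. Ck_on k S f)"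

text \<open>The points of the manifold are the elements of the type \<open>'m\<close>, with the topology of that
  type. The atlas consists of pairs \<open>(U, \<kappa>)\<close> with \<open>\<kappa>\<close> a chart on \<open>U\<close>; it need not be maximal.\<close>

record ('m, 'b) manifold =
  charts :: "('m set \<times> ('m \<Rightarrow> 'b)) set"

text \<open>The model space is a finite-dimensional inner product space, that is, \<open>\<real>\<^sup>n\<close> for some \<open>n \<ge> 0\<close>.
  The class \<open>euclidean_space\<close> would exclude \<open>n = 0\<close>.\<close>

definition is_manifold ::
  "('m::{t2_space,second_countable_topology}, 'b::real_inner, 'z) manifold_scheme \<Rightarrow> bool" where
  "is_manifold M \<longleftrightarrow>
     (\<exists>B::'b set. finite B \<and> span B = UNIV) \<and>
     (\<Union>(U, \<kappa>)\<in>charts M. U) = UNIV \<and>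
     (\<forall>(U, \<kappa>)\<in>charts M. open U \<and> open (\<kappa> ` U) \<and> homeomorphism U (\<kappa> ` U) \<kappa> (inv_into U \<kappa>)) \<and>
     (\<forall>(U, \<kappa>)\<in>charts M. \<forall>(V, \<mu>)\<in>charts M. smooth_on (\<kappa> ` (U \<inter> V)) (\<mu> \<circ> inv_into U \<kappa>))"

text \<open>Real functions that are smooth on the open set \<open>W\<close> of the manifold; their values outside
  \<open>W\<close> are irrelevant.\<close>

definition Cinf_on ::
  "('m::topological_space, 'b::real_inner, 'z) manifold_scheme \<Rightarrow> 'm set \<Rightarrow> ('m \<Rightarrow> real) set" where
  "Cinf_on M W = {f. \<forall>(U, \<kappa>)\<in>charts M. smooth_on (\<kappa> ` (U \<inter> W)) (f \<circ> inv_into U \<kappa>)}"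

abbreviation Cinf ::
  "('m::topological_space, 'b::real_inner, 'z) manifold_scheme \<Rightarrow> ('m \<Rightarrow> real) set" where
  "Cinf M \<equiv> Cinf_on M UNIV"

text \<open>Tangent vectors at \<open>x\<close> are the derivations at \<open>x\<close> of the algebra of smooth functions. They are
  made \<open>0\<close> on non-smooth arguments, so that equality of tangent vectors is equality of functions.\<close>

type_synonym 'm tangent = "('m \<Rightarrow> real) \<Rightarrow> real"

definition tangent_space ::
  "('m::topological_space, 'b::real_inner, 'z) manifold_scheme \<Rightarrow> 'm \<Rightarrow> 'm tangent set" where
  "tangent_space M x = {v.
     (\<forall>f\<in>Cinf M. \<forall>g\<in>Cinf M. \<forall>c d. v (\<lambda>y. c * f y + d * g y) = c * v f + d * v g) \<and>
     (\<forall>f\<in>Cinf M. \<forall>g\<in>Cinf M. v (\<lambda>y. f y * g y) = f x * v g + g x * v f) \<and>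
     (\<forall>f. f \<notin> Cinf M \<longrightarrow> v f = 0)}"

definition vector_fields_on ::
  "('m::topological_space, 'b::real_inner, 'z) manifold_scheme \<Rightarrow> 'm set \<Rightarrow> ('m \<Rightarrow> 'm tangent) set" where
  "vector_fields_on M W = {X.
     (\<forall>x\<in>W. X x \<in> tangent_space M x) \<and> (\<forall>f\<in>Cinf M. (\<lambda>x. X x f) \<in> Cinf_on M W)}"

abbreviation vector_fields ::
  "('m::topological_space, 'b::real_inner, 'z) manifold_scheme \<Rightarrow> ('m \<Rightarrow> 'm tangent) set" where
  "vector_fields M \<equiv> vector_fields_on M UNIV"


section \<open>Vector bundles\<close>

text \<open>The fibre over each point is a linear subspace of the vector space \<open>'e\<close>. A local
  trivialization \<open>U \<times> \<real>\<^sup>r \<rightarrow> E|\<^sub>U\<close>, \<open>(x, c) \<mapsto> (\<Sum>i<r. c i *\<^sub>R e i x)\<close>, is given by the local frame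
  \<open>e 0, \<dots>, e (r - 1)\<close> over \<open>U\<close>; the transition functions between them have to be smooth. No
  compatibility with a topology on \<open>'e\<close> is required: the smooth structure of the bundle
  is the one given by the trivializations.\<close>

record ('m, 'b, 'e) vbundle = "('m, 'b) manifold" +
  fibre :: "'m \<Rightarrow> 'e set"
  rk :: nat
  trivs :: "('m set \<times> (nat \<Rightarrow> 'm \<Rightarrow> 'e)) set"

definition is_vbundle ::
  "('m::{t2_space,second_countable_topology}, 'b::real_inner, 'e::real_vector, 'z) vbundle_scheme \<Rightarrow> bool" where
  "is_vbundle E \<longleftrightarrow>
     is_manifold E \<and>
     (\<Union>(U, e)\<in>trivs E. U) = UNIV \<and>
     (\<forall>(U, e)\<in>trivs E. open U \<and>
        (\<forall>x\<in>U. inj_on (\<lambda>i. e i x) {..<rk E} \<and>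
               independent ((\<lambda>i. e i x) ` {..<rk E}) \<and>
               span ((\<lambda>i. e i x) ` {..<rk E}) = fibre E x)) \<and>
     (\<forall>(U, e)\<in>trivs E. \<forall>(V, e')\<in>trivs E. \<exists>g.
        (\<forall>i<rk E. \<forall>j<rk E. g i j \<in> Cinf_on E (U \<inter> V)) \<and>
        (\<forall>j<rk E. \<forall>x\<in>U \<inter> V. e' j x = (\<Sum>i<rk E. g i j x *\<^sub>R e i x)))"

definition sections_on ::
  "('m::topological_space, 'b::real_inner, 'e::real_vector, 'z) vbundle_scheme \<Rightarrow> 'm set \<Rightarrow> ('m \<Rightarrow> 'e) set" where
  "sections_on E W = {s.
     (\<forall>x\<in>W. s x \<in> fibre E x) \<and>
     (\<forall>(U, e)\<in>trivs E. \<exists>c. (\<forall>i<rk E. c i \<in> Cinf_on E (U \<inter> W)) \<and>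
        (\<forall>x\<in>U \<inter> W. s x = (\<Sum>i<rk E. c i x *\<^sub>R e i x)))}"

abbreviation sections ::
  "('m::topological_space, 'b::real_inner, 'e::real_vector, 'z) vbundle_scheme \<Rightarrow> ('m \<Rightarrow> 'e) set" where
  "sections E \<equiv> sections_on E UNIV"

definition lin_on :: "'e::real_vector set \<Rightarrow> ('e \<Rightarrow> 'c::real_vector) \<Rightarrow> bool" where
  "lin_on F g \<longleftrightarrow> (\<forall>a\<in>F. \<forall>b\<in>F. \<forall>c d. g (c *\<^sub>R a + d *\<^sub>R b) = c *\<^sub>R g a + d *\<^sub>R g b)"

text \<open>Smooth bundle maps \<open>E \<rightarrow> TM\<close> over the identity, equivalently smooth sections of \<open>E\<^sup>* \<otimes> TM\<close>.\<close>

definition bundle_maps_TM ::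
  "('m::topological_space, 'b::real_inner, 'e::real_vector, 'z) vbundle_scheme \<Rightarrow>
   ('m \<Rightarrow> 'e \<Rightarrow> 'm tangent) set" where
  "bundle_maps_TM E = {K.
     (\<forall>x. \<forall>a\<in>fibre E x. K x a \<in> tangent_space E x) \<and>
     (\<forall>x f. lin_on (fibre E x) (\<lambda>a. K x a f)) \<and>
     (\<forall>(U, e)\<in>trivs E. \<forall>i<rk E. (\<lambda>x. K x (e i x)) \<in> vector_fields_on E U)}"

text \<open>Smooth sections of \<open>\<Lambda>\<^sup>2 E\<^sup>* \<otimes> E\<close>.\<close>

definition E_valued_2forms ::
  "('m::topological_space, 'b::real_inner, 'e::real_vector, 'z) vbundle_scheme \<Rightarrow>
   ('m \<Rightarrow> 'e \<Rightarrow> 'e \<Rightarrow> 'e) set" where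
  "E_valued_2forms E = {L.
     (\<forall>x. \<forall>a\<in>fibre E x. \<forall>b\<in>fibre E x. L x a b \<in> fibre E x) \<and>
     (\<forall>x. \<forall>a\<in>fibre E x. lin_on (fibre E x) (\<lambda>b. L x a b) \<and> lin_on (fibre E x) (\<lambda>b. L x b a)) \<and>
     (\<forall>x. \<forall>a\<in>fibre E x. L x a a = 0) \<and>
     (\<forall>x a b. a \<notin> fibre E x \<or> b \<notin> fibre E x \<longrightarrow> L x a b = 0) \<and>
     (\<forall>(U, e)\<in>trivs E. \<forall>i<rk E. \<forall>j<rk E. (\<lambda>x. L x (e i x) (e j x)) \<in> sections_on E U)}"


section \<open>The exterior algebra\<close>

text \<open>An element \<open>w\<close> of \<open>\<Lambda>\<^sup>\<bullet> F\<^sup>*\<close> is a function on lists over \<open>F\<close>, its component of degree \<open>k\<close> being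
  the restriction of \<open>w\<close> to the lists of length \<open>k\<close>, an alternating \<open>k\<close>-linear map. On all other lists
  \<open>w\<close> is \<open>0\<close>. If \<open>F\<close> has dimension \<open>r\<close>, the components of degree \<open>> r\<close> vanish
  automatically, so that this is the direct sum of the \<open>\<Lambda>\<^sup>k F\<^sup>*\<close>.\<close>

definition alternating_on :: "'e::real_vector set \<Rightarrow> ('e list \<Rightarrow> real) \<Rightarrow> bool" where
  "alternating_on F w \<longleftrightarrow>
     (\<forall>l\<in>lists F. \<forall>l'\<in>lists F. lin_on F (\<lambda>a. w (l @ a # l'))) \<and>
     (\<forall>l\<in>lists F. \<not> distinct l \<longrightarrow> w l = 0) \<and>
     (\<forall>l. l \<notin> lists F \<longrightarrow> w l = 0)"

type_synonym ('m, 'e) form = "'m \<Rightarrow> 'e list \<Rightarrow> real"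

definition forms ::
  "('m::topological_space, 'b::real_inner, 'e::real_vector, 'z) vbundle_scheme \<Rightarrow> ('m, 'e) form set" where
  "forms E = {\<omega>.
     (\<forall>x. alternating_on (fibre E x) (\<omega> x)) \<and>
     (\<forall>(U, e)\<in>trivs E. \<forall>I\<in>lists {..<rk E}. (\<lambda>x. \<omega> x (map (\<lambda>i. e i x) I)) \<in> Cinf_on E U)}"

definition kforms ::
  "('m::topological_space, 'b::real_inner, 'e::real_vector, 'z) vbundle_scheme \<Rightarrow> nat \<Rightarrow>
   ('m, 'e) form set" where
  "kforms E k = {\<omega> \<in> forms E. \<forall>x l. length l \<noteq> k \<longrightarrow> \<omega> x l = 0}"

text \<open>A function as a form of degree \<open>0\<close>.\<close>

definition fun_form :: "('m \<Rightarrow> real) \<Rightarrow> ('m, 'e) form" where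
  "fun_form f = (\<lambda>x l. if l = [] then f x else 0)"

text \<open>The exterior product as a sum over shuffles. The set \<open>S\<close> contains the positions of the arguments
  given to \<open>\<omega>\<close>; the sign is that of the permutation moving these to the front. For 1-forms this is
  \<open>(\<alpha> \<and> \<beta>)(A, B) = \<alpha>(A) \<beta>(B) - \<alpha>(B) \<beta>(A)\<close>.\<close>

definition shuffle_sign :: "nat \<Rightarrow> nat set \<Rightarrow> real" where
  "shuffle_sign n S = (- 1) ^ card {(i, j). i < n \<and> j < i \<and> i \<in> S \<and> j \<notin> S}"

definition wedge :: "('m, 'e) form \<Rightarrow> ('m, 'e) form \<Rightarrow> ('m, 'e) form" where
  "wedge \<omega> \<tau> = (\<lambda>x l. \<Sum>S\<in>Pow {..<length l}.
     shuffle_sign (length l) S * \<omega> x (nths l S) * \<tau> x (nths l (- S)))"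

text \<open>Derivations of degree \<open>d\<close>. Outside of \<open>forms E\<close> they are \<open>undefined\<close>, so that equality of
  derivations is equality of functions.\<close>

definition derivation ::
  "('m::topological_space, 'b::real_inner, 'e::real_vector, 'z) vbundle_scheme \<Rightarrow> nat \<Rightarrow>
   (('m, 'e) form \<Rightarrow> ('m, 'e) form) \<Rightarrow> bool" where
  "derivation E d P \<longleftrightarrow>
     P \<in> forms E \<rightarrow>\<^sub>E forms E \<and>
     (\<forall>\<omega>\<in>forms E. \<forall>\<tau>\<in>forms E. \<forall>a b.
        P (\<lambda>x l. a * \<omega> x l + b * \<tau> x l) = (\<lambda>x l. a * P \<omega> x l + b * P \<tau> x l)) \<and>
     (\<forall>k. \<forall>\<omega>\<in>kforms E k. P \<omega> \<in> kforms E (k + d)) \<and>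
     (\<forall>k. \<forall>\<omega>\<in>kforms E k. \<forall>\<tau>\<in>forms E.
        P (wedge \<omega> \<tau>) = (\<lambda>x l. wedge (P \<omega>) \<tau> x l + (- 1) ^ (d * k) * wedge \<omega> (P \<tau>) x l))"


section \<open>Connections\<close>

type_synonym ('m, 'e) connection = "('m \<Rightarrow> 'm tangent) \<Rightarrow> ('m \<Rightarrow> 'e) \<Rightarrow> ('m \<Rightarrow> 'e)"

definition is_connection ::
  "('m::topological_space, 'b::real_inner, 'e::real_vector, 'z) vbundle_scheme \<Rightarrow>
   ('m, 'e) connection \<Rightarrow> bool" where
  "is_connection E nab \<longleftrightarrow>
     (\<forall>X\<in>vector_fields E. \<forall>B\<in>sections E. nab X B \<in> sections E) \<and>
     (\<forall>X\<in>vector_fields E. \<forall>Y\<in>vector_fields E. \<forall>B\<in>sections E.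
        nab (\<lambda>x f. X x f + Y x f) B = (\<lambda>x. nab X B x + nab Y B x)) \<and>
     (\<forall>f\<in>Cinf E. \<forall>X\<in>vector_fields E. \<forall>B\<in>sections E.
        nab (\<lambda>x g. f x * X x g) B = (\<lambda>x. f x *\<^sub>R nab X B x)) \<and>
     (\<forall>X\<in>vector_fields E. \<forall>A\<in>sections E. \<forall>B\<in>sections E. \<forall>c d.
        nab X (\<lambda>x. c *\<^sub>R A x + d *\<^sub>R B x) = (\<lambda>x. c *\<^sub>R nab X A x + d *\<^sub>R nab X B x)) \<and>
     (\<forall>f\<in>Cinf E. \<forall>X\<in>vector_fields E. \<forall>B\<in>sections E.
        nab X (\<lambda>x. f x *\<^sub>R B x) = (\<lambda>x. X x f *\<^sub>R B x + f x *\<^sub>R nab X B x))"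

text \<open>The operator \<open>\<nabla>\<^sub>X\<close> on \<open>\<Gamma>(\<Lambda>\<^sup>\<bullet> E\<^sup>*)\<close>: the derivation of degree \<open>0\<close> that is \<open>X\<close> on functions and the
  dual connection on \<open>\<Gamma>(E\<^sup>*)\<close>.\<close>

definition form_connection ::
  "('m::topological_space, 'b::real_inner, 'e::real_vector, 'z) vbundle_scheme \<Rightarrow>
   ('m, 'e) connection \<Rightarrow> ('m \<Rightarrow> 'm tangent) \<Rightarrow> ('m, 'e) form \<Rightarrow> ('m, 'e) form" where
  "form_connection E nab X = (THE P.
     derivation E 0 P \<and>
     (\<forall>f\<in>Cinf E. P (fun_form f) = fun_form (\<lambda>x. X x f)) \<and>
     (\<forall>\<alpha>\<in>kforms E 1. \<forall>A\<in>sections E. \<forall>x.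
        P \<alpha> x [A x] = X x (\<lambda>y. \<alpha> y [A y]) - \<alpha> x [nab X A x]))"

text \<open>The operator \<open>\<nabla>\<^sub>K\<close>: wherever \<open>K = \<Sum>\<^sub>i \<eta>\<^sub>i \<otimes> X\<^sub>i\<close>, one has \<open>\<nabla>\<^sub>K \<omega> = \<Sum>\<^sub>i \<eta>\<^sub>i \<and> \<nabla>\<^bsub>X\<^sub>i\<^esub> \<omega>\<close>. Every point has a
  neighbourhood \<open>U\<close> on which \<open>K\<close> is of this form with globally defined \<open>\<eta>\<^sub>i\<close> and \<open>X\<^sub>i\<close>.\<close>

definition form_connection_along ::
  "('m::topological_space, 'b::real_inner, 'e::real_vector, 'z) vbundle_scheme \<Rightarrow>
   ('m, 'e) connection \<Rightarrow> ('m \<Rightarrow> 'e \<Rightarrow> 'm tangent) \<Rightarrow> ('m, 'e) form \<Rightarrow> ('m, 'e) form" where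
  "form_connection_along E nab K \<omega> = (THE \<theta>.
     \<theta> \<in> forms E \<and>
     (\<forall>U (m::nat) \<eta> X.
        open U \<and> (\<forall>i<m. \<eta> i \<in> kforms E 1 \<and> X i \<in> vector_fields E) \<and>
        (\<forall>x\<in>U. \<forall>a\<in>fibre E x. K x a = (\<lambda>f. \<Sum>i<m. \<eta> i x [a] * X i x f)) \<longrightarrow>
        (\<forall>x\<in>U. \<theta> x = (\<lambda>l. \<Sum>i<m. wedge (\<eta> i) (form_connection E nab (X i) \<omega>) x l))))"

text \<open>The operator \<open>\<imath>\<^sub>L\<close>.\<close>

definition insertion ::
  "('m::topological_space, 'b::real_inner, 'e::real_vector, 'z) vbundle_scheme \<Rightarrow>
   ('m \<Rightarrow> 'e \<Rightarrow> 'e \<Rightarrow> 'e) \<Rightarrow> ('m, 'e) form \<Rightarrow> ('m, 'e) form" where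
  "insertion E L = (THE P.
     derivation E 1 P \<and>
     (\<forall>f\<in>Cinf E. P (fun_form f) = (\<lambda>x l. 0)) \<and>
     (\<forall>\<alpha>\<in>kforms E 1. \<forall>A\<in>sections E. \<forall>B\<in>sections E. \<forall>x.
        P \<alpha> x [A x, B x] = \<alpha> x [L x (A x) (B x)]))"


section \<open>Lie algebroids\<close>

record ('m, 'b, 'e) lie_algebroid = "('m, 'b, 'e) vbundle" +
  anchor :: "'m \<Rightarrow> 'e \<Rightarrow> 'm tangent"
  bracket :: "('m \<Rightarrow> 'e) \<Rightarrow> ('m \<Rightarrow> 'e) \<Rightarrow> ('m \<Rightarrow> 'e)"

definition is_lie_algebroid ::
  "('m::{t2_space,second_countable_topology}, 'b::real_inner, 'e::real_vector) lie_algebroid \<Rightarrow> bool" where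
  "is_lie_algebroid E \<longleftrightarrow>
     is_vbundle E \<and>
     anchor E \<in> bundle_maps_TM E \<and>
     (\<forall>A\<in>sections E. \<forall>B\<in>sections E. bracket E A B \<in> sections E) \<and>
     (\<forall>A\<in>sections E. \<forall>B\<in>sections E. \<forall>C\<in>sections E. \<forall>c d.
        bracket E (\<lambda>x. c *\<^sub>R A x + d *\<^sub>R B x) C =
          (\<lambda>x. c *\<^sub>R bracket E A C x + d *\<^sub>R bracket E B C x) \<and>
        bracket E C (\<lambda>x. c *\<^sub>R A x + d *\<^sub>R B x) =
          (\<lambda>x. c *\<^sub>R bracket E C A x + d *\<^sub>R bracket E C B x)) \<and>
     (\<forall>A\<in>sections E. bracket E A A = (\<lambda>x. 0)) \<and>
     (\<forall>A\<in>sections E. \<forall>B\<in>sections E. \<forall>C\<in>sections E. \<forall>x.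
        bracket E A (bracket E B C) x + bracket E B (bracket E C A) x +
        bracket E C (bracket E A B) x = 0) \<and>
     (\<forall>f\<in>Cinf E. \<forall>A\<in>sections E. \<forall>B\<in>sections E.
        bracket E A (\<lambda>x. f x *\<^sub>R B x) =
          (\<lambda>x. f x *\<^sub>R bracket E A B x + anchor E x (A x) f *\<^sub>R B x))"

definition is_E_connection ::
  "('m::topological_space, 'b::real_inner, 'e::real_vector) lie_algebroid \<Rightarrow>
   (('m \<Rightarrow> 'e) \<Rightarrow> ('m \<Rightarrow> 'e) \<Rightarrow> ('m \<Rightarrow> 'e)) \<Rightarrow> bool" where
  "is_E_connection E \<delta> \<longleftrightarrow>
     (\<forall>A\<in>sections E. \<forall>B\<in>sections E. \<delta> A B \<in> sections E) \<and>
     (\<forall>A\<in>sections E. \<forall>B\<in>sections E. \<forall>C\<in>sections E. \<forall>c d.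
        \<delta> (\<lambda>x. c *\<^sub>R A x + d *\<^sub>R B x) C = (\<lambda>x. c *\<^sub>R \<delta> A C x + d *\<^sub>R \<delta> B C x) \<and>
        \<delta> C (\<lambda>x. c *\<^sub>R A x + d *\<^sub>R B x) = (\<lambda>x. c *\<^sub>R \<delta> C A x + d *\<^sub>R \<delta> C B x)) \<and>
     (\<forall>f\<in>Cinf E. \<forall>A\<in>sections E. \<forall>B\<in>sections E.
        \<delta> (\<lambda>x. f x *\<^sub>R A x) B = (\<lambda>x. f x *\<^sub>R \<delta> A B x) \<and>
        \<delta> A (\<lambda>x. f x *\<^sub>R B x) = (\<lambda>x. anchor E x (A x) f *\<^sub>R B x + f x *\<^sub>R \<delta> A B x))"

definition torsion ::
  "('m::topological_space, 'b::real_inner, 'e::real_vector) lie_algebroid \<Rightarrow>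
   (('m \<Rightarrow> 'e) \<Rightarrow> ('m \<Rightarrow> 'e) \<Rightarrow> ('m \<Rightarrow> 'e)) \<Rightarrow> ('m \<Rightarrow> 'e) \<Rightarrow> ('m \<Rightarrow> 'e) \<Rightarrow> ('m \<Rightarrow> 'e)" where
  "torsion E \<delta> A B = (\<lambda>x. \<delta> A B x - \<delta> B A x - bracket E A B x)"

text \<open>The vector field \<open>qA\<close> and the \<open>E\<close>-connection \<open>\<delta>\<^sup>\<nabla>\<close> determined by \<open>\<nabla>\<close>.\<close>

definition anchored ::
  "('m::topological_space, 'b::real_inner, 'e::real_vector) lie_algebroid \<Rightarrow> ('m \<Rightarrow> 'e) \<Rightarrow>
   ('m \<Rightarrow> 'm tangent)" where
  "anchored E A = (\<lambda>x. anchor E x (A x))"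

definition induced_E_connection ::
  "('m::topological_space, 'b::real_inner, 'e::real_vector) lie_algebroid \<Rightarrow>
   ('m, 'e) connection \<Rightarrow> ('m \<Rightarrow> 'e) \<Rightarrow> ('m \<Rightarrow> 'e) \<Rightarrow> ('m \<Rightarrow> 'e)" where
  "induced_E_connection E nab A B = nab (anchored E A) B"

text \<open>The values of \<open>D\<close> on functions and on 1-forms that determine the derivation \<open>D\<close>.\<close>

definition algebroid_differential ::
  "('m::topological_space, 'b::real_inner, 'e::real_vector) lie_algebroid \<Rightarrow>
   (('m, 'e) form \<Rightarrow> ('m, 'e) form) \<Rightarrow> bool" where
  "algebroid_differential E D \<longleftrightarrow>
     derivation E 1 D \<and>
     (\<forall>f\<in>Cinf E. \<forall>A\<in>sections E. \<forall>x. D (fun_form f) x [A x] = anchored E A x f) \<and>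
     (\<forall>\<alpha>\<in>kforms E 1. \<forall>A\<in>sections E. \<forall>B\<in>sections E. \<forall>x.
        D \<alpha> x [A x, B x] =
          anchored E A x (\<lambda>y. \<alpha> y [B y]) - anchored E B x (\<lambda>y. \<alpha> y [A y]) - \<alpha> x [bracket E A B x])"

end

theory Submission
  imports Defs
begin

text \<open>A derivation of \<open>\<Gamma>(\<Lambda>\<^sup>\<bullet> E\<^sup>*)\<close> is determined by its values on functions and 1-forms: near a point, a form
  \<open>\<omega>\<close> of degree \<open>k > 0\<close> satisfies Euler's identity \<open>k \<omega> = \<Sum>\<^sub>i \<epsilon>\<^sub>i \<and> \<iota>\<^bsub>e\<^sub>i\<^esub> \<omega>\<close> for a frame \<open>e\<close> with dual frame \<open>\<epsilon>\<close>,
  and bump functions make the right-hand side global, so that induction on \<open>k\<close> applies. Hence if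
  \<open>q = \<Sum>\<^sub>i \<eta>\<^sub>i \<otimes> X\<^sub>i\<close> locally, the derivation \<open>\<Sum>\<^sub>i \<eta>\<^sub>i \<and> \<nabla>\<^bsub>X\<^sub>i\<^esub>\<close> does not depend on the choice of \<open>\<eta>\<^sub>i\<close> and \<open>X\<^sub>i\<close>, because its
  values on functions and 1-forms involve only \<open>q\<close>; these local derivations glue to \<open>\<nabla>\<^sub>q\<close>. The
  difference \<open>D - \<nabla>\<^sub>q\<close> is a derivation of degree 1 that vanishes on functions and sends a 1-form \<open>\<alpha>\<close> to
  \<open>\<alpha> \<circ> L\<close>, where \<open>L\<close> is the torsion. So it is \<open>\<imath>\<^sub>L\<close>, whose existence needs no separate proof.\<close>

section \<open>Calculus of smooth functions\<close>

text \<open>The operators on forms are given by definite descriptions, so each needs an explicit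
  candidate as well as uniqueness. The candidate for \<open>\<nabla>\<^sub>X\<close> is the usual
  formula on sections; it descends to vectors in the fibres because it is linear over functions in
  every slot. A similar cancellation of derivative terms makes the torsion a tensor. The recurring
  obstacle is that \<open>nab\<close> and tangent vectors act on globally defined data only, so
  neither a connection nor a derivation can simply be restricted to an open set. Frames and coframes
  have to be multiplied by bump functions before these operators apply to them, and locality of a
  derivation is never invoked: the Leibniz rule for a function that does not vanish at the point
  takes its place. For the exterior product the sum over shuffles is replaced by a recursion on the
  first argument. Signs and associativity then become inductions on the argument list, and one
  recursion serves lists of vectors and lists of sections alike.\<close>

lemma frechet_derivative_eqI: "(f has_derivative f') (at x) \<Longrightarrow> frechet_derivative f (at x) = f'"
  by (metis frechet_derivative_at)

lemma Ck_on_subset: "Ck_on k S f \<Longrightarrow> T \<subseteq> S \<Longrightarrow> Ck_on k T f"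
  by (induction k arbitrary: f) (auto intro: continuous_on_subset)

text \<open>Agreement on an open set is agreement near each of its points, so both functions have
  the same derivatives there. Both are generalized because the induction hypothesis is applied to
  their directional derivatives.\<close>

lemma Ck_on_cong:
  assumes "open S" "\<And>x. x \<in> S \<Longrightarrow> f x = g x" "Ck_on k S f"
  shows "Ck_on k S g"
  using assms(2,3)
proof (induction k arbitrary: f g)
  case 0
  then show ?case using continuous_on_eq by auto
next
  case (Suc k)
  have d: "(f has_derivative f') (at x) = (g has_derivative f') (at x)" if "x \<in> S" for x f'
    using has_derivative_transform_within_open[OF _ assms(1) that, of f f' UNIV g]
      has_derivative_transform_within_open[OF _ assms(1) that, of g f' UNIV f] Suc.prems(1) by auto
  \<comment> \<open>\<open>frechet_derivative\<close> is a choice among all derivatives; equal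
    predicates give equal choices.\<close>
  have "frechet_derivative f (at x) = frechet_derivative g (at x)" if "x \<in> S" for x
    unfolding frechet_derivative_def using d[OF that] by simp
  then have "Ck_on k S (\<lambda>x. frechet_derivative g (at x) v)" for v
    by (intro Suc.IH[of "\<lambda>x. frechet_derivative f (at x) v" "\<lambda>x. frechet_derivative g (at x) v"])
      (use Suc.prems(2) in simp_all)
  moreover have "g differentiable at x" if "x \<in> S" for x
    using Suc.prems(2) d[OF that] that unfolding differentiable_def Ck_on.simps by blast
  ultimately show ?case by simp
qed

text \<open>Lets the derivative be given by any formula valid on the open set, as the rules of
  differentiation produce it, instead of by \<open>frechet_derivative\<close>.\<close>

lemma Ck_on_SucI:
  assumes "open S" "\<And>x. x \<in> S \<Longrightarrow> (f has_derivative f' x) (at x)" "\<And>v. Ck_on k S (\<lambda>x. f' x v)"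
  shows "Ck_on (Suc k) S f"
proof -
  have "Ck_on k S (\<lambda>x. frechet_derivative f (at x) v)" for v
    by (rule Ck_on_cong[OF assms(1) _ assms(3)[of v]]) (simp add: frechet_derivative_eqI[OF assms(2)])
  moreover have "f differentiable at x" if "x \<in> S" for x
    using assms(2)[OF that] unfolding differentiable_def by blast
  ultimately show ?thesis by simp
qed

lemma Ck_on_Suc_has_derivative:
  "Ck_on (Suc k) S f \<Longrightarrow> x \<in> S \<Longrightarrow> (f has_derivative frechet_derivative f (at x)) (at x)"
  by (simp add: frechet_derivative_works)

lemma Ck_on_SucD: "Ck_on (Suc k) S f \<Longrightarrow> Ck_on k S f"
proof (induction k arbitrary: f)
  case 0
  then show ?case
    by (auto intro!: continuous_at_imp_continuous_on differentiable_imp_continuous_within)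
qed auto

lemma Ck_on_local:
  assumes "\<And>x. x \<in> S \<Longrightarrow> \<exists>T. open T \<and> x \<in> T \<and> Ck_on k T f"
  shows "Ck_on k S f"
  using assms
proof (induction k arbitrary: f)
  case 0
  have "isCont f x" if "x \<in> S" for x
    using 0[OF that] by (auto simp: continuous_on_eq_continuous_at)
  then show ?case by (simp add: continuous_at_imp_continuous_on)
next
  case (Suc k)
  have "Ck_on k S (\<lambda>x. frechet_derivative f (at x) v)" for v
  proof (rule Suc.IH)
    fix x assume "x \<in> S"
    then obtain T where "open T" "x \<in> T" "Ck_on (Suc k) T f" using Suc.prems by blast
    then show "\<exists>T. open T \<and> x \<in> T \<and> Ck_on k T (\<lambda>x. frechet_derivative f (at x) v)"
      by (intro exI[of _ T]) simp
  qed
  moreover have "f differentiable at x" if "x \<in> S" for x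
    using Suc.prems[OF that] by (metis Ck_on.simps(2))
  ultimately show ?case by simp
qed

lemma Ck_on_const: "Ck_on k S (\<lambda>x. c)"
proof (induction k arbitrary: c)
  case (Suc k)
  then show ?case
    by (simp add: frechet_derivative_eqI[OF has_derivative_const])
qed simp

lemma Ck_on_add:
  assumes "open S" "Ck_on k S f" "Ck_on k S g"
  shows "Ck_on k S (\<lambda>x. f x + g x)"
  using assms(2,3)
proof (induction k arbitrary: f g)
  case 0
  then show ?case by (simp add: continuous_on_add)
next
  case (Suc k)
  show ?case
    by (rule Ck_on_SucI[OF assms(1) has_derivative_add[OF Ck_on_Suc_has_derivative[OF Suc.prems(1)]
            Ck_on_Suc_has_derivative[OF Suc.prems(2)]]])
      (use Suc in auto)
qed

text \<open>By the product rule each directional derivative is a sum of two products of the same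
  shape, one factor differentiated and the other lowered by \<open>Ck_on_SucD\<close>. The form with
  a general bilinear map covers both multiplication and the inner product of the model
  space.\<close>

lemma Ck_on_bilinear:
  assumes "open S" "bounded_bilinear p" "Ck_on k S f" "Ck_on k S g"
  shows "Ck_on k S (\<lambda>x. p (f x) (g x))"
  using assms(3,4)
proof (induction k arbitrary: f g)
  case 0
  then show ?case by (simp add: bounded_bilinear.continuous_on[OF assms(2)])
next
  case (Suc k)
  have "Ck_on k S (\<lambda>x. frechet_derivative f (at x) v)" "Ck_on k S (\<lambda>x. frechet_derivative g (at x) v)" for v
    using Suc.prems by simp_all
  note d = Ck_on_add[OF assms(1) Suc.IH[OF Ck_on_SucD[OF Suc.prems(1)] this(2)]
      Suc.IH[OF this(1) Ck_on_SucD[OF Suc.prems(2)]]]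
  show ?case
    by (rule Ck_on_SucI[OF assms(1) bounded_bilinear.FDERIV[OF assms(2)
            Ck_on_Suc_has_derivative[OF Suc.prems(1)] Ck_on_Suc_has_derivative[OF Suc.prems(2)]] d])
qed

lemmas Ck_on_mult = Ck_on_bilinear[OF _ bounded_bilinear_mult]

text \<open>The derivative \<open>- inverse f * f' * inverse f\<close> is again built from the
  reciprocal, whose lower order of smoothness is the induction hypothesis.\<close>

lemma Ck_on_inverse:
  fixes f :: "'a::real_normed_vector \<Rightarrow> real"
  assumes "open S" "\<And>x. x \<in> S \<Longrightarrow> f x \<noteq> 0" "Ck_on k S f"
  shows "Ck_on k S (\<lambda>x. inverse (f x))"
  using assms(3)
proof (induction k)
  case 0
  then show ?case using assms(2) by (simp add: continuous_on_inverse)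
next
  case (Suc k)
  have m: "Ck_on k S (\<lambda>x. inverse (f x))" using Suc Ck_on_SucD by blast
  have d: "Ck_on k S (\<lambda>x. (-1) * (inverse (f x) * frechet_derivative f (at x) v * inverse (f x)))" for v
    by (rule Ck_on_mult[OF assms(1) Ck_on_const Ck_on_mult[OF assms(1) Ck_on_mult[OF assms(1) m] m]])
      (use Suc.prems in simp)
  show ?case
    by (rule Ck_on_SucI[OF assms(1) Deriv.has_derivative_inverse[OF assms(2)
            Ck_on_Suc_has_derivative[OF Suc.prems]] d[unfolded mult_minus1]])
qed

text \<open>The derivative of \<open>h\<close> at a point is multiplication by a number, so the
  chain rule yields a product, to which \<open>Ck_on_mult\<close> applies. \<open>h\<close> varies
  in the induction because its derivative takes its place.\<close>

lemma Ck_on_compose_real: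
  fixes f :: "'a::real_normed_vector \<Rightarrow> real" and h :: "real \<Rightarrow> real"
  assumes "open S" "Ck_on k S f" "Ck_on k UNIV h"
  shows "Ck_on k S (\<lambda>x. h (f x))"
  using assms(2,3)
proof (induction k arbitrary: h)
  case 0
  then show ?case by (auto intro: continuous_on_compose2)
next
  case (Suc k)
  have hd: "(h has_derivative frechet_derivative h (at t)) (at t)" for t
    by (rule Ck_on_Suc_has_derivative[OF Suc.prems(2)]) simp
  have lin: "frechet_derivative h (at t) s = s * frechet_derivative h (at t) 1" for t s
    using linear_scale[OF has_derivative_linear[OF hd[of t]], of s 1] by simp
  have d: "((\<lambda>x. h (f x)) has_derivative
      (\<lambda>v. frechet_derivative f (at x) v * frechet_derivative h (at (f x)) 1)) (at x)" if "x \<in> S" for x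
    using diff_chain_at[OF Ck_on_Suc_has_derivative[OF Suc.prems(1) that] hd]
    by (simp add: o_def lin[symmetric])
  have h': "Ck_on k UNIV (\<lambda>t. frechet_derivative h (at t) 1)"
    and f': "Ck_on k S (\<lambda>x. frechet_derivative f (at x) v)" for v
    using Suc.prems by simp_all
  show ?case
    by (rule Ck_on_SucI[OF assms(1) d Ck_on_mult[OF assms(1) f' Suc.IH[OF Ck_on_SucD[OF Suc.prems(1)] h']]])
qed

lemma Ck_on_id: "Ck_on k S (\<lambda>x. x)"
proof (cases k)
  case (Suc k')
  then show ?thesis
    by (simp add: frechet_derivative_eqI[OF has_derivative_ident] Ck_on_const)
qed (simp add: continuous_on_id)

subsection \<open>A cutoff function on the real line\<close>

text \<open>The functions \<open>p(1/t) exp(-1/t)\<close>, continued by 0, form a family closed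
  under differentiation: the derivative replaces \<open>p\<close> by \<open>X^2 (p - p')\<close>.
  This turns smoothness of \<open>exp(-1/t)\<close> at 0 into one induction on the order.\<close>

definition flat :: "real poly \<Rightarrow> real \<Rightarrow> real" where
  "flat p t = (if t > 0 then poly p (1 / t) * exp (- (1 / t)) else 0)"

lemma poly_exp_tendsto_0: "((\<lambda>u::real. poly p u * exp (- u)) \<longlongrightarrow> 0) at_top"
proof -
  have "((\<lambda>u::real. \<Sum>i\<le>degree p. coeff p i * (u ^ i / exp u)) \<longlongrightarrow> (\<Sum>i\<le>degree p. coeff p i * 0)) at_top"
    by (intro tendsto_sum tendsto_mult tendsto_const tendsto_power_div_exp_0)
  moreover have "(\<lambda>u::real. poly p u * exp (- u)) = (\<lambda>u. \<Sum>i\<le>degree p. coeff p i * (u ^ i / exp u))"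
    by (auto simp: poly_altdef sum_distrib_right exp_minus divide_inverse mult.assoc)
  ultimately show ?thesis by simp
qed

lemma flat_at_right_0: "(flat p \<longlongrightarrow> 0) (at_right 0)"
proof -
  have "((\<lambda>t. poly p (inverse t) * exp (- inverse t)) \<longlongrightarrow> 0) (at_right 0)"
    using filterlim_compose[OF poly_exp_tendsto_0 filterlim_inverse_at_top_right] .
  then show ?thesis
    by (rule Lim_transform_eventually)
      (auto simp: flat_def eventually_at_filter inverse_eq_divide)
qed

lemma flat_has_derivative:
  "(flat p has_real_derivative flat ([:0, 0, 1:] * (p - pderiv p)) t) (at t)"
proof -
  consider "t > 0" | "t < 0" | "t = 0" by linarith
  then show ?thesis
  proof cases
    case 1
    have "((\<lambda>t. poly p (1 / t) * exp (- (1 / t))) has_real_derivative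
        flat ([:0, 0, 1:] * (p - pderiv p)) t) (at t)"
      using 1 by (auto intro!: derivative_eq_intros simp: flat_def field_simps power2_eq_square)
    then show ?thesis
      by (rule DERIV_cong_ev[THEN iffD1, rotated -1, OF _ refl _ refl])
        (use 1 eventually_nhds_in_open[of "{0<..}" t] in \<open>auto simp: flat_def elim: eventually_mono\<close>)
  next
    case 2
    have "((\<lambda>t. 0) has_real_derivative flat ([:0, 0, 1:] * (p - pderiv p)) t) (at t)"
      using 2 by (simp add: flat_def)
    then show ?thesis
      by (rule DERIV_cong_ev[THEN iffD1, rotated -1, OF _ refl _ refl])
        (use 2 eventually_nhds_in_open[of "{..<0}" t] in \<open>auto simp: flat_def elim: eventually_mono\<close>)
  next
    case 3
    \<comment> \<open>Dividing by \<open>h\<close> multiplies the polynomial in \<open>1/h\<close>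
      by its variable, so the difference quotient stays in the family and tends to 0.\<close>
    have "(\<lambda>h. (flat p h - flat p 0) / h) = flat (pCons 0 p)"
      by (auto simp: flat_def field_simps)
    moreover have "(flat (pCons 0 p) \<longlongrightarrow> 0) (at_left 0)"
      by (rule Lim_transform_eventually[OF tendsto_const])
        (auto simp: flat_def eventually_at_filter)
    ultimately have "((\<lambda>h. (flat p h - flat p 0) / h) \<longlongrightarrow> 0) (at 0)"
      using flat_at_right_0 by (simp add: filterlim_at_split)
    then show ?thesis using 3 by (simp add: DERIV_def flat_def)
  qed
qed

lemma Ck_on_flat: "Ck_on k UNIV (flat p)"
proof (induction k arbitrary: p)
  case 0
  then show ?case
    by (auto intro!: continuous_at_imp_continuous_on DERIV_isCont flat_has_derivative)
next
  case (Suc k)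
  show ?case
    by (rule Ck_on_SucI[OF open_UNIV flat_has_derivative[unfolded has_field_derivative_def]
          Ck_on_mult[OF open_UNIV Suc Ck_on_const]])
qed

lemma cutoff_exists:
  fixes a b :: real
  assumes "a < b"
  obtains h :: "real \<Rightarrow> real"
  where "\<And>k. Ck_on k UNIV h" "\<And>t. t \<le> a \<Longrightarrow> h t = 1" "\<And>t. t \<ge> b \<Longrightarrow> h t = 0"
proof
  let ?f = "flat 1"
  \<comment> \<open>The quotient \<open>f(b-t) / (f(b-t) + f(t-a))\<close>: since
    \<open>a < b\<close>, the two arguments cannot both be nonpositive, and the vanishing of one
    summand gives the values 1 and 0. Differences are written as sums to fit the closure rules of
    \<open>Ck_on\<close>.\<close>
  let ?h = "\<lambda>t. ?f (b + (-1) * t) * inverse (?f (b + (-1) * t) + ?f (t + (-a)))"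
  have pos: "?f s > 0 \<longleftrightarrow> s > 0" "?f s \<ge> 0" "s \<le> 0 \<Longrightarrow> ?f s = 0" for s by (auto simp: flat_def)
  have nz: "?f (b + (-1) * t) + ?f (t + (-a)) \<noteq> 0" for t
  proof -
    have "b + (-1) * t > 0 \<or> t + (-a) > 0" using assms by auto
    then show ?thesis using pos(1,2)[of "b + (-1) * t"] pos(1,2)[of "t + (-a)"] by linarith
  qed
  show "Ck_on k UNIV ?h" for k
    by (intro Ck_on_mult Ck_on_inverse Ck_on_add nz open_UNIV Ck_on_compose_real[OF _ _ Ck_on_flat]
        Ck_on_id Ck_on_const)
  show "?h t = 1" if "t \<le> a" for t
    using pos(3)[of "t + (-a)"] nz[of t] that by simp
  show "?h t = 0" if "t \<ge> b" for t
    using pos(3)[of "b + (-1) * t"] that by simp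
qed

subsection \<open>Smooth functions on a manifold\<close>

text \<open>The model space is only known to be an inner product space with a finite spanning set,
  so compactness is proved by hand. With respect to an orthogonal spanning set the coefficients of a
  vector can be bounded by its norm, and combinations with bounded coefficients lie in a compact
  set.\<close>

lemma compact_cball_span:
  fixes B :: "'b::real_inner set"
  assumes "finite B" "span B = UNIV"
  shows "compact (cball (y::'b) r)"
proof -
  obtain C where C: "finite C" "span C = (UNIV::'b set)" "pairwise orthogonal C"
    using basis_orthogonal[OF assms(1)] assms(2) by metis
  have comp: "\<exists>K. compact K \<and> (\<forall>t. (\<forall>c\<in>A. \<bar>t c\<bar> \<le> R) \<longrightarrow> (\<Sum>c\<in>A. t c *\<^sub>R c) \<in> K)"
    if "finite A" for A :: "'b set" and R :: real
    using that
  proof (induction A)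
    case empty
    then show ?case by (intro exI[of _ "{0}"]) simp
  next
    case (insert a A)
    then obtain K where K: "compact K" "\<And>t. (\<forall>c\<in>A. \<bar>t c\<bar> \<le> R) \<Longrightarrow> (\<Sum>c\<in>A. t c *\<^sub>R c) \<in> K" by blast
    have ca: "compact ((\<lambda>t. t *\<^sub>R a) ` {-R..R})"
      by (intro compact_continuous_image continuous_intros compact_Icc)
    show ?case
    proof (intro exI conjI allI impI)
      show "compact {x + y |x y. x \<in> (\<lambda>t. t *\<^sub>R a) ` {-R..R} \<and> y \<in> K}"
        by (rule compact_sums[OF ca K(1)])
      fix t assume t: "\<forall>c\<in>insert a A. \<bar>t c\<bar> \<le> R"
      then have "t a *\<^sub>R a \<in> (\<lambda>t. t *\<^sub>R a) ` {-R..R}" by (auto simp: abs_le_iff)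
      moreover have "(\<Sum>c\<in>A. t c *\<^sub>R c) \<in> K" using t K(2) by blast
      moreover have "(\<Sum>c\<in>insert a A. t c *\<^sub>R c) = t a *\<^sub>R a + (\<Sum>c\<in>A. t c *\<^sub>R c)"
        using insert.hyps by simp
      ultimately show "(\<Sum>c\<in>insert a A. t c *\<^sub>R c) \<in> {x + y |x y. x \<in> (\<lambda>t. t *\<^sub>R a) ` {-R..R} \<and> y \<in> K}"
        by blast
    qed
  qed
  \<comment> \<open>The inserted 1 keeps the set nonempty when \<open>C\<close> has no nonzero
    vector.\<close>
  obtain m where m: "m > 0" "\<And>c. c \<in> C \<Longrightarrow> c \<noteq> 0 \<Longrightarrow> m \<le> norm c"
  proof
    let ?N = "insert 1 (norm ` (C - {0}))"
    show "Min ?N > 0" using C(1) by (subst Min_gr_iff) auto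
    show "Min ?N \<le> norm c" if "c \<in> C" "c \<noteq> 0" for c using C(1) that by (intro Min_le) auto
  qed
  have ex: "\<exists>t. x = (\<Sum>c\<in>C. t c *\<^sub>R c) \<and> (\<forall>c\<in>C. \<bar>t c\<bar> \<le> norm x / m)" for x
  proof -
    have "x \<in> span C" using C(2) by simp
    then obtain u where u: "x = (\<Sum>c\<in>C. u c *\<^sub>R c)" using C(1) by (auto simp: span_finite)
    \<comment> \<open>Orthogonalization may leave the zero vector in \<open>C\<close>; its
      coefficient is not controlled by \<open>x\<close> and is set to 0.\<close>
    define t where "t c = (if c = 0 then 0 else u c)" for c
    have x: "x = (\<Sum>c\<in>C. t c *\<^sub>R c)" unfolding u by (rule sum.cong) (auto simp: t_def)
    have "\<bar>t c\<bar> \<le> norm x / m" if c: "c \<in> C" for c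
    proof (cases "c = 0")
      case True
      then show ?thesis using m(1) by (simp add: t_def)
    next
      case False
      have "x \<bullet> c = (\<Sum>d\<in>C. if d = c then t c * (c \<bullet> c) else 0)"
        unfolding x inner_sum_left
        by (rule sum.cong) (use C(3) c in \<open>auto simp: pairwise_def orthogonal_def\<close>)
      then have "x \<bullet> c = t c * (c \<bullet> c)" using C(1) c by simp
      then have "\<bar>t c\<bar> * (norm c * norm c) = \<bar>x \<bullet> c\<bar>"
        by (simp add: abs_mult power2_norm_eq_inner[symmetric] power2_eq_square)
      also have "\<dots> \<le> norm x * norm c" by (rule Cauchy_Schwarz_ineq2)
      finally have "\<bar>t c\<bar> * norm c \<le> norm x" using False by simp
      moreover have "\<bar>t c\<bar> * m \<le> \<bar>t c\<bar> * norm c" using m(2)[OF c False] by (intro mult_left_mono) auto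
      ultimately show ?thesis using m(1) by (simp add: field_simps)
    qed
    then show ?thesis using x by blast
  qed
  obtain K where K: "compact K" "\<And>t. (\<forall>c\<in>C. \<bar>t c\<bar> \<le> (norm y + r) / m) \<Longrightarrow> (\<Sum>c\<in>C. t c *\<^sub>R c) \<in> K"
    using comp[OF C(1)] by blast
  have "cball y r \<subseteq> K"
  proof
    fix x assume "x \<in> cball y r"
    then have "norm x \<le> norm y + r" by (smt (verit) dist_norm mem_cball norm_minus_commute norm_triangle_sub)
    then have le: "norm x / m \<le> (norm y + r) / m" using m(1) by (simp add: divide_right_mono)
    obtain t where "x = (\<Sum>c\<in>C. t c *\<^sub>R c)" "\<forall>c\<in>C. \<bar>t c\<bar> \<le> norm x / m" using ex by blast
    then show "x \<in> K" using K(2)[of t] le by fastforce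
  qed
  then show ?thesis using K(1) closed_cball compact_Int_closed[of K "cball y r"] by (simp add: Int_absorb1)
qed

section \<open>Charts, smooth functions and bump functions\<close>

locale smooth_manifold =
  fixes M :: "('m::{t2_space,second_countable_topology}, 'b::real_inner, 'z) manifold_scheme"
  assumes manifold: "is_manifold M"
begin

lemma chart:
  assumes "(U, \<kappa>) \<in> charts M"
  shows "open U" "open (\<kappa> ` U)" "homeomorphism U (\<kappa> ` U) \<kappa> (inv_into U \<kappa>)" "inj_on \<kappa> U"
proof -
  have "\<forall>(U, \<kappa>)\<in>charts M. open U \<and> open (\<kappa> ` U) \<and> homeomorphism U (\<kappa> ` U) \<kappa> (inv_into U \<kappa>)"
    using manifold unfolding is_manifold_def by (elim conjE)
  note c = bspec[OF this assms, unfolded prod.case]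
  show "open U" using c by (elim conjE)
  show "open (\<kappa> ` U)" using c by (elim conjE)
  show h: "homeomorphism U (\<kappa> ` U) \<kappa> (inv_into U \<kappa>)" using c by (elim conjE)
  show "inj_on \<kappa> U" using h unfolding homeomorphism_def by (intro inj_on_inverseI[of U "inv_into U \<kappa>"]) blast
qed

lemma chart_exists: obtains U \<kappa> where "(U, \<kappa>) \<in> charts M" "x \<in> U"
proof -
  have "x \<in> (\<Union>(U, \<kappa>)\<in>charts M. U)" using manifold unfolding is_manifold_def by (elim conjE) simp
  then show ?thesis using that by blast
qed

lemma chart_open_image:
  assumes "(U, \<kappa>) \<in> charts M" "open W"
  shows "open (\<kappa> ` (U \<inter> W))"
proof -
  have "openin (top_of_set (\<kappa> ` U)) (\<kappa> ` (U \<inter> W))"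
    by (rule homeomorphism_imp_open_map[OF chart(3)[OF assms(1)]]) (use assms(2) in auto)
  then show ?thesis by (rule openin_open_trans[OF _ chart(2)[OF assms(1)]])
qed

lemma Cinf_on_iff:
  "f \<in> Cinf_on M W \<longleftrightarrow> (\<forall>U \<kappa> k. (U, \<kappa>) \<in> charts M \<longrightarrow> Ck_on k (\<kappa> ` (U \<inter> W)) (\<lambda>z. f (inv_into U \<kappa> z)))"
  unfolding Cinf_on_def smooth_on_def o_def by fast

lemma Cinf_on_subset: "f \<in> Cinf_on M W \<Longrightarrow> V \<subseteq> W \<Longrightarrow> f \<in> Cinf_on M V"
  unfolding Cinf_on_iff by (meson Ck_on_subset image_mono Int_mono subset_refl)

lemma inv_chart: "(U, \<kappa>) \<in> charts M \<Longrightarrow> z \<in> \<kappa> ` (U \<inter> W) \<Longrightarrow> inv_into U \<kappa> z \<in> U \<inter> W"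
  using chart(4) by fastforce

lemma Cinf_on_cong:
  assumes "open W" "\<And>x. x \<in> W \<Longrightarrow> f x = g x" "f \<in> Cinf_on M W"
  shows "g \<in> Cinf_on M W"
  unfolding Cinf_on_iff
proof (intro allI impI)
  fix U \<kappa> k assume c: "(U, \<kappa>) \<in> charts M"
  show "Ck_on k (\<kappa> ` (U \<inter> W)) (\<lambda>z. g (inv_into U \<kappa> z))"
  proof (rule Ck_on_cong[OF chart_open_image[OF c assms(1)]])
    show "Ck_on k (\<kappa> ` (U \<inter> W)) (\<lambda>z. f (inv_into U \<kappa> z))"
      using assms(3) c unfolding Cinf_on_iff by metis
    show "f (inv_into U \<kappa> z) = g (inv_into U \<kappa> z)" if "z \<in> \<kappa> ` (U \<inter> W)" for z
      using assms(2) inv_chart[OF c that] by simp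
  qed
qed

lemma Cinf_on_local:
  assumes "\<And>x. x \<in> W \<Longrightarrow> \<exists>V. open V \<and> x \<in> V \<and> f \<in> Cinf_on M V"
  shows "f \<in> Cinf_on M W"
  unfolding Cinf_on_iff
proof (intro allI impI Ck_on_local)
  fix U \<kappa> k z assume c: "(U, \<kappa>) \<in> charts M" and "z \<in> \<kappa> ` (U \<inter> W)"
  then obtain x where x: "x \<in> U" "x \<in> W" "z = \<kappa> x" by blast
  then obtain V where V: "open V" "x \<in> V" "f \<in> Cinf_on M V" using assms by blast
  have "Ck_on k (\<kappa> ` (U \<inter> V)) (\<lambda>z. f (inv_into U \<kappa> z))"
    using V(3) c unfolding Cinf_on_iff by metis
  moreover have "z \<in> \<kappa> ` (U \<inter> V)" using x V(2) by simp
  ultimately show "\<exists>T. open T \<and> z \<in> T \<and> Ck_on k T (\<lambda>z. f (inv_into U \<kappa> z))"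
    using chart_open_image[OF c V(1)] by metis
qed

lemma Cinf_on_const: "(\<lambda>x. c) \<in> Cinf_on M W"
  by (simp add: Cinf_on_iff Ck_on_const)

lemma Cinf_on_add:
  "open W \<Longrightarrow> f \<in> Cinf_on M W \<Longrightarrow> g \<in> Cinf_on M W \<Longrightarrow> (\<lambda>x. f x + g x) \<in> Cinf_on M W"
  by (simp add: Cinf_on_iff Ck_on_add chart_open_image)

lemma Cinf_on_mult:
  "open W \<Longrightarrow> f \<in> Cinf_on M W \<Longrightarrow> g \<in> Cinf_on M W \<Longrightarrow> (\<lambda>x. f x * g x) \<in> Cinf_on M W"
  by (simp add: Cinf_on_iff Ck_on_mult chart_open_image)

lemma Cinf_on_diff:
  assumes "open W" "f \<in> Cinf_on M W" "g \<in> Cinf_on M W"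
  shows "(\<lambda>x. f x - g x) \<in> Cinf_on M W"
  using Cinf_on_add[OF assms(1,2) Cinf_on_mult[OF assms(1) Cinf_on_const[of "-1"] assms(3)]] by simp

lemma Cinf_on_sum:
  "open W \<Longrightarrow> (\<And>i. i \<in> I \<Longrightarrow> f i \<in> Cinf_on M W) \<Longrightarrow> (\<lambda>x. \<Sum>i\<in>I. f i x) \<in> Cinf_on M W"
  by (induction I rule: infinite_finite_induct) (simp_all add: Cinf_on_const Cinf_on_add)

text \<open>The bump is a cutoff of the squared distance in a chart, continued by 0 outside the
  chart domain. It vanishes off the preimage \<open>C\<close> of a closed ball; \<open>C\<close> is
  compact and hence closed because the manifold is Hausdorff. So the chart domain and the complement
  of \<open>C\<close> are open sets covering the manifold, and the function is smooth on each of
  them.\<close>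

lemma bump_exists:
  assumes "open W" "x \<in> W"
  obtains \<rho> C N where "\<rho> \<in> Cinf M" "closed C" "C \<subseteq> W" "open N" "x \<in> N"
    "\<And>y. y \<in> N \<Longrightarrow> \<rho> y = 1" "\<And>y. y \<notin> C \<Longrightarrow> \<rho> y = 0"
proof -
  obtain U \<kappa> where c: "(U, \<kappa>) \<in> charts M" and xU: "x \<in> U" by (rule chart_exists)
  have op: "open (\<kappa> ` (U \<inter> W))" by (rule chart_open_image[OF c assms(1)])
  obtain r where r: "r > 0" "cball (\<kappa> x) r \<subseteq> \<kappa> ` (U \<inter> W)"
    using op xU assms(2) open_contains_cball[of "\<kappa> ` (U \<inter> W)"] by blast
  let ?s = "r / 2"
  have "?s\<^sup>2 < r\<^sup>2" using r(1) by (simp add: power_divide)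
  then obtain h :: "real \<Rightarrow> real" where h: "\<And>k. Ck_on k UNIV h" "\<And>t. t \<le> ?s\<^sup>2 \<Longrightarrow> h t = 1" "\<And>t. t \<ge> r\<^sup>2 \<Longrightarrow> h t = 0"
    using cutoff_exists[of "?s\<^sup>2" "r\<^sup>2"] by metis
  \<comment> \<open>The squared distance is smooth at the centre too, unlike the distance, so the
    thresholds of \<open>h\<close> are squares.\<close>
  define d where "d y = \<kappa> y + - \<kappa> x" for y
  define \<rho> where "\<rho> y = (if y \<in> U then h (d y \<bullet> d y) else 0)" for y
  define C where "C = inv_into U \<kappa> ` cball (\<kappa> x) r"
  define N where "N = U \<inter> \<kappa> -` ball (\<kappa> x) ?s"
  have dd: "d y \<bullet> d y = (dist (\<kappa> x) (\<kappa> y))\<^sup>2" for y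
    unfolding d_def by (metis dist_commute dist_norm power2_norm_eq_inner diff_conv_add_uminus)
  have "\<exists>B :: 'b set. finite B \<and> span B = UNIV"
    using manifold unfolding is_manifold_def by (elim conjE)
  then obtain B :: "'b set" where B: "finite B" "span B = UNIV" by blast
  have "continuous_on (cball (\<kappa> x) r) (inv_into U \<kappa>)"
    by (rule continuous_on_subset[of "\<kappa> ` U"]) (use chart(3)[OF c] r(2) in \<open>auto simp: homeomorphism_def\<close>)
  then have "compact C" unfolding C_def
    using compact_cball_span[OF B] by (rule compact_continuous_image)
  then have C: "closed C" by (rule compact_imp_closed)
  have CW: "C \<subseteq> U \<inter> W" unfolding C_def using r(2) inv_chart[OF c] by blast
  have N: "open N" unfolding N_def
    by (rule continuous_open_preimage) (use chart[OF c] in \<open>auto simp: homeomorphism_def\<close>)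
  have xN: "x \<in> N" using xU r(1) by (simp add: N_def)
  have 1: "\<rho> y = 1" if "y \<in> N" for y
  proof -
    have "dist (\<kappa> x) (\<kappa> y) \<le> ?s" using that by (simp add: N_def)
    then have "(dist (\<kappa> x) (\<kappa> y))\<^sup>2 \<le> ?s\<^sup>2" by (intro power_mono) auto
    then show ?thesis using that h(2) by (simp add: \<rho>_def dd N_def)
  qed
  have 0: "\<rho> y = 0" if "y \<notin> C" for y
  proof (cases "y \<in> U")
    case True
    then have "y = inv_into U \<kappa> (\<kappa> y)" using chart(4)[OF c] by simp
    then have "\<kappa> y \<notin> cball (\<kappa> x) r" using that unfolding C_def by (metis imageI)
    then have "r\<^sup>2 \<le> (dist (\<kappa> x) (\<kappa> y))\<^sup>2" using r(1) by (intro power_mono) auto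
    then show ?thesis using h(3) by (simp add: \<rho>_def dd)
  qed (simp add: \<rho>_def)
  have sU: "\<rho> \<in> Cinf_on M U"
    unfolding Cinf_on_iff
  proof (intro allI impI)
    fix V \<mu> k assume v: "(V, \<mu>) \<in> charts M"
    have o: "open (\<mu> ` (V \<inter> U))" by (rule chart_open_image[OF v chart(1)[OF c]])
    \<comment> \<open>In another chart \<open>\<mu>\<close> the function \<open>d\<close> is the
      transition map up to a constant.\<close>
    have "\<forall>(U, \<kappa>)\<in>charts M. \<forall>(V, \<mu>)\<in>charts M. smooth_on (\<kappa> ` (U \<inter> V)) (\<mu> \<circ> inv_into U \<kappa>)"
      using manifold unfolding is_manifold_def by (elim conjE)
    from bspec[OF this v] c have "smooth_on (\<mu> ` (V \<inter> U)) (\<kappa> \<circ> inv_into V \<mu>)"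
      by auto
    then have t: "Ck_on k (\<mu> ` (V \<inter> U)) (\<lambda>z. \<kappa> (inv_into V \<mu> z))"
      by (simp add: smooth_on_def o_def)
    have "Ck_on k (\<mu> ` (V \<inter> U)) (\<lambda>z. d (inv_into V \<mu> z))"
      unfolding d_def by (rule Ck_on_add[OF o t Ck_on_const])
    then have "Ck_on k (\<mu> ` (V \<inter> U)) (\<lambda>z. d (inv_into V \<mu> z) \<bullet> d (inv_into V \<mu> z))"
      by (intro Ck_on_bilinear[OF o bounded_bilinear_inner])
    then have "Ck_on k (\<mu> ` (V \<inter> U)) (\<lambda>z. h (d (inv_into V \<mu> z) \<bullet> d (inv_into V \<mu> z)))"
      by (rule Ck_on_compose_real[OF o _ h(1)])
    then show "Ck_on k (\<mu> ` (V \<inter> U)) (\<lambda>z. \<rho> (inv_into V \<mu> z))"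
      by (rule Ck_on_cong[OF o, rotated]) (use inv_chart[OF v] in \<open>auto simp: \<rho>_def\<close>)
  qed
  have sC: "\<rho> \<in> Cinf_on M (- C)"
    by (rule Cinf_on_cong[OF _ _ Cinf_on_const[of 0]]) (use C 0 in auto)
  have "\<rho> \<in> Cinf M"
  proof (rule Cinf_on_local)
    fix y show "\<exists>V. open V \<and> y \<in> V \<and> \<rho> \<in> Cinf_on M V"
    proof (cases "y \<in> C")
      case True
      then show ?thesis using sU CW chart(1)[OF c] by blast
    next
      case False
      then show ?thesis using sC C by (intro exI[of _ "-C"]) auto
    qed
  qed
  then show ?thesis using that[of \<rho> C N] C CW N xN 1 0 by blast
qed

text \<open>\<open>f\<close> is arbitrary outside \<open>W\<close>; the product is smooth there
  because it vanishes on the open complement of \<open>C\<close>. This is how local coefficients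
  become global functions.\<close>

lemma bump_mult:
  assumes "\<rho> \<in> Cinf M" "closed C" "C \<subseteq> W" "open W" "\<And>y. y \<notin> C \<Longrightarrow> \<rho> y = 0" "f \<in> Cinf_on M (V \<inter> W)" "open V"
  shows "(\<lambda>y. \<rho> y * f y) \<in> Cinf_on M V"
proof (rule Cinf_on_local)
  fix y assume y: "y \<in> V"
  have o: "open (V \<inter> W)" "open (- C)" using assms(2,4,7) by (simp_all add: open_Int open_Compl)
  have 1: "(\<lambda>y. \<rho> y * f y) \<in> Cinf_on M (V \<inter> W)"
    by (rule Cinf_on_mult[OF o(1) Cinf_on_subset[OF assms(1) subset_UNIV] assms(6)])
  have 2: "(\<lambda>y. \<rho> y * f y) \<in> Cinf_on M (- C)"
    by (rule Cinf_on_cong[OF o(2) _ Cinf_on_const[of 0]]) (simp add: assms(5))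
  show "\<exists>V. open V \<and> y \<in> V \<and> (\<lambda>y. \<rho> y * f y) \<in> Cinf_on M V"
  proof (cases "y \<in> C")
    case True
    then show ?thesis using y assms(3) o(1) 1 by (intro exI[of _ "V \<inter> W"]) blast
  next
    case False
    then show ?thesis using o(2) 2 by (intro exI[of _ "- C"]) blast
  qed
qed

end

section \<open>The signed shuffle product\<close>

text \<open>Interior multiplication by \<open>a\<close>.\<close>

definition contract :: "'a \<Rightarrow> ('a list \<Rightarrow> real) \<Rightarrow> 'a list \<Rightarrow> real" where
  "contract a u = (\<lambda>k. u (a # k))"

text \<open>The parity involution: it supplies the sign for passing an argument across all arguments
  of \<open>u\<close>, also when \<open>u\<close> is not homogeneous.\<close>

definition grade :: "('a list \<Rightarrow> real) \<Rightarrow> 'a list \<Rightarrow> real" where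
  "grade u = (\<lambda>k. (- 1) ^ length k * u k)"

text \<open>The first argument goes either to \<open>u\<close>, or to \<open>v\<close> after passing all arguments of \<open>u\<close>. This recursion
  makes sense for arbitrary functions on lists, and the algebraic laws of the exterior product
  hold in this generality.\<close>

fun shuffle_prod :: "('a list \<Rightarrow> real) \<Rightarrow> ('a list \<Rightarrow> real) \<Rightarrow> 'a list \<Rightarrow> real" where
  "shuffle_prod u v [] = u [] * v []"
| "shuffle_prod u v (a # l) = shuffle_prod (contract a u) v l + shuffle_prod (grade u) (contract a v) l"

lemma contract_apply: "contract a u k = u (a # k)"
  by (simp add: contract_def)

lemma contract_shuffle_prod:
  "contract a (shuffle_prod u v) = (\<lambda>l. shuffle_prod (contract a u) v l + shuffle_prod (grade u) (contract a v) l)"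
  by (simp add: contract_def)

lemma contract_linear: "contract a (\<lambda>k. c * u k + d * v k) = (\<lambda>k. c * contract a u k + d * contract a v k)"
  by (simp add: contract_def)

lemma grade_linear: "grade (\<lambda>k. c * u k + d * v k) = (\<lambda>k. c * grade u k + d * grade v k)"
  by (simp add: grade_def fun_eq_iff algebra_simps)

lemma grade_grade [simp]: "grade (grade u) = u"
  by (simp add: grade_def fun_eq_iff flip: mult.assoc power_mult_distrib)

text \<open>Interior multiplication lowers the degree by one, hence anticommutes with the parity
  involution. The right-hand side is written as a linear combination, with second coefficient 0, so
  that \<open>shuffle_prod_linear_left\<close> rewrites it.\<close>

lemma contract_grade: "contract a (grade u) = (\<lambda>k. - 1 * grade (contract a u) k + 0 * u k)"
  by (simp add: contract_def grade_def)

lemma shuffle_prod_linear_left: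
  "shuffle_prod (\<lambda>k. c * u k + d * u' k) v l = c * shuffle_prod u v l + d * shuffle_prod u' v l"
  by (induction l arbitrary: u u' v) (simp_all add: contract_linear grade_linear algebra_simps)

lemma shuffle_prod_linear_right:
  "shuffle_prod u (\<lambda>k. c * v k + d * v' k) l = c * shuffle_prod u v l + d * shuffle_prod u v' l"
  by (induction l arbitrary: u v v') (simp_all add: contract_linear algebra_simps)

lemma shuffle_prod_zero [simp]: "shuffle_prod (\<lambda>k. 0) v l = 0" "shuffle_prod u (\<lambda>k. 0) l = 0"
  using shuffle_prod_linear_left[of 0 u 0 u v l] shuffle_prod_linear_right[of u 0 v 0 v l] by simp_all

lemma shuffle_prod_add_left:
  "shuffle_prod (\<lambda>k. u k + u' k) v l = shuffle_prod u v l + shuffle_prod u' v l"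
  using shuffle_prod_linear_left[of 1 u 1 u'] by simp

lemma shuffle_prod_add_right:
  "shuffle_prod u (\<lambda>k. v k + v' k) l = shuffle_prod u v l + shuffle_prod u v' l"
  using shuffle_prod_linear_right[of u 1 v 1 v'] by simp

lemma shuffle_prod_scale_left: "shuffle_prod (\<lambda>k. c * u k) v l = c * shuffle_prod u v l"
  using shuffle_prod_linear_left[of c u 0 u] by simp

lemma shuffle_prod_scale_right: "shuffle_prod u (\<lambda>k. c * v k) l = c * shuffle_prod u v l"
  using shuffle_prod_linear_right[of u c v 0 v] by simp

lemma shuffle_prod_sum_left:
  "shuffle_prod (\<lambda>k. \<Sum>i\<in>I. u i k) v l = (\<Sum>i\<in>I. shuffle_prod (u i) v l)"
  by (induction I rule: infinite_finite_induct) (simp_all add: shuffle_prod_add_left)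

lemma shuffle_prod_sum_right:
  "shuffle_prod u (\<lambda>k. \<Sum>i\<in>I. v i k) l = (\<Sum>i\<in>I. shuffle_prod u (v i) l)"
  by (induction I rule: infinite_finite_induct) (simp_all add: shuffle_prod_add_right)

text \<open>The parity involution is multiplicative because the lengths of the two parts of the list
  add up.\<close>

lemma grade_shuffle_prod: "grade (shuffle_prod u v) = shuffle_prod (grade u) (grade v)"
proof
  show "grade (shuffle_prod u v) l = shuffle_prod (grade u) (grade v) l" for l
  proof (induction l arbitrary: u v)
    case (Cons a l)
    have "grade (shuffle_prod u v) (a # l) =
        - (grade (shuffle_prod (contract a u) v) l + grade (shuffle_prod (grade u) (contract a v)) l)"
      by (simp add: grade_def algebra_simps)
    then show ?case
      by (simp only: Cons contract_grade shuffle_prod_linear_left shuffle_prod_linear_right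
          shuffle_prod.simps)
  qed (simp add: grade_def)
qed

text \<open>Contraction is a graded derivation and \<open>grade\<close> is multiplicative, so both
  sides expand into the same three products on the shorter list.\<close>

lemma shuffle_prod_assoc:
  "shuffle_prod (shuffle_prod u v) w = shuffle_prod u (shuffle_prod v w)"
proof
  show "shuffle_prod (shuffle_prod u v) w l = shuffle_prod u (shuffle_prod v w) l" for l
    by (induction l arbitrary: u v w)
      (simp_all add: contract_shuffle_prod grade_shuffle_prod shuffle_prod_add_left shuffle_prod_add_right)
qed

lemma contract_Nil_only: "contract a (\<lambda>k. if k = [] then c else 0) = (\<lambda>k. 0)"
  by (simp add: contract_def)

lemma grade_Nil_only: "grade (\<lambda>k. if k = [] then c else 0) = (\<lambda>k. if k = [] then c else 0)"
  by (auto simp: grade_def)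

lemma shuffle_prod_scalar_left: "shuffle_prod (\<lambda>k. if k = [] then c else 0) u l = c * u l"
  by (induction l arbitrary: u) (simp_all add: contract_Nil_only grade_Nil_only contract_apply)

lemma shuffle_prod_scalar_right: "shuffle_prod u (\<lambda>k. if k = [] then c else 0) l = c * u l"
  by (induction l arbitrary: u) (simp_all add: contract_Nil_only contract_apply)

lemma contract_1form:
  assumes "\<And>k. length k \<noteq> 1 \<Longrightarrow> \<eta> k = 0"
  shows "contract a \<eta> = (\<lambda>k. if k = [] then \<eta> [a] else 0)"
  using assms by (auto simp: contract_def)

lemma grade_1form:
  assumes "\<And>k. length k \<noteq> 1 \<Longrightarrow> \<eta> k = 0"
  shows "grade \<eta> = (\<lambda>k. - 1 * \<eta> k)"
  unfolding grade_def
proof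
  show "(- 1) ^ length k * \<eta> k = - 1 * \<eta> k" for k
    using assms[of k] by (cases "length k = 1") simp_all
qed

text \<open>The recursion becomes expansion along the first argument: contracting a 1-form leaves a
  scalar, and \<open>grade\<close> multiplies a 1-form by -1.\<close>

lemma shuffle_prod_1form_Cons:
  assumes "\<And>k. length k \<noteq> 1 \<Longrightarrow> \<eta> k = 0"
  shows "shuffle_prod \<eta> u (a # l) = \<eta> [a] * u l - shuffle_prod \<eta> (contract a u) l"
  by (simp add: contract_1form[OF assms] grade_1form[OF assms] shuffle_prod_scalar_left
      shuffle_prod_scale_left[of "-1", simplified])

text \<open>Graded commutativity against a 1-form. The sign \<open>(-1)^k\<close> is absorbed into
  \<open>grade\<close>, which covers \<open>u\<close> of mixed degree.\<close>

lemma shuffle_prod_1form_commute: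
  assumes "\<And>k. length k \<noteq> 1 \<Longrightarrow> \<eta> k = 0"
  shows "shuffle_prod \<eta> u = shuffle_prod (grade u) \<eta>"
proof
  show "shuffle_prod \<eta> u l = shuffle_prod (grade u) \<eta> l" for l
  proof (induction l arbitrary: u)
    case Nil
    then show ?case using assms[of "[]"] by simp
  next
    case (Cons a l)
    have "shuffle_prod (grade u) \<eta> (a # l) = - shuffle_prod (grade (contract a u)) \<eta> l + \<eta> [a] * u l"
      by (simp add: contract_grade shuffle_prod_scale_left[of "-1", simplified] contract_1form[OF assms]
          shuffle_prod_scalar_right)
    then show ?case by (simp add: shuffle_prod_1form_Cons[OF assms] Cons del: shuffle_prod.simps)
  qed
qed

lemma shuffle_prod_degree:
  assumes "\<And>k. length k \<noteq> m \<Longrightarrow> u k = 0" "\<And>k. length k \<noteq> n \<Longrightarrow> v k = 0" "length l \<noteq> m + n"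
  shows "shuffle_prod u v l = 0"
  using assms
proof (induction l arbitrary: u v m n)
  case Nil
  then show ?case by fastforce
next
  case (Cons a l)
  have "shuffle_prod (contract a u) v l = 0"
  proof (cases m)
    case 0
    then have "contract a u = (\<lambda>k. 0)" using Cons.prems(1) by (simp add: contract_def)
    then show ?thesis by simp
  next
    case (Suc m')
    show ?thesis by (rule Cons.IH[of m' _ n]) (use Cons.prems Suc in \<open>auto simp: contract_apply\<close>)
  qed
  moreover have "shuffle_prod (grade u) (contract a v) l = 0"
  proof (cases n)
    case 0
    then have "contract a v = (\<lambda>k. 0)" using Cons.prems(2) by (simp add: contract_def)
    then show ?thesis by simp
  next
    case (Suc n')
    show ?thesis by (rule Cons.IH[of m _ n']) (use Cons.prems Suc in \<open>auto simp: grade_def contract_apply\<close>)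
  qed
  ultimately show ?case by simp
qed

section \<open>Comparison with the sum over shuffles\<close>

lemma Pow_lessThan_Suc: "Pow {..<Suc n} = (`) Suc ` Pow {..<n} \<union> (\<lambda>T. insert 0 (Suc ` T)) ` Pow {..<n}"
proof -
  have "Pow {..<Suc n} = Pow (insert 0 (Suc ` {..<n}))" by (simp add: lessThan_Suc_eq_insert_0)
  then show ?thesis unfolding Pow_insert image_Pow_surj[OF refl, symmetric] by (simp add: image_image)
qed

lemma finite_inversions: "finite {(i, j). i < n \<and> j < i \<and> i \<in> S \<and> j \<notin> (S::nat set)}"
  by (rule finite_subset[of _ "{..<n} \<times> {..<n}"]) auto

text \<open>After all positions are shifted by one, a new position 0 that belongs to the set creates
  no inversion; if it does not belong, it forms one inversion with each shifted element of
  \<open>T\<close>. The factor \<open>(-1)^card T\<close> is what \<open>grade\<close> contributes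
  in the recursion.\<close>

lemma shuffle_sign_Suc:
  assumes "T \<subseteq> {..<n}"
  shows "shuffle_sign (Suc n) (insert 0 (Suc ` T)) = shuffle_sign n T"
    and "shuffle_sign (Suc n) (Suc ` T) = (- 1) ^ card T * shuffle_sign n T"
proof -
  let ?P = "\<lambda>n S. {(i, j). i < n \<and> j < i \<and> i \<in> S \<and> j \<notin> (S::nat set)}"
  have c: "card (map_prod Suc Suc ` X) = card X" for X
    by (rule card_image) (auto simp: inj_on_def)
  have "?P (Suc n) (insert 0 (Suc ` T)) = map_prod Suc Suc ` ?P n T"
    by (auto simp: image_iff less_Suc_eq_0_disj) blast
  then show "shuffle_sign (Suc n) (insert 0 (Suc ` T)) = shuffle_sign n T"
    by (simp only: shuffle_sign_def c)
  have "?P (Suc n) (Suc ` T) = map_prod Suc Suc ` ?P n T \<union> (\<lambda>i. (Suc i, 0)) ` T"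
    using assms by (auto simp: image_iff less_Suc_eq_0_disj) blast
  moreover have "map_prod Suc Suc ` ?P n T \<inter> (\<lambda>i. (Suc i, 0)) ` T = {}" by auto
  moreover have "finite T" using assms finite_subset by blast
  ultimately have "card (?P (Suc n) (Suc ` T)) = card (?P n T) + card T"
    by (simp add: card_Un_disjoint finite_inversions c card_image inj_on_def)
  then show "shuffle_sign (Suc n) (Suc ` T) = (- 1) ^ card T * shuffle_sign n T"
    by (simp add: shuffle_sign_def power_add)
qed

lemma sum_Pow_lessThan_Suc:
  fixes g :: "nat set \<Rightarrow> real"
  shows "(\<Sum>S\<in>Pow {..<Suc n}. g S) = (\<Sum>T\<in>Pow {..<n}. g (insert 0 (Suc ` T))) + (\<Sum>T\<in>Pow {..<n}. g (Suc ` T))"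
proof -
  have inj: "inj_on ((`) Suc) (Pow {..<n})" by (simp add: inj_on_def inj_image_eq_iff)
  have inj': "inj_on (\<lambda>T. insert 0 (Suc ` T)) (Pow {..<n})"
  proof (rule inj_onI)
    fix S T :: "nat set" assume "insert 0 (Suc ` S) = insert 0 (Suc ` T)"
    then have "Suc ` S = Suc ` T" by auto
    then show "S = T" by (simp add: inj_image_eq_iff)
  qed
  have "(`) Suc ` Pow {..<n} \<inter> (\<lambda>T. insert 0 (Suc ` T)) ` Pow {..<n} = {}" by auto
  then show ?thesis
    unfolding Pow_lessThan_Suc
    by (simp add: sum.union_disjoint sum.reindex[OF inj] sum.reindex[OF inj'])
qed

text \<open>Sets of positions are split according to whether they contain position 0; the two
  classes are the two summands of the recursion.\<close>

lemma shuffle_prod_eq_sum: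
  "(\<Sum>S\<in>Pow {..<length l}. shuffle_sign (length l) S * u (nths l S) * v (nths l (- S))) = shuffle_prod u v l"
proof (induction l arbitrary: u v)
  case Nil
  then show ?case by (simp add: shuffle_sign_def)
next
  case (Cons a l)
  let ?n = "length l"
  have s: "{j. Suc j \<in> Suc ` T} = T" "{j. Suc j \<notin> Suc ` T} = - T" for T by auto
  have "shuffle_sign (Suc ?n) (insert 0 (Suc ` T)) * u (nths (a # l) (insert 0 (Suc ` T))) *
        v (nths (a # l) (- insert 0 (Suc ` T))) =
      shuffle_sign ?n T * contract a u (nths l T) * v (nths l (- T))" if "T \<in> Pow {..<?n}" for T
    using that by (simp add: shuffle_sign_Suc nths_Cons s contract_apply)
  moreover have "shuffle_sign (Suc ?n) (Suc ` T) * u (nths (a # l) (Suc ` T)) * v (nths (a # l) (- (Suc ` T))) =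
      shuffle_sign ?n T * grade u (nths l T) * contract a v (nths l (- T))" if "T \<in> Pow {..<?n}" for T
  proof -
    have "length (nths l T) = card T"
      unfolding length_nths using that by (intro arg_cong[of _ _ card]) auto
    then show ?thesis using that by (simp add: shuffle_sign_Suc nths_Cons s grade_def contract_apply)
  qed
  ultimately show ?case
    by (simp add: sum_Pow_lessThan_Suc Cons[symmetric])
qed

lemma wedge_eq: "wedge \<omega> \<tau> = (\<lambda>x. shuffle_prod (\<omega> x) (\<tau> x))"
  by (simp add: wedge_def shuffle_prod_eq_sum fun_eq_iff)

subsection \<open>Alternating forms\<close>

lemma lin_onD: "lin_on F g \<Longrightarrow> a \<in> F \<Longrightarrow> b \<in> F \<Longrightarrow> g (c *\<^sub>R a + d *\<^sub>R b) = c *\<^sub>R g a + d *\<^sub>R g b"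
  by (simp add: lin_on_def)

lemma lin_on_zero:
  assumes "subspace F" "lin_on F g"
  shows "g 0 = 0"
  using lin_onD[OF assms(2), of 0 0 0 0] assms(1) by (simp add: subspace_0)

lemma lin_on_sum:
  assumes "subspace F" "lin_on F g" "\<And>i. i \<in> I \<Longrightarrow> f i \<in> F"
  shows "g (\<Sum>i\<in>I. c i *\<^sub>R f i) = (\<Sum>i\<in>I. c i *\<^sub>R g (f i))"
  using assms(3)
proof (induction I rule: infinite_finite_induct)
  case (insert i I)
  have "(\<Sum>i\<in>I. c i *\<^sub>R f i) \<in> F" using insert.prems by (intro subspace_sum subspace_scale assms(1)) auto
  then have "g (c i *\<^sub>R f i + 1 *\<^sub>R (\<Sum>i\<in>I. c i *\<^sub>R f i)) = c i *\<^sub>R g (f i) + 1 *\<^sub>R g (\<Sum>i\<in>I. c i *\<^sub>R f i)"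
    using insert.prems by (intro lin_onD[OF assms(2)]) auto
  then show ?case using insert by simp
qed (simp_all add: lin_on_zero[OF assms(1,2)])

lemma lin_on_scale:
  assumes "subspace F" "lin_on F g" "a \<in> F"
  shows "g (c *\<^sub>R a) = c *\<^sub>R g a"
  using lin_on_sum[OF assms(1,2), of "{()}" "\<lambda>_. a" "\<lambda>_. c"] assms(3) by simp

lemma alternating_on_lin:
  "alternating_on F w \<Longrightarrow> l \<in> lists F \<Longrightarrow> l' \<in> lists F \<Longrightarrow> lin_on F (\<lambda>a. w (l @ a # l'))"
  by (simp add: alternating_on_def)

lemma alternating_on_nondistinct: "alternating_on F w \<Longrightarrow> \<not> distinct l \<Longrightarrow> w l = 0"
  unfolding alternating_on_def by metis

lemma alternating_on_outside: "alternating_on F w \<Longrightarrow> l \<notin> lists F \<Longrightarrow> w l = 0"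
  by (simp add: alternating_on_def)

text \<open>Equal neighbours suffice: polarization gives a change of sign when two neighbours are
  exchanged, and by such exchanges any two equal arguments become neighbours.\<close>

lemma alternating_onI:
  assumes lin: "\<And>l l'. l \<in> lists F \<Longrightarrow> l' \<in> lists F \<Longrightarrow> lin_on F (\<lambda>a. w (l @ a # l'))"
    and adj: "\<And>l l' a. l \<in> lists F \<Longrightarrow> l' \<in> lists F \<Longrightarrow> a \<in> F \<Longrightarrow> w (l @ a # a # l') = 0"
    and out: "\<And>l. l \<notin> lists F \<Longrightarrow> w l = 0"
    and F: "subspace F"
  shows "alternating_on F w"
proof -
  have swap: "w (l @ a # b # l') = - w (l @ b # a # l')"
    if m: "l \<in> lists F" "l' \<in> lists F" "a \<in> F" "b \<in> F" for l l' a b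
  proof -
    have ab: "a + b \<in> F" using m F by (simp add: subspace_add)
    have 1: "w (l @ (a + b) # c # l') = w (l @ a # c # l') + w (l @ b # c # l')" if "c \<in> F" for c
      using lin_onD[OF lin[of l "c # l'"], of a b 1 1] m that by simp
    have 2: "w (l @ c # (a + b) # l') = w (l @ c # a # l') + w (l @ c # b # l')" if "c \<in> F" for c
      using lin_onD[OF lin[of "l @ [c]" "l'"], of a b 1 1] m that by simp
    show ?thesis
      using adj[OF m(1,2) ab] adj[OF m(1,2,3)] adj[OF m(1,2,4)] 1[OF ab] 2[OF m(3)] 2[OF m(4)] by simp
  qed
  have rep: "w (l1 @ a # l2 @ a # l3) = 0"
    if "l1 \<in> lists F" "l2 \<in> lists F" "l3 \<in> lists F" "a \<in> F" for l1 l2 l3 a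
    using that
  proof (induction l2 arbitrary: l1)
    case Nil
    then show ?case using adj by simp
  next
    case (Cons b l2)
    then show ?case using swap[of l1 "l2 @ a # l3" a b] Cons.IH[of "l1 @ [b]"] by simp
  qed
  have "w l = 0" if l: "l \<in> lists F" and nd: "\<not> distinct l" for l
  proof -
    obtain xs ys zs y where "l = xs @ [y] @ ys @ [y] @ zs" using not_distinct_decomp[OF nd] by blast
    then show ?thesis using rep[of xs ys zs y] l by simp
  qed
  then show ?thesis unfolding alternating_on_def using lin out by blast
qed

lemma alternating_on_contract:
  assumes "alternating_on F w"
  shows "alternating_on F (contract a w)"
proof (cases "a \<in> F")
  case True
  then show ?thesis
    unfolding alternating_on_def
    using alternating_on_lin[OF assms, of "a # l" for l] alternating_on_nondistinct[OF assms]
      alternating_on_outside[OF assms] by (auto simp: contract_apply)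
next
  case False
  then have "contract a w = (\<lambda>k. 0)" using alternating_on_outside[OF assms] by (simp add: contract_def)
  then show ?thesis by (simp add: alternating_on_def lin_on_def)
qed

lemma alternating_on_linear:
  assumes "alternating_on F u" "alternating_on F v"
  shows "alternating_on F (\<lambda>k. c * u k + d * v k)"
  using assms unfolding alternating_on_def lin_on_def by (simp add: algebra_simps)

lemma alternating_on_zero: "alternating_on F (\<lambda>k. 0)"
  by (simp add: alternating_on_def lin_on_def)

lemma alternating_on_grade:
  assumes "alternating_on F u"
  shows "alternating_on F (grade u)"
  using assms unfolding alternating_on_def lin_on_def grade_def by (simp add: algebra_simps)

lemma contract_lin:
  assumes "alternating_on F w" "a \<in> F" "b \<in> F" "subspace F"
  shows "contract (c *\<^sub>R a + d *\<^sub>R b) w = (\<lambda>k. c * contract a w k + d * contract b w k)"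
proof
  fix k
  show "contract (c *\<^sub>R a + d *\<^sub>R b) w k = c * contract a w k + d * contract b w k"
  proof (cases "k \<in> lists F")
    case True
    then show ?thesis using lin_onD[OF alternating_on_lin[OF assms(1), of "[]" k], of a b] assms
      by (simp add: contract_apply)
  next
    case False
    then show ?thesis using alternating_on_outside[OF assms(1)] by (simp add: contract_apply)
  qed
qed

lemma contract_outside: "alternating_on F w \<Longrightarrow> a \<notin> F \<Longrightarrow> contract a w = (\<lambda>k. 0)"
  by (simp add: contract_def alternating_on_outside)

lemma contract_contract: "alternating_on F w \<Longrightarrow> contract a (contract a w) = (\<lambda>k. 0)"
  by (simp add: contract_def alternating_on_nondistinct)

text \<open>Polarization of \<open>contract_contract\<close>: the double contraction with
  \<open>a + b\<close> is expanded. For arguments outside \<open>F\<close> both sides vanish by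
  convention.\<close>

lemma contract_swap:
  assumes "alternating_on F w" "subspace F"
  shows "contract a (contract b w) k = - contract b (contract a w) k"
proof (cases "a \<in> F \<and> b \<in> F")
  case True
  then have ab: "a + b \<in> F" using assms(2) by (simp add: subspace_add)
  have *: "contract (a + b) u = (\<lambda>k. contract a u k + contract b u k)" if "alternating_on F u" for u
    using contract_lin[OF that, of a b 1 1] True assms(2) by simp
  have "contract (a + b) (contract (a + b) w) k = 0" by (simp add: contract_contract[OF assms(1)])
  then have "contract a (contract (a + b) w) k + contract b (contract (a + b) w) k = 0"
    by (simp add: *[OF alternating_on_contract[OF assms(1)]])
  then show ?thesis
    using contract_contract[OF assms(1), of a] contract_contract[OF assms(1), of b]
    unfolding *[OF assms(1)] by (simp add: fun_eq_iff contract_apply)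
next
  case False
  then show ?thesis using alternating_on_outside[OF assms(1)] by (auto simp: contract_apply)
qed

text \<open>All conditions follow by recursion on the list. For two equal leading arguments the
  terms with a double contraction vanish, and the two mixed terms cancel because
  \<open>contract\<close> and \<open>grade\<close> anticommute.\<close>

lemma alternating_on_shuffle_prod:
  assumes "alternating_on F u" "alternating_on F v" "subspace F"
  shows "alternating_on F (shuffle_prod u v)"
proof (rule alternating_onI[OF _ _ _ assms(3)])
  fix l l' :: "'a list" assume m: "l \<in> lists F" "l' \<in> lists F"
  show "lin_on F (\<lambda>a. shuffle_prod u v (l @ a # l'))"
    using m(1) assms(1,2)
  proof (induction l arbitrary: u v)
    case Nil
    then show ?case
      by (simp add: lin_on_def contract_lin assms(3) shuffle_prod_linear_left shuffle_prod_linear_right algebra_simps)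
  next
    case (Cons b l)
    have 1: "lin_on F (\<lambda>a. shuffle_prod (contract b u) v (l @ a # l'))"
      "lin_on F (\<lambda>a. shuffle_prod (grade u) (contract b v) (l @ a # l'))"
      by (rule Cons.IH; use Cons.prems in \<open>simp add: alternating_on_contract alternating_on_grade\<close>)+
    then show ?case by (simp add: lin_on_def algebra_simps)
  qed
  fix a assume a: "a \<in> F"
  show "shuffle_prod u v (l @ a # a # l') = 0"
    using m(1) assms(1,2)
  proof (induction l arbitrary: u v)
    case Nil
    then show ?case
      by (simp add: contract_contract contract_grade shuffle_prod_scale_left[of "-1", simplified])
  next
    case (Cons b l)
    then show ?case by (simp add: alternating_on_contract alternating_on_grade)
  qed
next
  fix l assume "l \<notin> lists F"
  then show "shuffle_prod u v l = 0"
    using assms(1,2)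
  proof (induction l arbitrary: u v)
    case (Cons b l)
    show ?case
    proof (cases "b \<in> F")
      case True
      then show ?thesis using Cons by (simp add: alternating_on_contract alternating_on_grade)
    next
      case False
      then show ?thesis using Cons.prems by (simp add: contract_outside)
    qed
  qed simp
qed

text \<open>Euler's identity in one fibre: the sum is the number operator on alternating forms.
  Exchanging contraction with the first argument \<open>a\<close> and with \<open>e i\<close> costs
  a sign that cancels the one in the product with a 1-form, so this part counts
  \<open>length l\<close>; expanding \<open>a\<close> in the frame gives the remaining 1.\<close>

lemma sum_shuffle_prod_contract:
  assumes "alternating_on F w" "subspace F" "l \<in> lists F"
    and "\<And>i k. i < r \<Longrightarrow> length k \<noteq> 1 \<Longrightarrow> \<epsilon> i k = 0"
    and "\<And>i. i < r \<Longrightarrow> e i \<in> F" "\<And>a. a \<in> F \<Longrightarrow> a = (\<Sum>i<r. \<epsilon> i [a] *\<^sub>R e i)"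
  shows "(\<Sum>i<r. shuffle_prod (\<epsilon> i) (contract (e i) w) l) = real (length l) * w l"
  using assms(1,3)
proof (induction l arbitrary: w)
  case Nil
  then show ?case using assms(4) by simp
next
  case (Cons a l)
  have "w (a # l) = (\<Sum>i<r. \<epsilon> i [a] *\<^sub>R w (e i # l))"
    using lin_on_sum[OF assms(2) alternating_on_lin[OF Cons.prems(1), of "[]" l], of "{..<r}" e "\<lambda>i. \<epsilon> i [a]"]
      Cons.prems assms(5,6) by simp
  moreover have "(\<Sum>i<r. shuffle_prod (\<epsilon> i) (contract a (contract (e i) w)) l) = - (real (length l) * w (a # l))"
  proof -
    have "contract a (contract (e i) w) = (\<lambda>k. - 1 * contract (e i) (contract a w) k)" for i
      using contract_swap[OF Cons.prems(1) assms(2), of a "e i"] by auto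
    then have "(\<Sum>i<r. shuffle_prod (\<epsilon> i) (contract a (contract (e i) w)) l) =
        - (\<Sum>i<r. shuffle_prod (\<epsilon> i) (contract (e i) (contract a w)) l)"
      by (simp only: shuffle_prod_scale_right) (simp add: sum_negf)
    then show ?thesis
      using Cons.IH[OF alternating_on_contract[OF Cons.prems(1), of a], unfolded contract_apply[of a w l]] Cons.prems(2)
      by simp
  qed
  moreover have "(\<Sum>i<r. shuffle_prod (\<epsilon> i) (contract (e i) w) (a # l)) =
      (\<Sum>i<r. \<epsilon> i [a] * w (e i # l)) - (\<Sum>i<r. shuffle_prod (\<epsilon> i) (contract a (contract (e i) w)) l)"
    unfolding sum_subtractf[symmetric]
    by (rule sum.cong) (use assms(4) in \<open>simp_all add: shuffle_prod_1form_Cons contract_apply del: shuffle_prod.simps\<close>)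
  ultimately show ?case by (simp add: algebra_simps)
qed

text \<open>By multilinearity the arguments are replaced by frame vectors one at a time.\<close>

lemma alternating_on_frame_eq_0:
  assumes "alternating_on F w" "subspace F" "\<And>i. i < r \<Longrightarrow> e i \<in> F"
    and "\<And>a. a \<in> F \<Longrightarrow> \<exists>c. a = (\<Sum>i<r. c i *\<^sub>R e i)"
    and "\<And>I. I \<in> lists {..<r} \<Longrightarrow> length I = length l \<Longrightarrow> w (map e I) = 0"
  shows "w l = 0"
  using assms(1,5)
proof (induction l arbitrary: w)
  case Nil
  then show ?case using Nil.prems(2)[of "[]"] by simp
next
  case (Cons a l)
  show ?case
  proof (cases "a # l \<in> lists F")
    case True
    then obtain c where c: "a = (\<Sum>i<r. c i *\<^sub>R e i)" using assms(4) by auto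
    have "contract (e i) w l = 0" if "i < r" for i
    proof (rule Cons.IH[OF alternating_on_contract[OF Cons.prems(1)]])
      fix I assume "I \<in> lists {..<r}" "length I = length l"
      then show "contract (e i) w (map e I) = 0" using Cons.prems(2)[of "i # I"] that by (simp add: contract_apply)
    qed
    then have "(\<Sum>i<r. c i *\<^sub>R w (e i # l)) = 0" by (simp add: contract_apply)
    then show ?thesis
      using lin_on_sum[OF assms(2) alternating_on_lin[OF Cons.prems(1), of "[]" l], of "{..<r}" e c] c True assms(3)
      by simp
  next
    case False
    then show ?thesis by (rule alternating_on_outside[OF Cons.prems(1)])
  qed
qed

text \<open>Pigeonhole: in a list of more than \<open>r\<close> frame vectors one is
  repeated.\<close>

lemma alternating_on_degree_gt_rank:
  assumes "alternating_on F w" "subspace F" "\<And>i. i < r \<Longrightarrow> e i \<in> F"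
    and "\<And>a. a \<in> F \<Longrightarrow> \<exists>c. a = (\<Sum>i<r. c i *\<^sub>R e i)" "length l > r"
  shows "w l = 0"
proof (rule alternating_on_frame_eq_0[OF assms(1-4)])
  fix I assume I: "I \<in> lists {..<r}" "length I = length l"
  then have "card (set I) \<le> r" by (metis card_lessThan card_mono finite_lessThan in_listsD subsetI)
  then have "\<not> distinct I" using I(2) assms(5) by (auto dest: distinct_card)
  then have "\<not> distinct (map e I)" by (simp add: distinct_map)
  then show "w (map e I) = 0" by (rule alternating_on_nondistinct[OF assms(1)])
qed

section \<open>Frames and sections\<close>

locale smooth_bundle =
  fixes E :: "('m::{t2_space,second_countable_topology}, 'b::real_inner, 'e::real_vector, 'z) vbundle_scheme"
  assumes vbundle: "is_vbundle E"
begin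

sublocale smooth_manifold E
  by unfold_locales (use vbundle in \<open>simp add: is_vbundle_def\<close>)

lemma triv_exists: obtains U e where "(U, e) \<in> trivs E" "x \<in> U"
proof -
  have "(\<Union>(U, e)\<in>trivs E. U) = UNIV" using vbundle unfolding is_vbundle_def by (elim conjE)
  then have "x \<in> (\<Union>(U, e)\<in>trivs E. U)" by simp
  then show ?thesis using that by blast
qed

lemma triv:
  assumes "(U, e) \<in> trivs E"
  shows triv_open: "open U"
    and triv_inj: "x \<in> U \<Longrightarrow> inj_on (\<lambda>i. e i x) {..<rk E}"
    and triv_independent: "x \<in> U \<Longrightarrow> independent ((\<lambda>i. e i x) ` {..<rk E})"
    and triv_span: "x \<in> U \<Longrightarrow> span ((\<lambda>i. e i x) ` {..<rk E}) = fibre E x"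
proof -
  have "\<forall>(U, e)\<in>trivs E. open U \<and>
        (\<forall>x\<in>U. inj_on (\<lambda>i. e i x) {..<rk E} \<and>
               independent ((\<lambda>i. e i x) ` {..<rk E}) \<and>
               span ((\<lambda>i. e i x) ` {..<rk E}) = fibre E x)"
    using vbundle unfolding is_vbundle_def by (elim conjE)
  note t = bspec[OF this assms, unfolded prod.case]
  show "open U" using t by (elim conjE)
  show "inj_on (\<lambda>i. e i x) {..<rk E}" if "x \<in> U" using bspec[OF conjunct2[OF t] that] by (elim conjE)
  show "independent ((\<lambda>i. e i x) ` {..<rk E})" if "x \<in> U" using bspec[OF conjunct2[OF t] that] by (elim conjE)
  show "span ((\<lambda>i. e i x) ` {..<rk E}) = fibre E x" if "x \<in> U" using bspec[OF conjunct2[OF t] that] by (elim conjE)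
qed

lemma subspace_fibre: "subspace (fibre E x)"
  by (metis triv_exists triv_span subspace_span)

lemma zero_in_fibre [simp]: "0 \<in> fibre E x"
  using subspace_fibre by (rule subspace_0)

lemma frame_in_fibre: "(U, e) \<in> trivs E \<Longrightarrow> x \<in> U \<Longrightarrow> i < rk E \<Longrightarrow> e i x \<in> fibre E x"
  using triv_span[of U e x] by (metis imageI lessThan_iff span_base)

text \<open>The dual frame. \<open>representation\<close> is linear on the span of an independent
  set, so it serves at every point of the domain of \<open>e\<close>; elsewhere nothing is claimed
  about the value.\<close>

definition coframe :: "(nat \<Rightarrow> 'm \<Rightarrow> 'e) \<Rightarrow> nat \<Rightarrow> 'm \<Rightarrow> 'e \<Rightarrow> real" where
  "coframe e i x a = representation ((\<lambda>i. e i x) ` {..<rk E}) a (e i x)"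

lemma coframe_expand:
  assumes "(U, e) \<in> trivs E" "x \<in> U" "a \<in> fibre E x"
  shows "a = (\<Sum>i<rk E. coframe e i x a *\<^sub>R e i x)"
proof -
  let ?B = "(\<lambda>i. e i x) ` {..<rk E}"
  have "(\<Sum>b\<in>?B. representation ?B a b *\<^sub>R b) = a"
    by (rule sum_representation_eq[OF triv_independent[OF assms(1,2)]]) (use assms triv_span[OF assms(1,2)] in auto)
  then show ?thesis by (simp add: sum.reindex[OF triv_inj[OF assms(1,2)]] coframe_def)
qed

lemma coframe_linear:
  assumes "(U, e) \<in> trivs E" "x \<in> U"
  shows "lin_on (fibre E x) (coframe e i x)"
  unfolding lin_on_def coframe_def
  unfolding triv_span[OF assms, symmetric]
  using triv_independent[OF assms] by (simp add: representation_add representation_scale span_scale)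

lemma coframe_frame:
  assumes "(U, e) \<in> trivs E" "x \<in> U" "i < rk E" "j < rk E"
  shows "coframe e i x (e j x) = (if i = j then 1 else 0)"
proof -
  have "coframe e i x (e j x) = (if e i x = e j x then 1 else 0)"
    unfolding coframe_def using assms(4)
    by (subst representation_basis[OF triv_independent[OF assms(1,2)]]) auto
  moreover have "e i x = e j x \<longleftrightarrow> i = j"
    using inj_on_eq_iff[OF triv_inj[OF assms(1,2)], of i j] assms(3,4) by simp
  ultimately show ?thesis by simp
qed

lemma coframe_sum:
  assumes "(U, e) \<in> trivs E" "x \<in> U" "j < rk E"
  shows "coframe e j x (\<Sum>i<rk E. c i *\<^sub>R e i x) = c j"
proof -
  have "coframe e j x (\<Sum>i<rk E. c i *\<^sub>R e i x) = (\<Sum>i<rk E. c i *\<^sub>R coframe e j x (e i x))"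
    by (rule lin_on_sum[OF subspace_fibre coframe_linear[OF assms(1,2)]]) (simp add: frame_in_fibre[OF assms(1,2)])
  also have "\<dots> = (\<Sum>i<rk E. if j = i then c i else 0)"
    by (rule sum.cong) (simp_all add: coframe_frame[OF assms(1,2,3)])
  finally show ?thesis using assms(3) by simp
qed

text \<open>Coefficients with respect to a frame are unique, so those whose existence the definition
  demands are the values of the dual frame.\<close>

lemma sections_on_iff:
  assumes "open W"
  shows "s \<in> sections_on E W \<longleftrightarrow> (\<forall>x\<in>W. s x \<in> fibre E x) \<and>
    (\<forall>U e i. (U, e) \<in> trivs E \<longrightarrow> i < rk E \<longrightarrow> (\<lambda>x. coframe e i x (s x)) \<in> Cinf_on E (U \<inter> W))"
    (is "_ \<longleftrightarrow> ?R")
proof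
  assume s: "s \<in> sections_on E W"
  show ?R
  proof (intro conjI allI impI)
    show "\<forall>x\<in>W. s x \<in> fibre E x" using s by (simp add: sections_on_def)
    fix U e i assume t: "(U, e) \<in> trivs E" and i: "i < rk E"
    have "\<forall>(U, e)\<in>trivs E. \<exists>c. (\<forall>i<rk E. c i \<in> Cinf_on E (U \<inter> W)) \<and>
        (\<forall>x\<in>U \<inter> W. s x = (\<Sum>i<rk E. c i x *\<^sub>R e i x))"
      using s by (simp add: sections_on_def)
    from bspec[OF this t, unfolded prod.case]
    obtain c where c: "\<forall>i<rk E. c i \<in> Cinf_on E (U \<inter> W)" "\<forall>x\<in>U \<inter> W. s x = (\<Sum>i<rk E. c i x *\<^sub>R e i x)"
      by (elim exE conjE)
    show "(\<lambda>x. coframe e i x (s x)) \<in> Cinf_on E (U \<inter> W)"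
    proof (rule Cinf_on_cong)
      show "open (U \<inter> W)" using assms triv_open[OF t] by (rule open_Int[rotated])
      show "c i \<in> Cinf_on E (U \<inter> W)" using c(1) i by simp
      show "c i x = coframe e i x (s x)" if "x \<in> U \<inter> W" for x
        using c(2) that i coframe_sum[OF t, of x i "\<lambda>i. c i x"] by simp
    qed
  qed
next
  assume R: ?R
  show "s \<in> sections_on E W"
    unfolding sections_on_def
  proof (intro CollectI conjI ballI)
    show "s x \<in> fibre E x" if "x \<in> W" for x using R that by simp
    fix p assume p: "p \<in> trivs E"
    obtain U e where [simp]: "p = (U, e)" by (cases p)
    have t: "(U, e) \<in> trivs E" using p by simp
    show "case p of (U, e) \<Rightarrow> \<exists>c. (\<forall>i<rk E. c i \<in> Cinf_on E (U \<inter> W)) \<and>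
        (\<forall>x\<in>U \<inter> W. s x = (\<Sum>i<rk E. c i x *\<^sub>R e i x))"
      unfolding \<open>p = (U, e)\<close> prod.case
    proof (intro exI conjI allI impI ballI)
      show "(\<lambda>x. coframe e i x (s x)) \<in> Cinf_on E (U \<inter> W)" if "i < rk E" for i using R t that by simp
      show "s x = (\<Sum>i<rk E. coframe e i x (s x) *\<^sub>R e i x)" if "x \<in> U \<inter> W" for x
        using coframe_expand[OF t, of x "s x"] R that by simp
    qed
  qed
qed

lemma section_on_in_fibre: "s \<in> sections_on E W \<Longrightarrow> x \<in> W \<Longrightarrow> s x \<in> fibre E x"
  by (simp add: sections_on_def)

lemma section_in_fibre [simp]: "s \<in> sections E \<Longrightarrow> s x \<in> fibre E x"
  by (rule section_on_in_fibre[OF _ UNIV_I])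

lemma coframe_section_on:
  assumes "s \<in> sections_on E W" "open W" "(U, e) \<in> trivs E" "i < rk E"
  shows "(\<lambda>x. coframe e i x (s x)) \<in> Cinf_on E (U \<inter> W)"
  using conjunct2[OF iffD1[OF sections_on_iff[OF assms(2)] assms(1)], rule_format, OF assms(3,4)] .

lemma coframe_section:
  assumes "s \<in> sections E" "(U, e) \<in> trivs E" "i < rk E"
  shows "(\<lambda>x. coframe e i x (s x)) \<in> Cinf_on E U"
  using coframe_section_on[OF assms(1) open_UNIV assms(2,3)] unfolding Int_UNIV_right .

lemma sections_on_local:
  assumes "open W" "\<And>x. x \<in> W \<Longrightarrow> \<exists>V s'. open V \<and> x \<in> V \<and> s' \<in> sections E \<and> (\<forall>y\<in>V. s y = s' y)"
  shows "s \<in> sections_on E W"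
  unfolding sections_on_iff[OF assms(1)]
proof (intro conjI ballI allI impI)
  fix x assume "x \<in> W"
  then show "s x \<in> fibre E x" using assms(2) section_in_fibre by metis
next
  fix U e i assume t: "(U, e) \<in> trivs E" "i < rk E"
  show "(\<lambda>x. coframe e i x (s x)) \<in> Cinf_on E (U \<inter> W)"
  proof (rule Cinf_on_local)
    fix x assume x: "x \<in> U \<inter> W"
    then obtain V s' where V: "open V" "x \<in> V" "s' \<in> sections E" "\<forall>y\<in>V. s y = s' y"
      using assms(2) by (meson IntD2)
    have o: "open (U \<inter> V)" using triv_open[OF t(1)] V(1) by (rule open_Int)
    have "(\<lambda>x. coframe e i x (s' x)) \<in> Cinf_on E (U \<inter> V)"
      by (rule Cinf_on_subset[OF coframe_section[OF V(3) t] Int_lower1])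
    then have "(\<lambda>x. coframe e i x (s x)) \<in> Cinf_on E (U \<inter> V)"
      by (rule Cinf_on_cong[OF o, rotated]) (use V(4) in simp)
    then show "\<exists>V. open V \<and> x \<in> V \<and> (\<lambda>x. coframe e i x (s x)) \<in> Cinf_on E V"
      using o x V(2) by (intro exI[of _ "U \<inter> V"]) simp
  qed
qed

lemma sections_on_linear:
  assumes W: "open W" and f: "f \<in> Cinf_on E W" "g \<in> Cinf_on E W" and A: "A \<in> sections_on E W" "B \<in> sections_on E W"
  shows "(\<lambda>x. f x *\<^sub>R A x + g x *\<^sub>R B x) \<in> sections_on E W"
  unfolding sections_on_iff[OF W]
proof (intro conjI ballI allI impI)
  fix x assume "x \<in> W"
  then show "f x *\<^sub>R A x + g x *\<^sub>R B x \<in> fibre E x"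
    using A by (intro subspace_add subspace_scale subspace_fibre section_on_in_fibre)
next
  fix U e i assume t: "(U, e) \<in> trivs E" "i < rk E"
  have o: "open (U \<inter> W)" using triv_open[OF t(1)] W by (rule open_Int)
  have "(\<lambda>x. f x * coframe e i x (A x) + g x * coframe e i x (B x)) \<in> Cinf_on E (U \<inter> W)"
    by (intro Cinf_on_add Cinf_on_mult o Cinf_on_subset[OF f(1)] Cinf_on_subset[OF f(2)] Int_lower2
        coframe_section_on[OF A(1) W t] coframe_section_on[OF A(2) W t])
  then show "(\<lambda>x. coframe e i x (f x *\<^sub>R A x + g x *\<^sub>R B x)) \<in> Cinf_on E (U \<inter> W)"
  proof (rule Cinf_on_cong[OF o, rotated])
    fix x assume "x \<in> U \<inter> W"
    then have x: "x \<in> U" "x \<in> W" by simp_all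
    show "f x * coframe e i x (A x) + g x * coframe e i x (B x) = coframe e i x (f x *\<^sub>R A x + g x *\<^sub>R B x)"
      using lin_onD[OF coframe_linear[OF t(1) x(1)] section_on_in_fibre[OF A(1) x(2)] section_on_in_fibre[OF A(2) x(2)]]
      by simp
  qed
qed

lemma section_linear:
  "f \<in> Cinf E \<Longrightarrow> g \<in> Cinf E \<Longrightarrow> A \<in> sections E \<Longrightarrow> B \<in> sections E \<Longrightarrow> (\<lambda>x. f x *\<^sub>R A x + g x *\<^sub>R B x) \<in> sections E"
  by (rule sections_on_linear) simp_all

lemma section_scale: "f \<in> Cinf E \<Longrightarrow> A \<in> sections E \<Longrightarrow> (\<lambda>x. f x *\<^sub>R A x) \<in> sections E"
  using section_linear[of f "\<lambda>x. 0" A A] by (simp add: Cinf_on_const)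

lemma section_add: "A \<in> sections E \<Longrightarrow> B \<in> sections E \<Longrightarrow> (\<lambda>x. A x + B x) \<in> sections E"
  using section_linear[of "\<lambda>x. 1" "\<lambda>x. 1" A B] by (simp add: Cinf_on_const)

lemma section_diff: "A \<in> sections E \<Longrightarrow> B \<in> sections E \<Longrightarrow> (\<lambda>x. A x - B x) \<in> sections E"
  using section_linear[of "\<lambda>x. 1" "\<lambda>x. -1" A B] by (simp add: Cinf_on_const)

lemma section_zero: "(\<lambda>x. 0) \<in> sections E"
  unfolding sections_on_iff[OF open_UNIV]
proof (intro conjI ballI allI impI)
  fix U e i assume t: "(U, e) \<in> trivs E" "i < rk E"
  show "(\<lambda>x. coframe e i x 0) \<in> Cinf_on E (U \<inter> UNIV)"
    by (rule Cinf_on_cong[OF _ _ Cinf_on_const[of 0]])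
      (use lin_on_zero[OF subspace_fibre coframe_linear[OF t(1)]] triv_open[OF t(1)] in auto)
qed simp

lemma section_sum:
  "(\<And>i. i \<in> I \<Longrightarrow> A i \<in> sections E) \<Longrightarrow> (\<lambda>x. \<Sum>i\<in>I. A i x) \<in> sections E"
  by (induction I rule: infinite_finite_induct) (simp_all add: section_zero section_add)

text \<open>The coefficients of one frame in another are the transition functions.\<close>

lemma frame_section:
  assumes t: "(U, e) \<in> trivs E" "i < rk E"
  shows "e i \<in> sections_on E U"
  unfolding sections_on_iff[OF triv_open[OF t(1)]]
proof (intro conjI ballI allI impI)
  show "e i x \<in> fibre E x" if "x \<in> U" for x using frame_in_fibre t that by simp
  fix V e' j assume t': "(V, e') \<in> trivs E" "j < rk E"
  have "\<forall>(U, e)\<in>trivs E. \<forall>(V, e')\<in>trivs E. \<exists>g.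
        (\<forall>i<rk E. \<forall>j<rk E. g i j \<in> Cinf_on E (U \<inter> V)) \<and>
        (\<forall>j<rk E. \<forall>x\<in>U \<inter> V. e' j x = (\<Sum>i<rk E. g i j x *\<^sub>R e i x))"
    using vbundle unfolding is_vbundle_def by (elim conjE)
  from bspec[OF bspec[OF this t'(1), unfolded prod.case] t(1), unfolded prod.case]
  obtain g where g: "\<forall>i<rk E. \<forall>j<rk E. g i j \<in> Cinf_on E (V \<inter> U)"
    "\<forall>j<rk E. \<forall>x\<in>V \<inter> U. e j x = (\<Sum>i<rk E. g i j x *\<^sub>R e' i x)" by (elim exE conjE)
  show "(\<lambda>x. coframe e' j x (e i x)) \<in> Cinf_on E (V \<inter> U)"
  proof (rule Cinf_on_cong)
    show "open (V \<inter> U)" using triv_open[OF t'(1)] triv_open[OF t(1)] by (rule open_Int)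
    show "g j i \<in> Cinf_on E (V \<inter> U)" using g(1) t t' by simp
    show "g j i x = coframe e' j x (e i x)" if "x \<in> V \<inter> U" for x
      using g(2) t t' that coframe_sum[OF t'(1), of x j "\<lambda>k. g k i x"] by simp
  qed
qed

text \<open>A trivialization near \<open>x\<close> comes with a bump function vanishing outside a
  closed part of its domain: the data by which frames and coframes are made global.\<close>

lemma adapted_frame:
  obtains U e \<rho> C N where "(U, e) \<in> trivs E" "\<rho> \<in> Cinf E" "closed C" "C \<subseteq> U" "open N" "x \<in> N" "N \<subseteq> C"
    "\<And>y. y \<in> N \<Longrightarrow> \<rho> y = 1" "\<And>y. y \<notin> C \<Longrightarrow> \<rho> y = 0"
proof -
  obtain U e where t: "(U, e) \<in> trivs E" "x \<in> U" by (rule triv_exists)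
  obtain \<rho> C N where b: "\<rho> \<in> Cinf E" "closed C" "C \<subseteq> U" "open N" "x \<in> N"
    "\<And>y. y \<in> N \<Longrightarrow> \<rho> y = 1" "\<And>y. y \<notin> C \<Longrightarrow> \<rho> y = 0"
    using bump_exists[OF triv_open[OF t(1)] t(2)] by metis
  have "N \<subseteq> C" using b(6,7) by force
  then show ?thesis using that[OF t(1) b(1,2,3,4,5)] b(6,7) by simp
qed

text \<open>Outside \<open>U\<close> the values of \<open>s\<close> may leave the fibres, but there
  the product is the zero vector.\<close>

lemma bump_section:
  assumes "\<rho> \<in> Cinf E" "closed C" "C \<subseteq> U" "open U" "\<And>y. y \<notin> C \<Longrightarrow> \<rho> y = 0" "s \<in> sections_on E U"
  shows "(\<lambda>y. \<rho> y *\<^sub>R s y) \<in> sections E"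
  unfolding sections_on_iff[OF open_UNIV]
proof (intro conjI ballI allI impI)
  have f: "\<rho> y = 0 \<or> s y \<in> fibre E y" for y
    using assms(3,5) section_on_in_fibre[OF assms(6)] by (metis subsetD)
  then show "\<rho> y *\<^sub>R s y \<in> fibre E y" for y
    using subspace_scale[OF subspace_fibre] by (metis scale_zero_left zero_in_fibre)
  fix V e i assume t: "(V, e) \<in> trivs E" "i < rk E"
  have "(\<lambda>y. \<rho> y * coframe e i y (s y)) \<in> Cinf_on E V"
    by (intro bump_mult[OF assms(1-5)] triv_open[OF t(1)] coframe_section_on[OF assms(6,4) t])
  then show "(\<lambda>y. coframe e i y (\<rho> y *\<^sub>R s y)) \<in> Cinf_on E (V \<inter> UNIV)"
    unfolding Int_UNIV_right
  proof (rule Cinf_on_cong[OF triv_open[OF t(1)], rotated])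
    show "\<rho> y * coframe e i y (s y) = coframe e i y (\<rho> y *\<^sub>R s y)" if "y \<in> V" for y
      using f[of y] lin_on_scale[OF subspace_fibre coframe_linear[OF t(1) that]]
        lin_on_zero[OF subspace_fibre coframe_linear[OF t(1) that]] by auto
  qed
qed

lemma section_through:
  assumes "a \<in> fibre E x"
  obtains A where "A \<in> sections E" "A x = a"
proof -
  obtain U e \<rho> C N where b: "(U, e) \<in> trivs E" "\<rho> \<in> Cinf E" "closed C" "C \<subseteq> U" "open N" "x \<in> N" "N \<subseteq> C"
    "\<And>y. y \<in> N \<Longrightarrow> \<rho> y = 1" "\<And>y. y \<notin> C \<Longrightarrow> \<rho> y = 0"
    using adapted_frame[of x] by metis
  have "x \<in> U" using b(4,6,7) by blast
  have s: "(\<lambda>y. \<rho> y *\<^sub>R e i y) \<in> sections E" if "i < rk E" for i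
    by (rule bump_section[OF b(2,3,4) triv_open[OF b(1)] b(9) frame_section[OF b(1) that]])
  have "(\<lambda>y. coframe e i x a *\<^sub>R (\<rho> y *\<^sub>R e i y)) \<in> sections E" if "i < rk E" for i
    by (rule section_scale[OF Cinf_on_const s[OF that]])
  then have "(\<lambda>y. \<Sum>i<rk E. coframe e i x a *\<^sub>R (\<rho> y *\<^sub>R e i y)) \<in> sections E"
    by (intro section_sum) simp
  moreover have "(\<Sum>i<rk E. coframe e i x a *\<^sub>R (\<rho> x *\<^sub>R e i x)) = a"
    using coframe_expand[OF b(1) \<open>x \<in> U\<close> assms] b(8)[OF b(6)] by simp
  ultimately show ?thesis by (rule that)
qed

text \<open>The tool for tensoriality: an operation that is linear over functions sends
  \<open>A\<close> to a combination whose coefficients vanish at \<open>x\<close>. The decomposition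
  is \<open>A = \<rho>\<^sup>2 A + (1 - \<rho>\<^sup>2) A\<close>; in the first part one factor
  \<rho> makes the coefficients global and the other the frame, and
  \<open>1 - \<rho>\<^sup>2\<close> vanishes at \<open>x\<close> by itself.\<close>

lemma section_vanishing:
  assumes "A \<in> sections E" "A x = 0"
  shows "\<exists>(n::nat) g B. (\<forall>j. g j \<in> Cinf E \<and> g j x = 0 \<and> B j \<in> sections E) \<and>
    A = (\<lambda>y. \<Sum>j<n. g j y *\<^sub>R B j y)"
proof -
  obtain U e \<rho> C N where b: "(U, e) \<in> trivs E" "\<rho> \<in> Cinf E" "closed C" "C \<subseteq> U" "open N" "x \<in> N" "N \<subseteq> C"
    "\<And>y. y \<in> N \<Longrightarrow> \<rho> y = 1" "\<And>y. y \<notin> C \<Longrightarrow> \<rho> y = 0"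
    using adapted_frame[of x] by metis
  have xU: "x \<in> U" using b(4,6,7) by blast
  define g where "g j = (if j < rk E then (\<lambda>y. \<rho> y * coframe e j y (A y)) else (\<lambda>y. 1 - \<rho> y * \<rho> y))" for j
  define B where "B j = (if j < rk E then (\<lambda>y. \<rho> y *\<^sub>R e j y) else A)" for j
  have 1: "g j \<in> Cinf E" for j
  proof (cases "j < rk E")
    case True
    have "(\<lambda>y. \<rho> y * coframe e j y (A y)) \<in> Cinf E"
      by (rule bump_mult[OF b(2,3,4) triv_open[OF b(1)] b(9) _ open_UNIV])
        (simp_all add: coframe_section[OF assms(1) b(1) True])
    then show ?thesis using True by (simp add: g_def)
  next
    case False
    have "(\<lambda>y. 1 - \<rho> y * \<rho> y) \<in> Cinf E"
      by (intro Cinf_on_diff Cinf_on_mult Cinf_on_const open_UNIV b(2))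
    then show ?thesis using False by (simp add: g_def)
  qed
  have 2: "g j x = 0" for j
    using lin_on_zero[OF subspace_fibre coframe_linear[OF b(1) xU]] b(8)[OF b(6)] by (simp add: g_def assms(2))
  have 3: "B j \<in> sections E" for j
    unfolding B_def
    using bump_section[OF b(2,3,4) triv_open[OF b(1)] b(9) frame_section[OF b(1)]] assms(1) by simp
  \<comment> \<open>The index \<open>rk E\<close> carries the remainder
    \<open>(1 - \<rho>\<^sup>2) A\<close>, whence the upper bound \<open>Suc (rk E)\<close>.\<close>
  have 4: "A y = (\<Sum>j<Suc (rk E). g j y *\<^sub>R B j y)" for y
  proof -
    have "(\<Sum>j<rk E. g j y *\<^sub>R B j y) = (\<rho> y * \<rho> y) *\<^sub>R A y"
    proof (cases "y \<in> C")
      case True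
      then have "y \<in> U" using b(4) by blast
      then have "(\<rho> y * \<rho> y) *\<^sub>R A y = (\<rho> y * \<rho> y) *\<^sub>R (\<Sum>j<rk E. coframe e j y (A y) *\<^sub>R e j y)"
        using coframe_expand[OF b(1), of y "A y"] assms(1) by simp
      also have "\<dots> = (\<Sum>j<rk E. g j y *\<^sub>R B j y)"
        unfolding scaleR_sum_right by (rule sum.cong) (simp_all add: g_def B_def mult_ac)
      finally show ?thesis by simp
    next
      case False
      then show ?thesis using b(9) by (simp add: g_def)
    qed
    then show ?thesis by (simp add: g_def B_def algebra_simps)
  qed
  show ?thesis
    by (rule exI[of _ "Suc (rk E)"], rule exI[of _ g], rule exI[of _ B])
      (intro conjI allI ext 1 2 3 4)
qed

end

section \<open>Forms and the uniqueness of derivations\<close>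

context smooth_bundle
begin

lemma form_alternating: "\<omega> \<in> forms E \<Longrightarrow> alternating_on (fibre E x) (\<omega> x)"
  by (simp add: forms_def)

lemma form_frame_smooth:
  assumes "\<omega> \<in> forms E" "(U, e) \<in> trivs E" "I \<in> lists {..<rk E}"
  shows "(\<lambda>x. \<omega> x (map (\<lambda>i. e i x) I)) \<in> Cinf_on E U"
proof -
  have "\<forall>(U, e)\<in>trivs E. \<forall>I\<in>lists {..<rk E}. (\<lambda>x. \<omega> x (map (\<lambda>i. e i x) I)) \<in> Cinf_on E U"
    using assms(1) unfolding forms_def by simp
  from bspec[OF bspec[OF this assms(2), unfolded prod.case] assms(3)] show ?thesis .
qed

lemma sections_at_in_lists: "As \<in> lists (sections E) \<Longrightarrow> map (\<lambda>A. A x) As \<in> lists (fibre E x)"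
  by (induction As) (auto simp: section_on_in_fibre[OF _ UNIV_I])

text \<open>The definition tests smoothness on frames only. Here the sections are expanded in the
  frame one after the other; the list \<open>I\<close> collects the frame vectors that already stand
  in front.\<close>

lemma form_smooth:
  assumes "\<omega> \<in> forms E" "As \<in> lists (sections E)"
  shows "(\<lambda>y. \<omega> y (map (\<lambda>A. A y) As)) \<in> Cinf E"
proof -
  have main: "(\<lambda>y. \<omega> y (map (\<lambda>i. e i y) I @ map (\<lambda>A. A y) As)) \<in> Cinf_on E U"
    if t: "(U, e) \<in> trivs E" and "I \<in> lists {..<rk E}" for U e I
    using assms(2) that(2)
  proof (induction As arbitrary: I)
    case Nil
    then show ?case using form_frame_smooth[OF assms(1) t] by simp
  next
    case (Cons A As)
    have A: "A \<in> sections E" "As \<in> lists (sections E)" using Cons.hyps by simp_all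
    let ?J = "\<lambda>i. I @ [i]"
    have "(\<lambda>y. \<Sum>i<rk E. coframe e i y (A y) * \<omega> y (map (\<lambda>i. e i y) (?J i) @ map (\<lambda>A. A y) As)) \<in> Cinf_on E U"
      by (intro Cinf_on_sum Cinf_on_mult triv_open[OF t] coframe_section[OF A(1) t] Cons.IH)
        (use Cons.prems in auto)
    then show ?case
    proof (rule Cinf_on_cong[OF triv_open[OF t], rotated])
      fix y assume y: "y \<in> U"
      let ?l = "map (\<lambda>i. e i y) I" and ?l' = "map (\<lambda>A. A y) As"
      have l: "?l \<in> lists (fibre E y)" "?l' \<in> lists (fibre E y)"
        using Cons.prems frame_in_fibre[OF t y] sections_at_in_lists[OF A(2)] by auto
      have "\<omega> y (?l @ A y # ?l') = \<omega> y (?l @ (\<Sum>i<rk E. coframe e i y (A y) *\<^sub>R e i y) # ?l')"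
        using coframe_expand[OF t y, of "A y"] A(1) by simp
      also have "\<dots> = (\<Sum>i<rk E. coframe e i y (A y) *\<^sub>R \<omega> y (?l @ e i y # ?l'))"
        by (rule lin_on_sum[OF subspace_fibre alternating_on_lin[OF form_alternating[OF assms(1)] l]])
          (simp add: frame_in_fibre[OF t y])
      finally show "(\<Sum>i<rk E. coframe e i y (A y) * \<omega> y (map (\<lambda>i. e i y) (?J i) @ ?l')) =
          \<omega> y (?l @ map (\<lambda>A. A y) (A # As))" by simp
    qed
  qed
  show ?thesis
  proof (rule Cinf_on_local)
    fix x
    obtain U e where t: "(U, e) \<in> trivs E" "x \<in> U" by (rule triv_exists)
    show "\<exists>V. open V \<and> x \<in> V \<and> (\<lambda>y. \<omega> y (map (\<lambda>A. A y) As)) \<in> Cinf_on E V"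
      using main[OF t(1), of "[]"] triv_open[OF t(1)] t(2) by (intro exI[of _ U]) simp
  qed
qed

text \<open>Near a point a frame agrees with its product with a bump function, so testing on global
  sections is enough.\<close>

lemma formsI:
  assumes alt: "\<And>x. alternating_on (fibre E x) (\<omega> x)"
    and smooth: "\<And>As. As \<in> lists (sections E) \<Longrightarrow> (\<lambda>y. \<omega> y (map (\<lambda>A. A y) As)) \<in> Cinf E"
  shows "\<omega> \<in> forms E"
  unfolding forms_def
proof (intro CollectI conjI allI ballI)
  show "alternating_on (fibre E x) (\<omega> x)" for x by (rule alt)
  fix p assume p: "p \<in> trivs E"
  obtain U e where pe: "p = (U, e)" by (cases p)
  have t: "(U, e) \<in> trivs E" using p pe by simp
  show "case p of (U, e) \<Rightarrow> \<forall>I\<in>lists {..<rk E}. (\<lambda>x. \<omega> x (map (\<lambda>i. e i x) I)) \<in> Cinf_on E U"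
    unfolding pe prod.case
  proof (intro ballI Cinf_on_local)
    fix I x assume I: "I \<in> lists {..<rk E}" and x: "x \<in> U"
    obtain \<rho> C N where b: "\<rho> \<in> Cinf E" "closed C" "C \<subseteq> U" "open N" "x \<in> N"
      "\<And>y. y \<in> N \<Longrightarrow> \<rho> y = 1" "\<And>y. y \<notin> C \<Longrightarrow> \<rho> y = 0"
      using bump_exists[OF triv_open[OF t] x] by metis
    have s: "(\<lambda>y. \<rho> y *\<^sub>R e i y) \<in> sections E" if "i < rk E" for i
      by (rule bump_section[OF b(1,2,3) triv_open[OF t] b(7) frame_section[OF t that]])
    have "map (\<lambda>i y. \<rho> y *\<^sub>R e i y) I \<in> lists (sections E)" using I s by auto
    from smooth[OF this] have "(\<lambda>y. \<omega> y (map (\<lambda>i. \<rho> y *\<^sub>R e i y) I)) \<in> Cinf_on E N"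
      unfolding map_map o_def by (rule Cinf_on_subset[OF _ subset_UNIV])
    then have "(\<lambda>y. \<omega> y (map (\<lambda>i. e i y) I)) \<in> Cinf_on E N"
      by (rule Cinf_on_cong[OF b(4), rotated]) (simp add: b(6))
    then show "\<exists>V. open V \<and> x \<in> V \<and> (\<lambda>x. \<omega> x (map (\<lambda>i. e i x) I)) \<in> Cinf_on E V"
      using b(4,5) by (intro exI[of _ N]) simp
  qed
qed

lemma forms_local:
  assumes "\<And>x. \<exists>N \<omega>'. open N \<and> x \<in> N \<and> \<omega>' \<in> forms E \<and> (\<forall>y\<in>N. \<omega> y = \<omega>' y)"
  shows "\<omega> \<in> forms E"
proof (rule formsI)
  show "alternating_on (fibre E x) (\<omega> x)" for x using assms[of x] form_alternating by metis
  fix As assume As: "As \<in> lists (sections E)"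
  show "(\<lambda>y. \<omega> y (map (\<lambda>A. A y) As)) \<in> Cinf E"
  proof (rule Cinf_on_local)
    fix x
    obtain N \<omega>' where N: "open N" "x \<in> N" "\<omega>' \<in> forms E" "\<forall>y\<in>N. \<omega> y = \<omega>' y" using assms by metis
    have "(\<lambda>y. \<omega>' y (map (\<lambda>A. A y) As)) \<in> Cinf_on E N"
      by (rule Cinf_on_subset[OF form_smooth[OF N(3) As] subset_UNIV])
    then have "(\<lambda>y. \<omega> y (map (\<lambda>A. A y) As)) \<in> Cinf_on E N"
      by (rule Cinf_on_cong[OF N(1), rotated]) (use N(4) in simp)
    then show "\<exists>V. open V \<and> x \<in> V \<and> (\<lambda>y. \<omega> y (map (\<lambda>A. A y) As)) \<in> Cinf_on E V"
      using N(1,2) by (intro exI[of _ N]) simp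
  qed
qed

lemma form_linear:
  assumes "\<omega> \<in> forms E" "\<tau> \<in> forms E" "f \<in> Cinf E" "g \<in> Cinf E"
  shows "(\<lambda>x l. f x * \<omega> x l + g x * \<tau> x l) \<in> forms E"
  by (rule formsI) (intro alternating_on_linear form_alternating assms(1,2),
      intro Cinf_on_add Cinf_on_mult open_UNIV form_smooth assms)

lemma form_zero: "(\<lambda>x l. 0) \<in> forms E"
  by (rule formsI) (rule alternating_on_zero, rule Cinf_on_const)

lemma form_add: "\<omega> \<in> forms E \<Longrightarrow> \<tau> \<in> forms E \<Longrightarrow> (\<lambda>x l. \<omega> x l + \<tau> x l) \<in> forms E"
  using form_linear[of \<omega> \<tau> "\<lambda>x. 1" "\<lambda>x. 1"] by (simp add: Cinf_on_const)

lemma form_scale: "\<omega> \<in> forms E \<Longrightarrow> f \<in> Cinf E \<Longrightarrow> (\<lambda>x l. f x * \<omega> x l) \<in> forms E"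
  using form_linear[of \<omega> \<omega> f "\<lambda>x. 0"] by (simp add: Cinf_on_const)

lemma form_sum: "(\<And>i. i \<in> I \<Longrightarrow> \<omega> i \<in> forms E) \<Longrightarrow> (\<lambda>x l. \<Sum>i\<in>I. \<omega> i x l) \<in> forms E"
  by (induction I rule: infinite_finite_induct) (simp_all add: form_zero form_add)

lemma form_contract:
  assumes "\<omega> \<in> forms E" "A \<in> sections E"
  shows "(\<lambda>x. contract (A x) (\<omega> x)) \<in> forms E"
proof (rule formsI)
  fix As assume "As \<in> lists (sections E)"
  then have "A # As \<in> lists (sections E)" using assms(2) by simp
  from form_smooth[OF assms(1) this]
  show "(\<lambda>y. contract (A y) (\<omega> y) (map (\<lambda>A. A y) As)) \<in> Cinf E" by (simp add: contract_apply)
qed (intro alternating_on_contract form_alternating assms(1))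

lemma form_grade:
  assumes "\<omega> \<in> forms E"
  shows "(\<lambda>x. grade (\<omega> x)) \<in> forms E"
proof (rule formsI)
  fix As assume As: "As \<in> lists (sections E)"
  show "(\<lambda>y. grade (\<omega> y) (map (\<lambda>A. A y) As)) \<in> Cinf E"
    unfolding grade_def length_map
    by (intro Cinf_on_mult open_UNIV Cinf_on_const form_smooth[OF assms As])
qed (intro alternating_on_grade form_alternating assms)

text \<open>The recursion leads from forms to forms again: contraction with a section and
  \<open>grade\<close> preserve smoothness.\<close>

lemma form_shuffle_prod:
  assumes "\<omega> \<in> forms E" "\<tau> \<in> forms E"
  shows "(\<lambda>x. shuffle_prod (\<omega> x) (\<tau> x)) \<in> forms E"
proof (rule formsI)
  show "alternating_on (fibre E x) (shuffle_prod (\<omega> x) (\<tau> x))" for x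
    by (intro alternating_on_shuffle_prod form_alternating assms subspace_fibre)
  fix As assume "As \<in> lists (sections E)"
  then show "(\<lambda>y. shuffle_prod (\<omega> y) (\<tau> y) (map (\<lambda>A. A y) As)) \<in> Cinf E"
    using assms
  proof (induction As arbitrary: \<omega> \<tau>)
    case Nil
    have "(\<lambda>y. \<omega> y []) \<in> Cinf E" "(\<lambda>y. \<tau> y []) \<in> Cinf E"
      using form_smooth[OF Nil(1), of "[]"] form_smooth[OF Nil(2), of "[]"] by simp_all
    then show ?case by (simp add: Cinf_on_mult)
  next
    case (Cons A As)
    have A: "A \<in> sections E" using Cons.hyps by simp
    show ?case
      unfolding list.map shuffle_prod.simps
      by (intro Cinf_on_add open_UNIV Cons.IH form_contract form_grade A Cons.prems)
  qed
qed

lemma form_wedge: "\<omega> \<in> forms E \<Longrightarrow> \<tau> \<in> forms E \<Longrightarrow> wedge \<omega> \<tau> \<in> forms E"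
  unfolding wedge_eq by (rule form_shuffle_prod)

lemma kform_form: "\<omega> \<in> kforms E k \<Longrightarrow> \<omega> \<in> forms E"
  by (simp add: kforms_def)

lemma kform_degree: "\<omega> \<in> kforms E k \<Longrightarrow> length l \<noteq> k \<Longrightarrow> \<omega> x l = 0"
  by (simp add: kforms_def)

lemma kformI: "\<omega> \<in> forms E \<Longrightarrow> (\<And>x l. length l \<noteq> k \<Longrightarrow> \<omega> x l = 0) \<Longrightarrow> \<omega> \<in> kforms E k"
  by (simp add: kforms_def)

lemma kform_wedge:
  assumes "\<omega> \<in> kforms E m" "\<tau> \<in> kforms E n"
  shows "wedge \<omega> \<tau> \<in> kforms E (m + n)"
proof (rule kformI)
  show "wedge \<omega> \<tau> \<in> forms E" using assms by (intro form_wedge kform_form)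
  show "wedge \<omega> \<tau> x l = 0" if "length l \<noteq> m + n" for x l
    unfolding wedge_eq using kform_degree[OF assms(1)] kform_degree[OF assms(2)] that
    by (rule shuffle_prod_degree)
qed

text \<open>Every vector of a fibre is the value of a global section, and on lists leaving the fibre
  forms are 0 by convention.\<close>

lemma form_eqI:
  assumes "\<omega> \<in> forms E" "\<tau> \<in> forms E"
    and "\<And>As x. As \<in> lists (sections E) \<Longrightarrow> \<omega> x (map (\<lambda>A. A x) As) = \<tau> x (map (\<lambda>A. A x) As)"
  shows "\<omega> = \<tau>"
proof (intro ext)
  fix x l
  show "\<omega> x l = \<tau> x l"
  proof (cases "l \<in> lists (fibre E x)")
    case True
    then have "\<exists>As\<in>lists (sections E). l = map (\<lambda>A. A x) As"
    proof (induction l)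
      case (Cons a l)
      then obtain As where As: "As \<in> lists (sections E)" "l = map (\<lambda>A. A x) As" by blast
      obtain A where A: "A \<in> sections E" "A x = a" using section_through Cons.hyps(1) by metis
      show ?case by (rule bexI[of _ "A # As"]) (use A As in auto)
    qed simp
    then show ?thesis using assms(3) by metis
  next
    case False
    then show ?thesis using alternating_on_outside form_alternating assms(1,2) by metis
  qed
qed

lemma kform_eqI:
  assumes "\<omega> \<in> kforms E k" "\<tau> \<in> kforms E k"
    and "\<And>As x. As \<in> lists (sections E) \<Longrightarrow> length As = k \<Longrightarrow> \<omega> x (map (\<lambda>A. A x) As) = \<tau> x (map (\<lambda>A. A x) As)"
  shows "\<omega> = \<tau>"
proof (rule form_eqI[OF kform_form[OF assms(1)] kform_form[OF assms(2)]])
  fix As x assume "As \<in> lists (sections E)"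
  then show "\<omega> x (map (\<lambda>A. A x) As) = \<tau> x (map (\<lambda>A. A x) As)"
    using assms(3) kform_degree[OF assms(1)] kform_degree[OF assms(2)] by (cases "length As = k") simp_all
qed

lemma kform1_eqI:
  assumes "\<omega> \<in> kforms E 1" "\<tau> \<in> kforms E 1"
    and "\<And>A x. A \<in> sections E \<Longrightarrow> \<omega> x [A x] = \<tau> x [A x]"
  shows "\<omega> = \<tau>"
  by (rule kform_eqI[OF assms(1,2)]) (auto simp: length_Suc_conv intro: assms(3))

lemma kform2_eqI:
  assumes "\<omega> \<in> kforms E 2" "\<tau> \<in> kforms E 2"
    and "\<And>A B x. A \<in> sections E \<Longrightarrow> B \<in> sections E \<Longrightarrow> \<omega> x [A x, B x] = \<tau> x [A x, B x]"
  shows "\<omega> = \<tau>"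
  by (rule kform_eqI[OF assms(1,2)]) (auto simp: numeral_2_eq_2 length_Suc_conv intro: assms(3))

lemma fun_form_kform:
  assumes "f \<in> Cinf E"
  shows "fun_form f \<in> kforms E 0"
proof (intro kformI formsI)
  show "alternating_on (fibre E x) (fun_form f x)" for x
    by (auto simp: alternating_on_def lin_on_def fun_form_def)
  show "(\<lambda>y. fun_form f y (map (\<lambda>A. A y) As)) \<in> Cinf E" for As
    using assms by (cases As) (simp_all add: fun_form_def Cinf_on_const)
qed (simp add: fun_form_def)

lemma kform0_eq: "\<omega> \<in> kforms E 0 \<Longrightarrow> \<omega> = fun_form (\<lambda>x. \<omega> x [])"
  using kform_degree[of \<omega> 0] by (auto simp: fun_form_def fun_eq_iff)

lemma wedge_fun_form: "wedge (fun_form f) \<omega> = (\<lambda>x l. f x * \<omega> x l)"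
  by (simp add: wedge_eq fun_form_def shuffle_prod_scalar_left fun_eq_iff)

text \<open>The test for membership in the fibre enforces the convention that forms vanish on other
  lists.\<close>

definition lin_form :: "('m \<Rightarrow> 'e \<Rightarrow> real) \<Rightarrow> ('m, 'e) form" where
  "lin_form \<alpha> = (\<lambda>x l. if length l = 1 \<and> hd l \<in> fibre E x then \<alpha> x (hd l) else 0)"

lemma lin_form_kform:
  assumes lin: "\<And>x. lin_on (fibre E x) (\<alpha> x)" and smooth: "\<And>A. A \<in> sections E \<Longrightarrow> (\<lambda>x. \<alpha> x (A x)) \<in> Cinf E"
  shows "lin_form \<alpha> \<in> kforms E 1"
proof (intro kformI formsI)
  show "alternating_on (fibre E x) (lin_form \<alpha> x)" for x
    unfolding alternating_on_def
  proof (intro conjI ballI allI impI)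
    show "lin_on (fibre E x) (\<lambda>a. lin_form \<alpha> x (l @ a # l'))" for l l'
    proof (cases "l = [] \<and> l' = []")
      case True
      then show ?thesis
        using lin[of x] subspace_add[OF subspace_fibre] subspace_scale[OF subspace_fibre]
        by (simp add: lin_on_def lin_form_def)
    next
      case False
      then show ?thesis by (auto simp add: lin_on_def lin_form_def)
    qed
    show "lin_form \<alpha> x l = 0" if "\<not> distinct l" for l
      using that by (cases l) (auto simp: lin_form_def)
    show "lin_form \<alpha> x l = 0" if "l \<notin> lists (fibre E x)" for l
      using that by (cases l) (auto simp: lin_form_def)
  qed
  fix As assume As: "As \<in> lists (sections E)"
  show "(\<lambda>y. lin_form \<alpha> y (map (\<lambda>A. A y) As)) \<in> Cinf E"
  proof (cases "length As = 1")
    case True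
    then obtain A where "As = [A]" by (auto simp: length_Suc_conv)
    then show ?thesis using As smooth by (simp add: lin_form_def)
  next
    case False
    then show ?thesis by (simp add: lin_form_def Cinf_on_const)
  qed
qed (simp add: lin_form_def)

lemma lin_form_apply: "a \<in> fibre E x \<Longrightarrow> lin_form \<alpha> x [a] = \<alpha> x a"
  by (simp add: lin_form_def)

lemma coframe_kform:
  assumes t: "(U, e) \<in> trivs E" "i < rk E" and b: "\<rho> \<in> Cinf E" "closed C" "C \<subseteq> U" "\<And>y. y \<notin> C \<Longrightarrow> \<rho> y = 0"
  shows "lin_form (\<lambda>x a. \<rho> x * coframe e i x a) \<in> kforms E 1"
proof (rule lin_form_kform)
  show "lin_on (fibre E x) (\<lambda>a. \<rho> x * coframe e i x a)" for x
  proof (cases "x \<in> C")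
    case True
    then have "x \<in> U" using b(3) by blast
    then show ?thesis using coframe_linear[OF t(1)] by (simp add: lin_on_def algebra_simps)
  next
    case False
    then show ?thesis using b(4) by (simp add: lin_on_def)
  qed
  show "(\<lambda>x. \<rho> x * coframe e i x (A x)) \<in> Cinf E" if "A \<in> sections E" for A
    by (rule bump_mult[OF b(1,2,3) triv_open[OF t(1)] b(4) _ open_UNIV])
      (simp_all add: coframe_section[OF that t])
qed

text \<open>One factor \<rho> makes the coframe a global form, the other makes the frame a global
  section, which accounts for \<open>\<rho>\<^sup>2\<close>. Where \<rho> is 0 or the arguments
  leave the fibre, both sides vanish.\<close>

lemma euler_identity:
  assumes t: "(U, e) \<in> trivs E" and b: "\<rho> \<in> Cinf E" "closed C" "C \<subseteq> U" "\<And>y. y \<notin> C \<Longrightarrow> \<rho> y = 0"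
    and \<omega>: "\<omega> \<in> kforms E k"
  shows "(\<Sum>i<rk E. wedge (lin_form (\<lambda>x a. \<rho> x * coframe e i x a)) (\<lambda>x. contract (\<rho> x *\<^sub>R e i x) (\<omega> x)) y l) =
    real k * (\<rho> y * \<rho> y) * \<omega> y l"
proof (cases "y \<in> C \<and> l \<in> lists (fibre E y)")
  case True
  then have y: "y \<in> U" and l: "l \<in> lists (fibre E y)" using b(3) by auto
  define \<epsilon> where "\<epsilon> i k = (if length k = 1 \<and> hd k \<in> fibre E y then coframe e i y (hd k) else 0)" for i k
  have 1: "lin_form (\<lambda>x a. \<rho> x * coframe e i x a) y = (\<lambda>k. \<rho> y * \<epsilon> i k)" for i
    by (auto simp: lin_form_def \<epsilon>_def)
  have 2: "contract (\<rho> y *\<^sub>R e i y) (\<omega> y) = (\<lambda>k. \<rho> y * contract (e i y) (\<omega> y) k)" if "i < rk E" for i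
    using contract_lin[OF form_alternating[OF kform_form[OF \<omega>]] frame_in_fibre[OF t y that]
        frame_in_fibre[OF t y that] subspace_fibre, of "\<rho> y" 0] by simp
  have "(\<Sum>i<rk E. shuffle_prod (\<epsilon> i) (contract (e i y) (\<omega> y)) l) = real (length l) * \<omega> y l"
  proof (rule sum_shuffle_prod_contract[OF form_alternating[OF kform_form[OF \<omega>]] subspace_fibre l])
    show "\<epsilon> i k = 0" if "length k \<noteq> 1" for i k using that by (simp add: \<epsilon>_def)
    show "e i y \<in> fibre E y" if "i < rk E" for i using frame_in_fibre[OF t y that] .
    show "a = (\<Sum>i<rk E. \<epsilon> i [a] *\<^sub>R e i y)" if "a \<in> fibre E y" for a
      using coframe_expand[OF t y that] that by (simp add: \<epsilon>_def)
  qed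
  moreover have "real (length l) * \<omega> y l = real k * \<omega> y l"
    using kform_degree[OF \<omega>, of l y] by (cases "length l = k") simp_all
  moreover have "(\<Sum>i<rk E. wedge (lin_form (\<lambda>x a. \<rho> x * coframe e i x a)) (\<lambda>x. contract (\<rho> x *\<^sub>R e i x) (\<omega> x)) y l) =
      (\<Sum>i<rk E. (\<rho> y * \<rho> y) * shuffle_prod (\<epsilon> i) (contract (e i y) (\<omega> y)) l)"
    by (rule sum.cong) (simp_all add: wedge_eq 1 2 shuffle_prod_scale_left shuffle_prod_scale_right)
  ultimately show ?thesis by (simp add: sum_distrib_left[symmetric])
next
  case False
  then consider "\<rho> y = 0" | "l \<notin> lists (fibre E y)" using b(4) by blast
  then show ?thesis
  proof cases
    case 1
    then have "lin_form (\<lambda>x a. \<rho> x * coframe e i x a) y = (\<lambda>k. 0)" for i by (simp add: lin_form_def fun_eq_iff)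
    then show ?thesis using 1 by (simp add: wedge_eq)
  next
    case 2
    have "alternating_on (fibre E y) (shuffle_prod (lin_form (\<lambda>x a. \<rho> x * coframe e i x a) y) (contract (\<rho> y *\<^sub>R e i y) (\<omega> y)))"
      if "i < rk E" for i
      by (intro alternating_on_shuffle_prod alternating_on_contract subspace_fibre form_alternating kform_form[OF \<omega>]
          kform_form[OF coframe_kform[OF t that b]])
    then have "shuffle_prod (lin_form (\<lambda>x a. \<rho> x * coframe e i x a) y) (contract (\<rho> y *\<^sub>R e i y) (\<omega> y)) l = 0"
      if "i < rk E" for i
      using alternating_on_outside[OF _ 2] that by blast
    moreover have "\<omega> y l = 0" by (rule alternating_on_outside[OF form_alternating[OF kform_form[OF \<omega>]] 2])
    ultimately show ?thesis by (simp add: wedge_eq)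
  qed
qed

section \<open>Homogeneous components and uniqueness of derivations\<close>

definition component :: "nat \<Rightarrow> ('m, 'e) form \<Rightarrow> ('m, 'e) form" where
  "component k \<omega> = (\<lambda>x l. if length l = k then \<omega> x l else 0)"

lemma component_kform:
  assumes "\<omega> \<in> forms E"
  shows "component k \<omega> \<in> kforms E k"
proof (intro kformI formsI)
  show "alternating_on (fibre E x) (component k \<omega> x)" for x
    using form_alternating[OF assms, of x] unfolding component_def alternating_on_def lin_on_def by simp
  show "(\<lambda>y. component k \<omega> y (map (\<lambda>A. A y) As)) \<in> Cinf E" if "As \<in> lists (sections E)" for As
    using form_smooth[OF assms that] by (cases "length As = k") (simp_all add: component_def Cinf_on_const)
qed (simp add: component_def)

text \<open>Bounding the degree by the rank makes the decomposition of a form into homogeneous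
  components a finite sum, to which additivity of a derivation applies.\<close>

lemma form_degree_gt_rank:
  assumes "\<omega> \<in> forms E" "length l > rk E"
  shows "\<omega> x l = 0"
proof -
  obtain U e where t: "(U, e) \<in> trivs E" "x \<in> U" by (rule triv_exists)
  show ?thesis
  proof (rule alternating_on_degree_gt_rank[OF form_alternating[OF assms(1)] subspace_fibre _ _ assms(2)])
    show "e i x \<in> fibre E x" if "i < rk E" for i using frame_in_fibre[OF t that] .
    show "\<exists>c. a = (\<Sum>i<rk E. c i *\<^sub>R e i x)" if "a \<in> fibre E x" for a
      using coframe_expand[OF t that] by (intro exI[of _ "\<lambda>i. coframe e i x a"])
  qed
qed

lemma sum_component:
  assumes "\<omega> \<in> forms E"
  shows "(\<lambda>x l. \<Sum>k\<le>rk E. component k \<omega> x l) = \<omega>"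
  using form_degree_gt_rank[OF assms] by (auto simp: component_def fun_eq_iff not_le)

lemma derivation_form:
  assumes "derivation E d P" "\<omega> \<in> forms E"
  shows "P \<omega> \<in> forms E"
  using assms(1)[unfolded derivation_def, THEN conjunct1] assms(2) by (rule PiE_mem)

lemma derivation_linear:
  assumes "derivation E d P" "\<omega> \<in> forms E" "\<tau> \<in> forms E"
  shows "P (\<lambda>x l. a * \<omega> x l + b * \<tau> x l) = (\<lambda>x l. a * P \<omega> x l + b * P \<tau> x l)"
  using assms(1)[unfolded derivation_def, THEN conjunct2, THEN conjunct1, rule_format, OF assms(2,3)] .

lemma derivation_degree:
  assumes "derivation E d P" "\<omega> \<in> kforms E k"
  shows "P \<omega> \<in> kforms E (k + d)"
  using assms(1)[unfolded derivation_def, THEN conjunct2, THEN conjunct2, THEN conjunct1, rule_format, OF assms(2)] .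

lemma derivation_wedge:
  assumes "derivation E d P" "\<omega> \<in> kforms E k" "\<tau> \<in> forms E"
  shows "P (wedge \<omega> \<tau>) = (\<lambda>x l. wedge (P \<omega>) \<tau> x l + (- 1) ^ (d * k) * wedge \<omega> (P \<tau>) x l)"
  using assms(1)[unfolded derivation_def, THEN conjunct2, THEN conjunct2, THEN conjunct2, rule_format, OF assms(2,3)] .

lemma derivation_sum:
  assumes P: "derivation E d P"
  shows "(\<And>i. i \<in> I \<Longrightarrow> \<omega> i \<in> forms E) \<Longrightarrow> finite I \<Longrightarrow>
    P (\<lambda>x l. \<Sum>i\<in>I. \<omega> i x l) = (\<lambda>x l. \<Sum>i\<in>I. P (\<omega> i) x l)"
proof (induction I rule: infinite_finite_induct)
  case empty
  show ?case using derivation_linear[OF P form_zero form_zero, of 0 0] by simp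
next
  case (insert i I)
  then show ?case
    using derivation_linear[OF P, of "\<omega> i" "\<lambda>x l. \<Sum>i\<in>I. \<omega> i x l" 1 1] form_sum[of I \<omega>] by simp
qed simp

lemma derivation_scale:
  assumes "derivation E d P" "f \<in> Cinf E" "\<omega> \<in> forms E"
  shows "P (\<lambda>x l. f x * \<omega> x l) = (\<lambda>x l. wedge (P (fun_form f)) \<omega> x l + f x * P \<omega> x l)"
  using derivation_wedge[OF assms(1) fun_form_kform[OF assms(2)] assms(3)] by (simp add: wedge_fun_form)

theorem derivation_eqI:
  assumes P: "derivation E d P" and Q: "derivation E d Q"
    and fns: "\<And>f. f \<in> Cinf E \<Longrightarrow> P (fun_form f) = Q (fun_form f)"
    and one_forms: "\<And>\<alpha>. \<alpha> \<in> kforms E 1 \<Longrightarrow> P \<alpha> = Q \<alpha>"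
  shows "P = Q"
proof -
  have k: "P \<omega> = Q \<omega>" if "\<omega> \<in> kforms E k" for \<omega> k
    using that
  proof (induction k arbitrary: \<omega>)
    case 0
    have "(\<lambda>x. \<omega> x []) \<in> Cinf E" using form_smooth[OF kform_form[OF 0], of "[]"] by simp
    then show ?case using fns kform0_eq[OF 0] by metis
  next
    case (Suc k)
    show ?case
    proof (intro ext)
      fix x l
      obtain U e \<rho> C N where b: "(U, e) \<in> trivs E" "\<rho> \<in> Cinf E" "closed C" "C \<subseteq> U" "open N" "x \<in> N"
        "N \<subseteq> C" "\<And>y. y \<in> N \<Longrightarrow> \<rho> y = 1" "\<And>y. y \<notin> C \<Longrightarrow> \<rho> y = 0"
        using adapted_frame[of x] by metis
      define \<eta> where "\<eta> i = lin_form (\<lambda>x a. \<rho> x * coframe e i x a)" for i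
      define \<tau> where "\<tau> i = (\<lambda>x. contract (\<rho> x *\<^sub>R e i x) (\<omega> x))" for i
      define f where "f y = real (Suc k) * (\<rho> y * \<rho> y)" for y
      have \<eta>: "\<eta> i \<in> kforms E 1" if "i < rk E" for i
        unfolding \<eta>_def by (rule coframe_kform[OF b(1) that b(2,3,4,9)])
      have \<tau>: "\<tau> i \<in> kforms E k" if "i < rk E" for i
      proof (rule kformI)
        show "\<tau> i \<in> forms E"
          unfolding \<tau>_def
          by (rule form_contract[OF kform_form[OF Suc.prems]
              bump_section[OF b(2,3,4) triv_open[OF b(1)] b(9) frame_section[OF b(1) that]]])
        show "\<tau> i x l = 0" if "length l \<noteq> k" for x l
          using kform_degree[OF Suc.prems, of "(\<rho> x *\<^sub>R e i x) # l"] that by (simp add: \<tau>_def contract_apply)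
      qed
      have f: "f \<in> Cinf E"
        unfolding f_def by (intro Cinf_on_mult open_UNIV Cinf_on_const b(2))
      have eq: "(\<lambda>x l. f x * \<omega> x l) = (\<lambda>x l. \<Sum>i<rk E. wedge (\<eta> i) (\<tau> i) x l)"
        unfolding \<eta>_def \<tau>_def f_def by (intro ext euler_identity[OF b(1-4,9) Suc.prems, symmetric])
      have R: "R (\<lambda>x l. f x * \<omega> x l) =
          (\<lambda>x l. \<Sum>i<rk E. wedge (R (\<eta> i)) (\<tau> i) x l + (- 1) ^ (d * 1) * wedge (\<eta> i) (R (\<tau> i)) x l)"
        if R: "derivation E d R" for R
      proof -
        have "R (\<lambda>x l. f x * \<omega> x l) = (\<lambda>x l. \<Sum>i<rk E. R (wedge (\<eta> i) (\<tau> i)) x l)"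
          unfolding eq by (rule derivation_sum[OF R form_wedge[OF kform_form[OF \<eta>] kform_form[OF \<tau>]]]) simp_all
        also have "\<dots> = (\<lambda>x l. \<Sum>i<rk E. wedge (R (\<eta> i)) (\<tau> i) x l + (- 1) ^ (d * 1) * wedge (\<eta> i) (R (\<tau> i)) x l)"
          by (intro ext sum.cong refl)
            (simp only: lessThan_iff derivation_wedge[OF R \<eta> kform_form[OF \<tau>]])
        finally show ?thesis .
      qed
      \<comment> \<open>The factors have degree 1 and \<open>k\<close>, where \<open>P\<close> and
        \<open>Q\<close> agree.\<close>
      have "P (\<lambda>x l. f x * \<omega> x l) = Q (\<lambda>x l. f x * \<omega> x l)"
        unfolding R[OF P] R[OF Q]
        by (intro ext sum.cong refl) (simp add: one_forms[OF \<eta>] Suc.IH[OF \<tau>])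
      \<comment> \<open>The Leibniz rule for the product of \<open>f\<close> and
        \<open>\<omega>\<close> produces the same extra term for both derivations, as they agree on
        functions. It cancels, and at the chosen point \<open>f\<close> has the value
        \<open>Suc k\<close>.\<close>
      then have "f x * P \<omega> x l = f x * Q \<omega> x l"
        unfolding derivation_scale[OF P f kform_form[OF Suc.prems]] derivation_scale[OF Q f kform_form[OF Suc.prems]]
          fns[OF f] by (simp add: fun_eq_iff) blast
      moreover have "f x \<noteq> 0" using b(8)[OF b(6)] by (simp add: f_def)
      ultimately show "P \<omega> x l = Q \<omega> x l" by simp
    qed
  qed
  \<comment> \<open>Agreement on forms is equality because both operators are
    \<open>undefined\<close> elsewhere.\<close>
  have ext: "P \<in> extensional (forms E)" "Q \<in> extensional (forms E)"
    using P Q unfolding derivation_def PiE_def by simp_all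
  show ?thesis
  proof (rule extensionalityI[OF ext])
    fix \<omega> assume \<omega>: "\<omega> \<in> forms E"
    have "R \<omega> = (\<lambda>x l. \<Sum>k\<le>rk E. R (component k \<omega>) x l)" if "derivation E d R" for R
      using derivation_sum[OF that, of "{..rk E}" "\<lambda>k. component k \<omega>"] kform_form[OF component_kform[OF \<omega>]]
      by (simp add: sum_component[OF \<omega>])
    then show "P \<omega> = Q \<omega>" using P Q by (simp add: k[OF component_kform[OF \<omega>]])
  qed
qed

end

section \<open>The operators induced by a connection\<close>

text \<open>Applied with \<open>f\<close> the evaluation of sections at a point: products of forms
  can then be computed on lists of sections, where \<open>nabla_at\<close> lives.\<close>

lemma shuffle_prod_map:
  "shuffle_prod (\<lambda>k. u (map f k)) (\<lambda>k. v (map f k)) l = shuffle_prod u v (map f l)"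
proof (induction l arbitrary: u v)
  case (Cons a l)
  have "contract a (\<lambda>k. w (map f k)) = (\<lambda>k. contract (f a) w (map f k))"
    and "grade (\<lambda>k. w (map f k)) = (\<lambda>k. grade w (map f k))" for w
    by (simp_all add: contract_def grade_def)
  then show ?case by (simp add: Cons)
qed simp

text \<open>The recursion evaluates the factors only on sublists of \<open>l\<close>.\<close>

lemma shuffle_prod_cong:
  assumes "l \<in> lists S" "\<And>k. k \<in> lists S \<Longrightarrow> u k = u' k" "\<And>k. k \<in> lists S \<Longrightarrow> v k = v' k"
  shows "shuffle_prod u v l = shuffle_prod u' v' l"
  using assms
proof (induction l arbitrary: u v u' v')
  case (Cons a l)
  have "shuffle_prod (contract a u) v l = shuffle_prod (contract a u') v' l"
    by (rule Cons.IH) (use Cons.hyps Cons.prems in \<open>simp_all add: contract_apply\<close>)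
  moreover have "shuffle_prod (grade u) (contract a v) l = shuffle_prod (grade u') (contract a v') l"
    by (rule Cons.IH) (use Cons.hyps Cons.prems in \<open>simp_all add: contract_apply grade_def\<close>)
  ultimately show ?case by simp
qed simp

text \<open>\<open>nabla_at nab X [A\<^sub>1, \<dots>, A\<^sub>k] \<omega>\<close> is \<open>X(\<omega>(A\<^sub>1, \<dots>, A\<^sub>k)) - \<Sum>\<^sub>i \<omega>(A\<^sub>1, \<dots>, \<nabla>\<^sub>X A\<^sub>i, \<dots>, A\<^sub>k)\<close>.\<close>

primrec nabla_at ::
  "('m, 'e) connection \<Rightarrow> ('m \<Rightarrow> 'm tangent) \<Rightarrow> ('m \<Rightarrow> 'e) list \<Rightarrow> ('m, 'e) form \<Rightarrow> 'm \<Rightarrow> real" where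
  "nabla_at nab X [] \<omega> = (\<lambda>x. X x (\<lambda>y. \<omega> y []))"
| "nabla_at nab X (A # As) \<omega> = (\<lambda>x. nabla_at nab X As (\<lambda>y. contract (A y) (\<omega> y)) x -
     contract (nab X A x) (\<omega> x) (map (\<lambda>A. A x) As))"

context smooth_manifold
begin

lemma vector_field_tangent: "X \<in> vector_fields M \<Longrightarrow> X x \<in> tangent_space M x"
  by (simp add: vector_fields_on_def)

lemma vector_field_smooth: "X \<in> vector_fields M \<Longrightarrow> f \<in> Cinf M \<Longrightarrow> (\<lambda>x. X x f) \<in> Cinf M"
  by (simp add: vector_fields_on_def)

lemma tangent_linear:
  "v \<in> tangent_space M x \<Longrightarrow> f \<in> Cinf M \<Longrightarrow> g \<in> Cinf M \<Longrightarrow> v (\<lambda>y. c * f y + d * g y) = c * v f + d * v g"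
  by (simp add: tangent_space_def)

lemma tangent_mult:
  "v \<in> tangent_space M x \<Longrightarrow> f \<in> Cinf M \<Longrightarrow> g \<in> Cinf M \<Longrightarrow> v (\<lambda>y. f y * g y) = f x * v g + g x * v f"
  by (simp add: tangent_space_def)

lemma tangent_const:
  assumes v: "v \<in> tangent_space M x"
  shows "v (\<lambda>y. c) = 0"
proof -
  have "v (\<lambda>y. 1) = 0"
    using tangent_mult[OF v Cinf_on_const[of 1] Cinf_on_const[of 1]] by simp
  then show ?thesis
    using tangent_linear[OF v Cinf_on_const[of 1] Cinf_on_const[of 1], of c 0] by simp
qed

lemma tangent_space_linear:
  assumes "v \<in> tangent_space M x" "w \<in> tangent_space M x"
  shows "(\<lambda>f. a * v f + b * w f) \<in> tangent_space M x"
  using assms unfolding tangent_space_def by (simp add: algebra_simps)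

lemma tangent_space_zero: "(\<lambda>f. 0) \<in> tangent_space M x"
  by (simp add: tangent_space_def)

lemma vector_field_linear:
  assumes "X \<in> vector_fields M" "Y \<in> vector_fields M" "f \<in> Cinf M" "g \<in> Cinf M"
  shows "(\<lambda>x h. f x * X x h + g x * Y x h) \<in> vector_fields M"
  unfolding vector_fields_on_def
proof (intro CollectI conjI ballI)
  show "(\<lambda>h. f x * X x h + g x * Y x h) \<in> tangent_space M x" for x
    by (rule tangent_space_linear[OF vector_field_tangent[OF assms(1)] vector_field_tangent[OF assms(2)]])
  show "(\<lambda>x. f x * X x h + g x * Y x h) \<in> Cinf M" if "h \<in> Cinf M" for h
    by (intro Cinf_on_add Cinf_on_mult open_UNIV vector_field_smooth[OF assms(1) that]
        vector_field_smooth[OF assms(2) that] assms(3,4))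
qed

lemma vector_field_zero: "(\<lambda>x h. 0) \<in> vector_fields M"
  by (simp add: vector_fields_on_def tangent_space_zero Cinf_on_const)

lemma vector_field_scale: "X \<in> vector_fields M \<Longrightarrow> f \<in> Cinf M \<Longrightarrow> (\<lambda>x h. f x * X x h) \<in> vector_fields M"
  using vector_field_linear[of X X f "\<lambda>x. 0"] by (simp add: Cinf_on_const)

lemma vector_field_add:
  "X \<in> vector_fields M \<Longrightarrow> Y \<in> vector_fields M \<Longrightarrow> (\<lambda>x h. X x h + Y x h) \<in> vector_fields M"
  using vector_field_linear[of X Y "\<lambda>x. 1" "\<lambda>x. 1"] by (simp add: Cinf_on_const)

lemma vector_field_sum:
  "(\<And>i. i \<in> I \<Longrightarrow> X i \<in> vector_fields M) \<Longrightarrow> (\<lambda>x h. \<Sum>i\<in>I. X i x h) \<in> vector_fields M"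
  by (induction I rule: infinite_finite_induct) (simp_all add: vector_field_zero vector_field_add)

end

locale bundle_connection = smooth_bundle E
  for E :: "('m::{t2_space,second_countable_topology}, 'b::real_inner, 'e::real_vector, 'z) vbundle_scheme" +
  fixes nab :: "('m, 'e) connection"
  assumes connection: "is_connection E nab"
begin

lemma nab_section: "X \<in> vector_fields E \<Longrightarrow> B \<in> sections E \<Longrightarrow> nab X B \<in> sections E"
  using connection by (simp add: is_connection_def)

lemma nab_add_field:
  "X \<in> vector_fields E \<Longrightarrow> Y \<in> vector_fields E \<Longrightarrow> B \<in> sections E \<Longrightarrow>
    nab (\<lambda>x f. X x f + Y x f) B = (\<lambda>x. nab X B x + nab Y B x)"
  using connection by (simp add: is_connection_def)

lemma nab_scale_field:
  "f \<in> Cinf E \<Longrightarrow> X \<in> vector_fields E \<Longrightarrow> B \<in> sections E \<Longrightarrow>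
    nab (\<lambda>x g. f x * X x g) B = (\<lambda>x. f x *\<^sub>R nab X B x)"
  using connection by (simp add: is_connection_def)

lemma nab_const_linear:
  "X \<in> vector_fields E \<Longrightarrow> A \<in> sections E \<Longrightarrow> B \<in> sections E \<Longrightarrow>
    nab X (\<lambda>x. c *\<^sub>R A x + d *\<^sub>R B x) = (\<lambda>x. c *\<^sub>R nab X A x + d *\<^sub>R nab X B x)"
  using connection by (simp add: is_connection_def)

lemma nab_add:
  "X \<in> vector_fields E \<Longrightarrow> A \<in> sections E \<Longrightarrow> B \<in> sections E \<Longrightarrow>
    nab X (\<lambda>x. A x + B x) = (\<lambda>x. nab X A x + nab X B x)"
  using nab_const_linear[of X A B 1 1] by simp

lemma nab_leibniz:
  "f \<in> Cinf E \<Longrightarrow> X \<in> vector_fields E \<Longrightarrow> B \<in> sections E \<Longrightarrow>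
    nab X (\<lambda>x. f x *\<^sub>R B x) = (\<lambda>x. X x f *\<^sub>R B x + f x *\<^sub>R nab X B x)"
  using connection by (simp add: is_connection_def)

lemma nab_sum_field:
  assumes "B \<in> sections E"
  shows "(\<And>i. i \<in> I \<Longrightarrow> f i \<in> Cinf E \<and> X i \<in> vector_fields E) \<Longrightarrow>
    nab (\<lambda>x g. \<Sum>i\<in>I. f i x * X i x g) B = (\<lambda>x. \<Sum>i\<in>I. f i x *\<^sub>R nab (X i) B x)"
proof (induction I rule: infinite_finite_induct)
  case (infinite I)
  then show ?case
    using nab_scale_field[OF Cinf_on_const[of 0] vector_field_zero assms] by simp
next
  case empty
  show ?case
    using nab_scale_field[OF Cinf_on_const[of 0] vector_field_zero assms] by simp
next
  case (insert i I)
  have X: "(\<lambda>x g. f j x * X j x g) \<in> vector_fields E" if "j \<in> insert i I" for j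
    using insert.prems[OF that] by (simp add: vector_field_scale)
  have "(\<lambda>x g. \<Sum>i\<in>I. f i x * X i x g) \<in> vector_fields E"
    by (rule vector_field_sum) (simp add: X)
  from nab_add_field[OF X[OF insertI1] this assms] insert show ?case
    by (simp add: nab_scale_field assms)
qed

section \<open>The covariant derivative of a form, evaluated on sections\<close>

context
  fixes X assumes X: "X \<in> vector_fields E"
begin

lemma nabla_at_smooth:
  "As \<in> lists (sections E) \<Longrightarrow> \<omega> \<in> forms E \<Longrightarrow> nabla_at nab X As \<omega> \<in> Cinf E"
proof (induction As arbitrary: \<omega> rule: lists.induct)
  case Nil
  have "(\<lambda>y. \<omega> y []) \<in> Cinf E" using form_smooth[OF Nil(1), of "[]"] by simp
  then show ?case by (simp add: vector_field_smooth[OF X])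
next
  case (Cons A As)
  have A: "A \<in> sections E" "As \<in> lists (sections E)" using Cons.hyps by simp_all
  show ?case
    unfolding nabla_at.simps
    by (intro Cinf_on_diff open_UNIV Cons.IH form_smooth[OF _ A(2), of "\<lambda>x. contract (nab X A x) (\<omega> x)"]
        form_contract nab_section X A Cons.prems)
qed

text \<open>Functions as coefficients produce the terms with \<open>X x f\<close> and
  \<open>X x g\<close>, which cancel in \<open>nabla_at_slot\<close>.\<close>

lemma nabla_at_linear:
  "As \<in> lists (sections E) \<Longrightarrow> \<omega> \<in> forms E \<Longrightarrow> \<tau> \<in> forms E \<Longrightarrow> f \<in> Cinf E \<Longrightarrow> g \<in> Cinf E \<Longrightarrow>
    nabla_at nab X As (\<lambda>y l. f y * \<omega> y l + g y * \<tau> y l) x =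
      X x f * \<omega> x (map (\<lambda>A. A x) As) + f x * nabla_at nab X As \<omega> x +
      (X x g * \<tau> x (map (\<lambda>A. A x) As) + g x * nabla_at nab X As \<tau> x)"
proof (induction As arbitrary: \<omega> \<tau> rule: lists.induct)
  case Nil
  have s: "(\<lambda>y. \<omega> y []) \<in> Cinf E" "(\<lambda>y. \<tau> y []) \<in> Cinf E"
    using form_smooth[OF Nil(1), of "[]"] form_smooth[OF Nil(2), of "[]"] by simp_all
  note t = vector_field_tangent[OF X, of x]
  have "X x (\<lambda>y. 1 * (f y * \<omega> y []) + 1 * (g y * \<tau> y [])) = 1 * X x (\<lambda>y. f y * \<omega> y []) + 1 * X x (\<lambda>y. g y * \<tau> y [])"
    by (intro tangent_linear[OF t] Cinf_on_mult open_UNIV s Nil.prems)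
  then show ?case
    by (simp add: tangent_mult[OF t Nil(3) s(1)] tangent_mult[OF t Nil(4) s(2)])
next
  case (Cons A As)
  have A: "A \<in> sections E" "As \<in> lists (sections E)" using Cons.hyps by simp_all
  show ?case
    unfolding nabla_at.simps contract_linear
      Cons.IH[OF form_contract[OF Cons.prems(1) A(1)] form_contract[OF Cons.prems(2) A(1)] Cons.prems(3,4)]
    by (simp add: contract_apply algebra_simps)
qed

lemma nabla_at_const_linear:
  assumes "As \<in> lists (sections E)" "\<omega> \<in> forms E" "\<tau> \<in> forms E"
  shows "nabla_at nab X As (\<lambda>y l. a * \<omega> y l + b * \<tau> y l) x =
      a * nabla_at nab X As \<omega> x + b * nabla_at nab X As \<tau> x"
  using nabla_at_linear[OF assms Cinf_on_const[of a] Cinf_on_const[of b]]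
  by (simp add: tangent_const[OF vector_field_tangent[OF X]])

lemma nabla_at_grade:
  "As \<in> lists (sections E) \<Longrightarrow> \<omega> \<in> forms E \<Longrightarrow>
    nabla_at nab X As (\<lambda>y. grade (\<omega> y)) x = (- 1) ^ length As * nabla_at nab X As \<omega> x"
proof (induction As arbitrary: \<omega> rule: lists.induct)
  case Nil
  then show ?case by (simp add: grade_def)
next
  case (Cons A As)
  have A: "A \<in> sections E" "As \<in> lists (sections E)" using Cons.hyps by simp_all
  have c: "(\<lambda>y. grade (contract (A y) (\<omega> y))) \<in> forms E" by (intro form_grade form_contract A Cons.prems)
  have "nabla_at nab X As (\<lambda>y. contract (A y) (grade (\<omega> y))) x =
      - 1 * nabla_at nab X As (\<lambda>y. grade (contract (A y) (\<omega> y))) x + 0 * nabla_at nab X As \<omega> x"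
    unfolding contract_grade by (rule nabla_at_const_linear[OF A(2) c Cons.prems])
  moreover have "contract (nab X A x) (grade (\<omega> x)) (map (\<lambda>A. A x) As) =
      - ((- 1) ^ length As * contract (nab X A x) (\<omega> x) (map (\<lambda>A. A x) As))"
    by (simp add: contract_apply grade_def)
  ultimately show ?case
    unfolding nabla_at.simps Cons.IH[OF form_contract[OF Cons.prems A(1)]] by (simp add: algebra_simps)
qed

text \<open>In the slot itself the derivative of a coefficient arises once from the Leibniz rule for
  \<open>X\<close> and once, with opposite sign, from \<open>nab X\<close> of the scaled section.
  Passing the sections in front of the slot uses only the linearity of
  \<open>\<omega>\<close>.\<close>

lemma nabla_at_slot:
  assumes A: "A \<in> sections E" "B \<in> sections E" and Cs: "Cs \<in> lists (sections E)" and f: "f \<in> Cinf E" "g \<in> Cinf E"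
  shows "Bs \<in> lists (sections E) \<Longrightarrow> \<omega> \<in> forms E \<Longrightarrow>
    nabla_at nab X (Bs @ (\<lambda>y. f y *\<^sub>R A y + g y *\<^sub>R B y) # Cs) \<omega> x =
      f x * nabla_at nab X (Bs @ A # Cs) \<omega> x + g x * nabla_at nab X (Bs @ B # Cs) \<omega> x"
proof (induction Bs arbitrary: \<omega> rule: lists.induct)
  case Nil
  have alt: "alternating_on (fibre E y) (\<omega> y)" for y by (rule form_alternating[OF Nil(1)])
  have 1: "contract (f y *\<^sub>R A y + g y *\<^sub>R B y) (\<omega> y) = (\<lambda>l. f y * contract (A y) (\<omega> y) l + g y * contract (B y) (\<omega> y) l)" for y
    by (rule contract_lin[OF alt _ _ subspace_fibre]) (simp_all add: A)
  have f': "(\<lambda>x. f x *\<^sub>R A x) \<in> sections E" "(\<lambda>x. g x *\<^sub>R B x) \<in> sections E"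
    by (intro section_scale f A)+
  have n: "nab X (\<lambda>y. f y *\<^sub>R A y + g y *\<^sub>R B y) x =
      1 *\<^sub>R (X x f *\<^sub>R A x + f x *\<^sub>R nab X A x) + 1 *\<^sub>R (X x g *\<^sub>R B x + g x *\<^sub>R nab X B x)"
    by (simp add: nab_add[OF X f'] nab_leibniz[OF f(1) X A(1)] nab_leibniz[OF f(2) X A(2)])
  have m: "X x f *\<^sub>R A x + f x *\<^sub>R nab X A x \<in> fibre E x" "X x g *\<^sub>R B x + g x *\<^sub>R nab X B x \<in> fibre E x"
    by (intro subspace_add subspace_scale subspace_fibre section_in_fibre nab_section A X)+
  have 2: "contract (nab X (\<lambda>y. f y *\<^sub>R A y + g y *\<^sub>R B y) x) (\<omega> x) =
    (\<lambda>l. X x f * contract (A x) (\<omega> x) l + f x * contract (nab X A x) (\<omega> x) l +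
      (X x g * contract (B x) (\<omega> x) l + g x * contract (nab X B x) (\<omega> x) l))"
    unfolding n contract_lin[OF alt m subspace_fibre]
    by (simp add: contract_lin[OF alt _ _ subspace_fibre] A nab_section[OF X])
  show ?case
    unfolding append_Nil nabla_at.simps 1 2
      nabla_at_linear[OF Cs form_contract[OF Nil(1) A(1)] form_contract[OF Nil(1) A(2)] f]
    by (simp add: algebra_simps)
next
  case (Cons B0 Bs)
  have B: "B0 \<in> sections E" "Bs \<in> lists (sections E)" using Cons.hyps by simp_all
  have "lin_on (fibre E x) (\<lambda>a. contract (nab X B0 x) (\<omega> x) (map (\<lambda>A. A x) Bs @ a # map (\<lambda>A. A x) Cs))"
    by (intro alternating_on_lin[OF alternating_on_contract[OF form_alternating[OF Cons.prems]]]
        sections_at_in_lists B Cs)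
  from lin_onD[OF this, of "A x" "B x" "f x" "g x"]
  show ?case
    unfolding append_Cons nabla_at.simps Cons.IH[OF form_contract[OF Cons.prems B(1)]]
    by (simp add: A algebra_simps)
qed

text \<open>Linearity over functions turns the slot into a combination with coefficients
  \<open>g j x = 0\<close>. The sum is built up one term at a time since
  \<open>nabla_at_slot\<close> combines two sections.\<close>

lemma nabla_at_vanishing:
  assumes A: "A \<in> sections E" "A x = 0" and Bs: "Bs \<in> lists (sections E)" "Cs \<in> lists (sections E)" and \<omega>: "\<omega> \<in> forms E"
  shows "nabla_at nab X (Bs @ A # Cs) \<omega> x = 0"
proof -
  obtain n :: nat and g B where "\<forall>j. g j \<in> Cinf E \<and> g j x = 0 \<and> B j \<in> sections E"
    and A_eq: "A = (\<lambda>y. \<Sum>j<n. g j y *\<^sub>R B j y)"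
    using section_vanishing[OF A] by (elim exE conjE)
  then have v: "g j \<in> Cinf E" "g j x = 0" "B j \<in> sections E" for j by simp_all
  have "nabla_at nab X (Bs @ (\<lambda>y. \<Sum>j<m. g j y *\<^sub>R B j y) # Cs) \<omega> x = 0" if "m \<le> n" for m
    using that
  proof (induction m)
    case 0
    show ?case
      using nabla_at_slot[OF section_zero section_zero Bs(2) Cinf_on_const[of 0] Cinf_on_const[of 0] Bs(1) \<omega>] by simp
  next
    case (Suc m)
    have s: "(\<lambda>y. \<Sum>j<m. g j y *\<^sub>R B j y) \<in> sections E"
      by (rule section_sum, rule section_scale[OF v(1) v(3)])
    show ?case
      using nabla_at_slot[OF s v(3)[of m] Bs(2) Cinf_on_const[of 1] v(1)[of m] Bs(1) \<omega>] v(2)[of m] Suc by simp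
  qed
  then show ?thesis unfolding A_eq by simp
qed

text \<open>Entries are exchanged one by one, \<open>Bs\<close> holding those already exchanged; two
  sections with equal value at \<open>x\<close> differ by one that vanishes there.\<close>

lemma nabla_at_pointwise:
  assumes \<omega>: "\<omega> \<in> forms E"
  shows "As \<in> lists (sections E) \<Longrightarrow> As' \<in> lists (sections E) \<Longrightarrow> map (\<lambda>A. A x) As = map (\<lambda>A. A x) As' \<Longrightarrow>
    Bs \<in> lists (sections E) \<Longrightarrow> nabla_at nab X (Bs @ As) \<omega> x = nabla_at nab X (Bs @ As') \<omega> x"
proof (induction As arbitrary: As' Bs rule: lists.induct)
  case Nil
  then show ?case by simp
next
  case (Cons A As)
  then obtain A' As'' where As': "As' = A' # As''" by (cases As') auto
  have m: "A \<in> sections E" "As \<in> lists (sections E)" "A' \<in> sections E" "As'' \<in> lists (sections E)" "A x = A' x"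
    using Cons.hyps Cons.prems As' by simp_all
  have d: "(\<lambda>y. 1 *\<^sub>R A y + (-1) *\<^sub>R A' y) \<in> sections E" by (intro section_linear Cinf_on_const m)
  have "nabla_at nab X (Bs @ (\<lambda>y. 1 *\<^sub>R A y + (-1) *\<^sub>R A' y) # As) \<omega> x = 0"
    by (rule nabla_at_vanishing[OF d _ Cons.prems(3) m(2) \<omega>]) (simp add: m)
  then have "nabla_at nab X (Bs @ A # As) \<omega> x = nabla_at nab X (Bs @ A' # As) \<omega> x"
    using nabla_at_slot[OF m(1,3,2) Cinf_on_const Cinf_on_const Cons.prems(3) \<omega>, of 1 "-1"] by simp
  also have "\<dots> = nabla_at nab X ((Bs @ [A']) @ As) \<omega> x" by simp
  also have "\<dots> = nabla_at nab X ((Bs @ [A']) @ As'') \<omega> x"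
    by (rule Cons.IH[OF m(4)]) (use Cons.prems As' m in auto)
  finally show ?case by (simp add: As')
qed

text \<open>The derivative of the repeated section occurs in
  \<open>\<omega>(\<nabla>A, A, ...)\<close> and \<open>\<omega>(A, \<nabla>A, ...)\<close>; these
  cancel since \<open>\<omega>\<close> alternates.\<close>

lemma nabla_at_repeated:
  assumes A: "A \<in> sections E" and Cs: "Cs \<in> lists (sections E)"
  shows "Bs \<in> lists (sections E) \<Longrightarrow> \<omega> \<in> forms E \<Longrightarrow> nabla_at nab X (Bs @ A # A # Cs) \<omega> x = 0"
proof (induction Bs arbitrary: \<omega> rule: lists.induct)
  case Nil
  have alt: "alternating_on (fibre E y) (\<omega> y)" for y by (rule form_alternating[OF Nil(1)])
  have "nabla_at nab X Cs (\<lambda>y l. 0) x = 0"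
    using nabla_at_const_linear[OF Cs form_zero form_zero, of 0 0] by simp
  moreover have "contract (nab X A x) (\<omega> x) (map (\<lambda>A. A x) (A # Cs)) =
      - contract (nab X A x) (contract (A x) (\<omega> x)) (map (\<lambda>A. A x) Cs)"
    using contract_swap[OF alt subspace_fibre, of "nab X A x" "A x" x] by (simp add: contract_apply)
  ultimately show ?case by (simp add: contract_contract[OF alt])
next
  case (Cons B Bs)
  have B: "B \<in> sections E" "Bs \<in> lists (sections E)" using Cons.hyps by simp_all
  have "contract (nab X B x) (\<omega> x) (map (\<lambda>A. A x) (Bs @ A # A # Cs)) = 0"
    by (rule alternating_on_nondistinct[OF alternating_on_contract[OF form_alternating[OF Cons.prems]]]) simp
  then show ?case using Cons.IH[OF form_contract[OF Cons.prems B(1)]] by simp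
qed

lemma nabla_at_degree:
  "(\<And>x l. length l \<noteq> k \<Longrightarrow> \<omega> x l = 0) \<Longrightarrow> length As \<noteq> k \<Longrightarrow> nabla_at nab X As \<omega> x = 0"
proof (induction As arbitrary: k \<omega>)
  case Nil
  then show ?case using tangent_const[OF vector_field_tangent[OF X], of x 0] by simp
next
  case (Cons A As)
  have "nabla_at nab X As (\<lambda>y. contract (A y) (\<omega> y)) x = 0"
  proof (cases k)
    case 0
    \<comment> \<open>Contraction of a form of degree 0 is zero, hence may be assigned any degree;
      one different from \<open>length As\<close> is chosen.\<close>
    show ?thesis by (rule Cons.IH[of "Suc (length As)"]) (use Cons.prems 0 in \<open>simp_all add: contract_apply\<close>)
  next
    case (Suc k')
    show ?thesis by (rule Cons.IH[of k']) (use Cons.prems Suc in \<open>simp_all add: contract_apply\<close>)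
  qed
  then show ?case using Cons.prems by (simp add: contract_apply)
qed

text \<open>Both factors are regarded as functions on lists of sections, where
  \<open>shuffle_prod\<close> makes sense just as on lists of vectors. The induction rests on two
  rules: contraction with \<open>A\<close> commutes with the derivative up to contraction with
  \<open>nab X A\<close>, and \<open>grade\<close> commutes with the derivative.\<close>

lemma nabla_at_shuffle_prod:
  "As \<in> lists (sections E) \<Longrightarrow> \<omega> \<in> forms E \<Longrightarrow> \<tau> \<in> forms E \<Longrightarrow>
    nabla_at nab X As (\<lambda>y. shuffle_prod (\<omega> y) (\<tau> y)) x =
      shuffle_prod (\<lambda>Bs. nabla_at nab X Bs \<omega> x) (\<lambda>Bs. \<tau> x (map (\<lambda>A. A x) Bs)) As +
      shuffle_prod (\<lambda>Bs. \<omega> x (map (\<lambda>A. A x) Bs)) (\<lambda>Bs. nabla_at nab X Bs \<tau> x) As"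
proof (induction As arbitrary: \<omega> \<tau> rule: lists.induct)
  case Nil
  have s: "(\<lambda>y. \<omega> y []) \<in> Cinf E" "(\<lambda>y. \<tau> y []) \<in> Cinf E"
    using form_smooth[OF Nil(1), of "[]"] form_smooth[OF Nil(2), of "[]"] by simp_all
  show ?case by (simp add: tangent_mult[OF vector_field_tangent[OF X] s])
next
  case (Cons A As)
  let ?v = "\<lambda>u Bs. u (map (\<lambda>A. A x) Bs)"
  let ?N = "\<lambda>\<omega> Bs. nabla_at nab X Bs \<omega> x"
  let ?a = "nab X A x"
  have A: "A \<in> sections E" "As \<in> lists (sections E)" using Cons.hyps by simp_all
  note i = form_contract[OF Cons.prems(1) A(1)] form_contract[OF Cons.prems(2) A(1)] form_grade[OF Cons.prems(1)]
  have v: "contract A (?v u) = ?v (contract (A x) u)" "grade (?v u) = ?v (grade u)" for u :: "'e list \<Rightarrow> real"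
    by (simp_all add: contract_def grade_def)
  have N: "contract A (?N u) = (\<lambda>Bs. 1 * ?N (\<lambda>y. contract (A y) (u y)) Bs + (-1) * ?v (contract ?a (u x)) Bs)" for u
    by (simp add: contract_def)
  have gk: "grade (u :: ('m \<Rightarrow> 'e) list \<Rightarrow> real) k = (- 1) ^ length k * u k" for u k by (simp add: grade_def)
  have g: "shuffle_prod (grade (?N \<omega>)) w As = shuffle_prod (?N (\<lambda>y. grade (\<omega> y))) w As" for w
    by (rule shuffle_prod_cong[OF A(2)])
      (simp_all only: gk nabla_at_grade[OF _ Cons.prems(1)])
  have "nabla_at nab X As (\<lambda>y. contract (A y) (shuffle_prod (\<omega> y) (\<tau> y))) x =
      ?N (\<lambda>y. shuffle_prod (contract (A y) (\<omega> y)) (\<tau> y)) As + ?N (\<lambda>y. shuffle_prod (grade (\<omega> y)) (contract (A y) (\<tau> y))) As"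
    using nabla_at_const_linear[OF A(2) form_shuffle_prod[OF i(1) Cons.prems(2)] form_shuffle_prod[OF i(3,2)], of 1 1 x]
    unfolding contract_shuffle_prod by simp
  also have "\<dots> = shuffle_prod (?N (\<lambda>y. contract (A y) (\<omega> y))) (?v (\<tau> x)) As +
      shuffle_prod (?v (contract (A x) (\<omega> x))) (?N \<tau>) As +
      (shuffle_prod (?N (\<lambda>y. grade (\<omega> y))) (?v (contract (A x) (\<tau> x))) As +
       shuffle_prod (?v (grade (\<omega> x))) (?N (\<lambda>y. contract (A y) (\<tau> y))) As)"
    unfolding Cons.IH[OF i(1) Cons.prems(2)] Cons.IH[OF i(3,2)] by simp
  finally have 1: "nabla_at nab X As (\<lambda>y. contract (A y) (shuffle_prod (\<omega> y) (\<tau> y))) x = \<dots>" .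
  have 2: "contract ?a (shuffle_prod (\<omega> x) (\<tau> x)) (map (\<lambda>A. A x) As) =
      shuffle_prod (?v (contract ?a (\<omega> x))) (?v (\<tau> x)) As + shuffle_prod (?v (grade (\<omega> x))) (?v (contract ?a (\<tau> x))) As"
    unfolding shuffle_prod_map contract_shuffle_prod ..
  show ?case
    unfolding nabla_at.simps 1 2 shuffle_prod.simps v N g shuffle_prod_linear_left shuffle_prod_linear_right
    by simp
qed

end

text \<open>Any section through \<open>a\<close> will do: the values formed with it do not depend on
  the choice, by \<open>nabla_at_pointwise\<close> and, for the torsion,
  \<open>tor_pointwise\<close>.\<close>

definition extend :: "'m \<Rightarrow> 'e \<Rightarrow> 'm \<Rightarrow> 'e" where
  "extend x a = (SOME A. A \<in> sections E \<and> A x = a)"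

lemma extend:
  assumes "a \<in> fibre E x"
  shows "extend x a \<in> sections E" "extend x a x = a"
proof -
  have "\<exists>A. A \<in> sections E \<and> A x = a" using section_through[OF assms] by metis
  note e = someI_ex[OF this, folded extend_def]
  show "extend x a \<in> sections E" using e by (elim conjE)
  show "extend x a x = a" using e by (elim conjE)
qed

lemma map_extend:
  assumes "l \<in> lists (fibre E x)"
  shows "map (extend x) l \<in> lists (sections E)" "map (\<lambda>A. A x) (map (extend x) l) = l"
  using assms by (induction l) (simp_all add: extend)

definition nabla_form :: "('m \<Rightarrow> 'm tangent) \<Rightarrow> ('m, 'e) form \<Rightarrow> ('m, 'e) form" where
  "nabla_form X = (\<lambda>\<omega>\<in>forms E. \<lambda>x l. if l \<in> lists (fibre E x) then nabla_at nab X (map (extend x) l) \<omega> x else 0)"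

context
  fixes X assumes X: "X \<in> vector_fields E"
begin

lemma nabla_form_apply:
  assumes "\<omega> \<in> forms E" "As \<in> lists (sections E)"
  shows "nabla_form X \<omega> x (map (\<lambda>A. A x) As) = nabla_at nab X As \<omega> x"
proof -
  have l: "map (\<lambda>A. A x) As \<in> lists (fibre E x)" by (rule sections_at_in_lists[OF assms(2)])
  have "nabla_form X \<omega> x (map (\<lambda>A. A x) As) = nabla_at nab X ([] @ map (extend x) (map (\<lambda>A. A x) As)) \<omega> x"
    using l assms(1) by (simp add: nabla_form_def)
  also have "\<dots> = nabla_at nab X ([] @ As) \<omega> x"
    by (rule nabla_at_pointwise[OF X assms(1)]) (use map_extend[OF l] assms(2) in simp_all)
  finally show ?thesis by simp
qed

lemma nabla_form_form:
  assumes \<omega>: "\<omega> \<in> forms E"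
  shows "nabla_form X \<omega> \<in> forms E"
proof (intro formsI alternating_onI subspace_fibre)
  fix x l l' assume l: "l \<in> lists (fibre E x)" "l' \<in> lists (fibre E x)"
  let ?L = "map (extend x) l" and ?L' = "map (extend x) l'"
  have L: "?L \<in> lists (sections E)" "?L' \<in> lists (sections E)" using map_extend l by simp_all
  have ev: "map (\<lambda>A. A x) (?L @ A # ?L') = l @ A x # l'" for A
    unfolding map_append list.map(2) map_extend(2)[OF l(1)] map_extend(2)[OF l(2)] ..
  have app: "nabla_form X \<omega> x (l @ A x # l') = nabla_at nab X (?L @ A # ?L') \<omega> x" if "A \<in> sections E" for A
    using nabla_form_apply[OF \<omega>, of "?L @ A # ?L'" x] L that unfolding ev by simp
  show "lin_on (fibre E x) (\<lambda>a. nabla_form X \<omega> x (l @ a # l'))"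
    unfolding lin_on_def
  proof (intro ballI allI)
    fix a b c d assume "a \<in> fibre E x" "b \<in> fibre E x"
    then obtain A B where A: "A \<in> sections E" "A x = a" "B \<in> sections E" "B x = b"
      using section_through by metis
    have s: "(\<lambda>y. c *\<^sub>R A y + d *\<^sub>R B y) \<in> sections E" by (intro section_linear Cinf_on_const A)
    show "nabla_form X \<omega> x (l @ (c *\<^sub>R a + d *\<^sub>R b) # l') =
        c *\<^sub>R nabla_form X \<omega> x (l @ a # l') + d *\<^sub>R nabla_form X \<omega> x (l @ b # l')"
      using app[OF s] app[OF A(1)] app[OF A(3)]
        nabla_at_slot[OF X A(1,3) L(2) Cinf_on_const[of c] Cinf_on_const[of d] L(1) \<omega>, of x]
      by (simp add: A)
  qed
  fix a assume a: "a \<in> fibre E x"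
  then obtain A where A: "A \<in> sections E" "A x = a" using section_through by metis
  have "map (\<lambda>A. A x) (?L @ A # A # ?L') = l @ a # a # l'"
    unfolding map_append list.map(2) map_extend(2)[OF l(1)] map_extend(2)[OF l(2)] A ..
  then show "nabla_form X \<omega> x (l @ a # a # l') = 0"
    using nabla_form_apply[OF \<omega>, of "?L @ A # A # ?L'" x] nabla_at_repeated[OF X A(1) L(2,1) \<omega>, of x] L A(1) by simp
next
  show "nabla_form X \<omega> x l = 0" if "l \<notin> lists (fibre E x)" for x l
    using that \<omega> by (auto simp add: nabla_form_def)
  show "(\<lambda>y. nabla_form X \<omega> y (map (\<lambda>A. A y) As)) \<in> Cinf E" if "As \<in> lists (sections E)" for As
    unfolding nabla_form_apply[OF \<omega> that] by (rule nabla_at_smooth[OF X that \<omega>])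
qed

lemma nabla_form_derivation: "derivation E 0 (nabla_form X)"
  unfolding derivation_def
proof (intro conjI ballI allI)
  show "nabla_form X \<in> forms E \<rightarrow>\<^sub>E forms E"
  proof (rule PiE_I)
    show "nabla_form X \<omega> = undefined" if "\<omega> \<notin> forms E" for \<omega> using that by (simp add: nabla_form_def)
  qed (rule nabla_form_form)
next
  fix \<omega> \<tau> a b assume w: "\<omega> \<in> forms E" "\<tau> \<in> forms E"
  have l: "(\<lambda>x l. a * u x l + b * v x l) \<in> forms E" if "u \<in> forms E" "v \<in> forms E" for u v
    by (intro form_linear Cinf_on_const that)
  show "nabla_form X (\<lambda>x l. a * \<omega> x l + b * \<tau> x l) = (\<lambda>x l. a * nabla_form X \<omega> x l + b * nabla_form X \<tau> x l)"
    by (rule form_eqI[OF nabla_form_form[OF l[OF w]] l[OF nabla_form_form[OF w(1)] nabla_form_form[OF w(2)]]])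
      (simp only: nabla_form_apply[OF l[OF w]] nabla_form_apply[OF w(1)] nabla_form_apply[OF w(2)]
        nabla_at_const_linear[OF X _ w])
next
  fix k \<omega> assume w: "\<omega> \<in> kforms E k"
  note w' = kform_form[OF w]
  show "nabla_form X \<omega> \<in> kforms E (k + 0)"
  proof (rule kformI[OF nabla_form_form[OF w']])
    show "nabla_form X \<omega> x l = 0" if "length l \<noteq> k + 0" for x l
      using nabla_at_degree[OF X kform_degree[OF w], where As = "map (extend x) l" and x = x] that w'
      by (simp add: nabla_form_def)
  qed
  fix \<tau> assume t: "\<tau> \<in> forms E"
  let ?R = "\<lambda>x l. wedge (nabla_form X \<omega>) \<tau> x l + (- 1) ^ (0 * k) * wedge \<omega> (nabla_form X \<tau>) x l"
  show "nabla_form X (wedge \<omega> \<tau>) = ?R"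
  proof (rule form_eqI[OF nabla_form_form[OF form_wedge[OF w' t]]])
    show "?R \<in> forms E"
      using form_add[OF form_wedge[OF nabla_form_form[OF w'] t] form_wedge[OF w' nabla_form_form[OF t]]] by simp
    fix As x assume As: "As \<in> lists (sections E)"
    have "shuffle_prod (nabla_form X \<omega> x) (\<tau> x) (map (\<lambda>A. A x) As) =
        shuffle_prod (\<lambda>Bs. nabla_at nab X Bs \<omega> x) (\<lambda>Bs. \<tau> x (map (\<lambda>A. A x) Bs)) As"
      unfolding shuffle_prod_map[symmetric]
      by (rule shuffle_prod_cong[OF As]) (simp_all only: nabla_form_apply[OF w'])
    moreover have "shuffle_prod (\<omega> x) (nabla_form X \<tau> x) (map (\<lambda>A. A x) As) =
        shuffle_prod (\<lambda>Bs. \<omega> x (map (\<lambda>A. A x) Bs)) (\<lambda>Bs. nabla_at nab X Bs \<tau> x) As"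
      unfolding shuffle_prod_map[symmetric]
      by (rule shuffle_prod_cong[OF As]) (simp_all only: nabla_form_apply[OF t])
    ultimately show "nabla_form X (wedge \<omega> \<tau>) x (map (\<lambda>A. A x) As) = ?R x (map (\<lambda>A. A x) As)"
      unfolding nabla_form_apply[OF form_wedge[OF w' t] As]
      unfolding wedge_eq nabla_at_shuffle_prod[OF X As w' t] by simp
  qed
qed

lemma nabla_form_fun_form:
  assumes "f \<in> Cinf E"
  shows "nabla_form X (fun_form f) = fun_form (\<lambda>x. X x f)"
proof -
  have f: "fun_form f \<in> kforms E 0" by (rule fun_form_kform[OF assms])
  have "nabla_form X (fun_form f) \<in> kforms E 0" using derivation_degree[OF nabla_form_derivation f] by simp
  from kform0_eq[OF this] have "nabla_form X (fun_form f) = fun_form (\<lambda>x. nabla_form X (fun_form f) x [])" .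
  moreover have "nabla_form X (fun_form f) x [] = X x f" for x
    using nabla_form_apply[OF kform_form[OF f], of "[]" x] by (simp add: fun_form_def)
  ultimately show ?thesis by simp
qed

lemma nabla_form_1form:
  assumes "\<alpha> \<in> kforms E 1" "A \<in> sections E"
  shows "nabla_form X \<alpha> x [A x] = X x (\<lambda>y. \<alpha> y [A y]) - \<alpha> x [nab X A x]"
  using nabla_form_apply[OF kform_form[OF assms(1)], of "[A]" x] assms(2) by (simp add: contract_apply)

text \<open>The candidate satisfies the specification and \<open>derivation_eqI\<close> excludes any
  other; 1-forms are compared through their values on sections.\<close>

lemma form_connection_eq: "form_connection E nab X = nabla_form X"
  unfolding form_connection_def
proof (rule the_equality)
  show "derivation E 0 (nabla_form X) \<and>
     (\<forall>f\<in>Cinf E. nabla_form X (fun_form f) = fun_form (\<lambda>x. X x f)) \<and>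
     (\<forall>\<alpha>\<in>kforms E 1. \<forall>A\<in>sections E. \<forall>x.
        nabla_form X \<alpha> x [A x] = X x (\<lambda>y. \<alpha> y [A y]) - \<alpha> x [nab X A x])"
    by (intro conjI ballI allI nabla_form_derivation nabla_form_fun_form nabla_form_1form)
next
  fix P assume "derivation E 0 P \<and>
     (\<forall>f\<in>Cinf E. P (fun_form f) = fun_form (\<lambda>x. X x f)) \<and>
     (\<forall>\<alpha>\<in>kforms E 1. \<forall>A\<in>sections E. \<forall>x.
        P \<alpha> x [A x] = X x (\<lambda>y. \<alpha> y [A y]) - \<alpha> x [nab X A x])"
  then have P: "derivation E 0 P" and f: "\<And>f. f \<in> Cinf E \<Longrightarrow> P (fun_form f) = fun_form (\<lambda>x. X x f)"
    and a: "\<And>\<alpha> A x. \<alpha> \<in> kforms E 1 \<Longrightarrow> A \<in> sections E \<Longrightarrow> P \<alpha> x [A x] = X x (\<lambda>y. \<alpha> y [A y]) - \<alpha> x [nab X A x]"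
    by simp_all
  show "P = nabla_form X"
  proof (rule derivation_eqI[OF P nabla_form_derivation])
    show "P (fun_form f) = nabla_form X (fun_form f)" if "f \<in> Cinf E" for f
      using f[OF that] nabla_form_fun_form[OF that] by simp
    fix \<alpha> assume \<alpha>: "\<alpha> \<in> kforms E 1"
    show "P \<alpha> = nabla_form X \<alpha>"
      by (rule kform1_eqI)
        (use derivation_degree[OF P \<alpha>] derivation_degree[OF nabla_form_derivation \<alpha>] a[OF \<alpha>]
          nabla_form_1form[OF \<alpha>] in simp_all)
  qed
qed

end

end

lemma shuffle_prod_1form_pair:
  assumes "\<And>k. length k \<noteq> 1 \<Longrightarrow> \<eta> k = 0"
  shows "shuffle_prod \<eta> u [a, b] = \<eta> [a] * u [b] - \<eta> [b] * u [a]"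
  using assms[of "[]"] by (simp add: shuffle_prod_1form_Cons[OF assms] contract_apply del: shuffle_prod.simps(2))

text \<open>Moving a 1-form past a form of degree \<open>k\<close> costs \<open>(-1)^k\<close>: this
  is the sign in the Leibniz rule when a derivation of degree 0 is multiplied by a 1-form.\<close>

lemma shuffle_prod_1form_left_commute:
  assumes "\<And>k. length k \<noteq> 1 \<Longrightarrow> \<eta> k = 0" "\<And>l. length l \<noteq> k \<Longrightarrow> w l = 0"
  shows "shuffle_prod \<eta> (shuffle_prod w t) l = (- 1) ^ k * shuffle_prod w (shuffle_prod \<eta> t) l"
proof -
  have g: "grade w = (\<lambda>l. (- 1) ^ k * w l)"
  proof
    show "grade w l = (- 1) ^ k * w l" for l
      using assms(2)[of l] by (cases "length l = k") (simp_all add: grade_def)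
  qed
  have "shuffle_prod \<eta> (shuffle_prod w t) l = shuffle_prod (shuffle_prod \<eta> w) t l"
    by (simp only: shuffle_prod_assoc)
  also have "\<dots> = shuffle_prod (shuffle_prod (grade w) \<eta>) t l"
  proof -
    have "shuffle_prod \<eta> w = shuffle_prod (grade w) \<eta>" by (rule shuffle_prod_1form_commute) (rule assms(1))
    then show ?thesis by (simp only:)
  qed
  finally have "shuffle_prod \<eta> (shuffle_prod w t) l = shuffle_prod (shuffle_prod (grade w) \<eta>) t l" .
  then show ?thesis unfolding shuffle_prod_assoc g shuffle_prod_scale_left .
qed

section \<open>The operator induced by a bundle map\<close>

context smooth_bundle
begin

lemma bundle_map_tangent: "K \<in> bundle_maps_TM E \<Longrightarrow> a \<in> fibre E x \<Longrightarrow> K x a \<in> tangent_space E x"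
  by (simp add: bundle_maps_TM_def)

lemma bundle_map_linear: "K \<in> bundle_maps_TM E \<Longrightarrow> lin_on (fibre E x) (\<lambda>a. K x a f)"
  by (simp add: bundle_maps_TM_def)

lemma bundle_map_frame:
  assumes "K \<in> bundle_maps_TM E" "(U, e) \<in> trivs E" "i < rk E" "f \<in> Cinf E"
  shows "(\<lambda>x. K x (e i x) f) \<in> Cinf_on E U"
proof -
  have "\<forall>(U, e)\<in>trivs E. \<forall>i<rk E. (\<lambda>x. K x (e i x)) \<in> vector_fields_on E U"
    using assms(1) by (simp add: bundle_maps_TM_def)
  from bspec[OF this assms(2), unfolded prod.case, rule_format, OF assms(3)]
  show ?thesis using assms(4) by (simp add: vector_fields_on_def)
qed

text \<open>Smoothness of \<open>K\<close> is given on frames and is transported by expanding the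
  section.\<close>

lemma bundle_map_section:
  assumes K: "K \<in> bundle_maps_TM E" and A: "A \<in> sections E"
  shows "(\<lambda>x. K x (A x)) \<in> vector_fields E"
  unfolding vector_fields_on_def
proof (intro CollectI conjI ballI)
  show "K x (A x) \<in> tangent_space E x" for x
    by (rule bundle_map_tangent[OF K section_in_fibre[OF A]])
  fix f assume f: "f \<in> Cinf E"
  show "(\<lambda>x. K x (A x) f) \<in> Cinf E"
  proof (rule Cinf_on_local)
    fix x
    obtain U e where t: "(U, e) \<in> trivs E" "x \<in> U" by (rule triv_exists)
    have "(\<lambda>y. \<Sum>i<rk E. coframe e i y (A y) * K y (e i y) f) \<in> Cinf_on E U"
      by (intro Cinf_on_sum Cinf_on_mult triv_open[OF t(1)] coframe_section[OF A t(1)] bundle_map_frame[OF K t(1) _ f])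
        simp_all
    then have "(\<lambda>y. K y (A y) f) \<in> Cinf_on E U"
    proof (rule Cinf_on_cong[OF triv_open[OF t(1)], rotated])
      fix y assume y: "y \<in> U"
      have "K y (A y) f = K y (\<Sum>i<rk E. coframe e i y (A y) *\<^sub>R e i y) f"
        using coframe_expand[OF t(1) y section_in_fibre[OF A]] by simp
      also have "\<dots> = (\<Sum>i<rk E. coframe e i y (A y) *\<^sub>R K y (e i y) f)"
        by (rule lin_on_sum[OF subspace_fibre bundle_map_linear[OF K]]) (simp add: frame_in_fibre[OF t(1) y])
      finally show "(\<Sum>i<rk E. coframe e i y (A y) * K y (e i y) f) = K y (A y) f" by simp
    qed
    then show "\<exists>V. open V \<and> x \<in> V \<and> (\<lambda>y. K y (A y) f) \<in> Cinf_on E V"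
      using triv_open[OF t(1)] t(2) by (intro exI[of _ U]) simp
  qed
qed

text \<open>Names the premise in the definition of \<open>form_connection_along\<close>, so that its
  specification can be folded.\<close>

definition represents ::
  "('m \<Rightarrow> 'e \<Rightarrow> 'm tangent) \<Rightarrow> 'm set \<Rightarrow> nat \<Rightarrow> (nat \<Rightarrow> ('m, 'e) form) \<Rightarrow> (nat \<Rightarrow> 'm \<Rightarrow> 'm tangent) \<Rightarrow> bool" where
  "represents K U m \<eta> X \<longleftrightarrow> open U \<and> (\<forall>i<m. \<eta> i \<in> kforms E 1 \<and> X i \<in> vector_fields E) \<and>
     (\<forall>x\<in>U. \<forall>a\<in>fibre E x. K x a = (\<lambda>f. \<Sum>i<m. \<eta> i x [a] * X i x f))"

lemma representsD:
  assumes "represents K U m \<eta> X"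
  shows "open U" "i < m \<Longrightarrow> \<eta> i \<in> kforms E 1" "i < m \<Longrightarrow> X i \<in> vector_fields E"
    "x \<in> U \<Longrightarrow> a \<in> fibre E x \<Longrightarrow> K x a f = (\<Sum>i<m. \<eta> i x [a] * X i x f)"
  using assms by (simp_all add: represents_def)

text \<open>With a frame \<open>e\<close> and its dual frame \<open>\<epsilon>\<close>,
  \<open>K\<close> is locally the sum of the \<open>\<epsilon> i \<otimes> K(e i)\<close>.
  Multiplying both factors by \<rho> makes them global and changes nothing on \<open>N\<close>,
  where \<rho> is 1.\<close>

lemma represents_exists:
  assumes K: "K \<in> bundle_maps_TM E"
  shows "\<exists>U m \<eta> X. x \<in> U \<and> represents K U m \<eta> X"
proof -
  obtain U e \<rho> C N where b: "(U, e) \<in> trivs E" "\<rho> \<in> Cinf E" "closed C" "C \<subseteq> U" "open N" "x \<in> N" "N \<subseteq> C"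
    "\<And>y. y \<in> N \<Longrightarrow> \<rho> y = 1" "\<And>y. y \<notin> C \<Longrightarrow> \<rho> y = 0"
    using adapted_frame[of x] by metis
  have "represents K N (rk E) (\<lambda>i. lin_form (\<lambda>x a. \<rho> x * coframe e i x a)) (\<lambda>i x. K x (\<rho> x *\<^sub>R e i x))"
    unfolding represents_def
  proof (intro conjI allI impI ballI ext)
    fix i assume i: "i < rk E"
    show "lin_form (\<lambda>x a. \<rho> x * coframe e i x a) \<in> kforms E 1"
      by (rule coframe_kform[OF b(1) i b(2,3,4,9)])
    show "(\<lambda>x. K x (\<rho> x *\<^sub>R e i x)) \<in> vector_fields E"
      by (rule bundle_map_section[OF K bump_section[OF b(2,3,4) triv_open[OF b(1)] b(9) frame_section[OF b(1) i]]])
  next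
    fix y a f assume y: "y \<in> N" and a: "a \<in> fibre E y"
    then have yU: "y \<in> U" using b(4,7) by blast
    have "K y a f = K y (\<Sum>i<rk E. coframe e i y a *\<^sub>R e i y) f"
      using coframe_expand[OF b(1) yU a] by simp
    also have "\<dots> = (\<Sum>i<rk E. coframe e i y a *\<^sub>R K y (e i y) f)"
      by (rule lin_on_sum[OF subspace_fibre bundle_map_linear[OF K]]) (simp add: frame_in_fibre[OF b(1) yU])
    finally show "K y a f = (\<Sum>i<rk E. lin_form (\<lambda>x a. \<rho> x * coframe e i x a) y [a] * K y (\<rho> y *\<^sub>R e i y) f)"
      by (simp add: lin_form_apply[OF a] b(8)[OF y])
  qed (rule b(5))
  then show ?thesis using b(6) by (intro exI conjI)
qed

lemma derivation_diff:
  assumes P: "derivation E d P" and Q: "derivation E d Q"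
  shows "derivation E d (\<lambda>\<omega>\<in>forms E. \<lambda>x l. P \<omega> x l - Q \<omega> x l)" (is "derivation E d ?R")
proof -
  have form: "(\<lambda>x l. P \<omega> x l - Q \<omega> x l) \<in> forms E" if "\<omega> \<in> forms E" for \<omega>
    using form_linear[OF derivation_form[OF P that] derivation_form[OF Q that] Cinf_on_const[of 1] Cinf_on_const[of "-1"]]
    by simp
  show ?thesis
    unfolding derivation_def
  proof (intro conjI ballI allI)
    show "?R \<in> forms E \<rightarrow>\<^sub>E forms E"
      by (rule PiE_I) (simp_all add: form)
  next
    fix \<omega> \<tau> a b assume w: "\<omega> \<in> forms E" "\<tau> \<in> forms E"
    have "(\<lambda>x l. a * \<omega> x l + b * \<tau> x l) \<in> forms E" by (rule form_linear[OF w Cinf_on_const Cinf_on_const])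
    then show "?R (\<lambda>x l. a * \<omega> x l + b * \<tau> x l) =
        (\<lambda>x l. a * ?R \<omega> x l + b * ?R \<tau> x l)"
      using w by (simp add: derivation_linear[OF P w] derivation_linear[OF Q w] algebra_simps)
  next
    fix k \<omega> assume w: "\<omega> \<in> kforms E k"
    show "?R \<omega> \<in> kforms E (k + d)"
      using form[OF kform_form[OF w]] kform_degree[OF derivation_degree[OF P w]] kform_degree[OF derivation_degree[OF Q w]]
      by (intro kformI) (simp_all add: kform_form[OF w])
    fix \<tau> assume t: "\<tau> \<in> forms E"
    have s: "shuffle_prod (\<lambda>l. u l - v l) w l = shuffle_prod u w l - shuffle_prod v w l"
      "shuffle_prod w (\<lambda>l. u l - v l) l = shuffle_prod w u l - shuffle_prod w v l" for u v w :: "'e list \<Rightarrow> real" and l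
      using shuffle_prod_linear_left[of 1 u "-1" v w l] shuffle_prod_linear_right[of w 1 u "-1" v l] by simp_all
    show "?R (wedge \<omega> \<tau>) =
        (\<lambda>x l. wedge (?R \<omega>) \<tau> x l +
          (- 1) ^ (d * k) * wedge \<omega> (?R \<tau>) x l)"
      using t kform_form[OF w] form_wedge[OF kform_form[OF w] t]
      by (simp add: derivation_wedge[OF P w t] derivation_wedge[OF Q w t])
        (simp add: wedge_eq s algebra_simps)
  qed
qed

end

section \<open>The local derivations built from a representation\<close>

context bundle_connection
begin

definition nabla_rep ::
  "nat \<Rightarrow> (nat \<Rightarrow> ('m, 'e) form) \<Rightarrow> (nat \<Rightarrow> 'm \<Rightarrow> 'm tangent) \<Rightarrow> ('m, 'e) form \<Rightarrow> ('m, 'e) form" where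
  "nabla_rep m \<eta> X = (\<lambda>\<omega>\<in>forms E. \<lambda>x l. \<Sum>i<m. wedge (\<eta> i) (nabla_form (X i) \<omega>) x l)"

text \<open>Each summand is a global 1-form times a derivation of degree 0, so this holds whether or
  not \<open>\<eta>\<close> and \<open>X\<close> represent a bundle map.\<close>

lemma nabla_rep_derivation:
  assumes \<eta>: "\<And>i. i < m \<Longrightarrow> \<eta> i \<in> kforms E 1" and X: "\<And>i. i < m \<Longrightarrow> X i \<in> vector_fields E"
  shows "derivation E 1 (nabla_rep m \<eta> X)"
proof -
  note N = nabla_form_derivation[OF X]
  have apply_rep: "nabla_rep m \<eta> X \<omega> = (\<lambda>x l. \<Sum>i<m. wedge (\<eta> i) (nabla_form (X i) \<omega>) x l)" if "\<omega> \<in> forms E" for \<omega>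
    using that by (simp add: nabla_rep_def)
  have form: "nabla_rep m \<eta> X \<omega> \<in> forms E" if "\<omega> \<in> forms E" for \<omega>
    unfolding apply_rep[OF that]
    by (rule form_sum, rule form_wedge[OF kform_form[OF \<eta>] derivation_form[OF N that]]) simp_all
  show ?thesis
    unfolding derivation_def
  proof (intro conjI ballI allI)
    show "nabla_rep m \<eta> X \<in> forms E \<rightarrow>\<^sub>E forms E"
    proof (rule PiE_I)
      show "nabla_rep m \<eta> X \<omega> = undefined" if "\<omega> \<notin> forms E" for \<omega> using that by (simp add: nabla_rep_def)
    qed (rule form)
  next
    fix \<omega> \<tau> a b assume w: "\<omega> \<in> forms E" "\<tau> \<in> forms E"
    have l: "(\<lambda>x l. a * \<omega> x l + b * \<tau> x l) \<in> forms E" by (rule form_linear[OF w Cinf_on_const Cinf_on_const])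
    show "nabla_rep m \<eta> X (\<lambda>x l. a * \<omega> x l + b * \<tau> x l) = (\<lambda>x l. a * nabla_rep m \<eta> X \<omega> x l + b * nabla_rep m \<eta> X \<tau> x l)"
      unfolding apply_rep[OF l] apply_rep[OF w(1)] apply_rep[OF w(2)] sum_distrib_left sum.distrib[symmetric]
      by (intro ext sum.cong refl)
        (simp only: lessThan_iff derivation_linear[OF N w] wedge_eq shuffle_prod_linear_right)
  next
    fix k \<omega> assume w: "\<omega> \<in> kforms E k"
    note w' = kform_form[OF w]
    show "nabla_rep m \<eta> X \<omega> \<in> kforms E (k + 1)"
    proof (rule kformI[OF form[OF w']])
      fix x and l :: "'e list" assume "length l \<noteq> k + 1"
      then have "wedge (\<eta> i) (nabla_form (X i) \<omega>) x l = 0" if "i < m" for i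
        using kform_degree[OF kform_wedge[OF \<eta>[OF that] derivation_degree[OF N[OF that] w]]] by simp
      then show "nabla_rep m \<eta> X \<omega> x l = 0" unfolding apply_rep[OF w'] by simp
    qed
    fix \<tau> assume t: "\<tau> \<in> forms E"
    show "nabla_rep m \<eta> X (wedge \<omega> \<tau>) =
        (\<lambda>x l. wedge (nabla_rep m \<eta> X \<omega>) \<tau> x l + (- 1) ^ (1 * k) * wedge \<omega> (nabla_rep m \<eta> X \<tau>) x l)"
    proof (intro ext)
      fix x l
      have "wedge (\<eta> i) (nabla_form (X i) (wedge \<omega> \<tau>)) x l =
          wedge (wedge (\<eta> i) (nabla_form (X i) \<omega>)) \<tau> x l +
          (- 1) ^ k * wedge \<omega> (wedge (\<eta> i) (nabla_form (X i) \<tau>)) x l" if "i < m" for i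
      proof -
        have "shuffle_prod (\<eta> i x) (shuffle_prod (\<omega> x) (nabla_form (X i) \<tau> x)) l =
            (- 1) ^ k * shuffle_prod (\<omega> x) (shuffle_prod (\<eta> i x) (nabla_form (X i) \<tau> x)) l"
          by (rule shuffle_prod_1form_left_commute)
            (simp_all add: kform_degree[OF \<eta>[OF that]] kform_degree[OF w])
        then show ?thesis
          unfolding derivation_wedge[OF N[OF that] w t]
          unfolding wedge_eq shuffle_prod_assoc by (simp add: shuffle_prod_add_right)
      qed
      then have "(\<Sum>i<m. wedge (\<eta> i) (nabla_form (X i) (wedge \<omega> \<tau>)) x l) =
          (\<Sum>i<m. wedge (wedge (\<eta> i) (nabla_form (X i) \<omega>)) \<tau> x l) +
          (- 1) ^ k * (\<Sum>i<m. wedge \<omega> (wedge (\<eta> i) (nabla_form (X i) \<tau>)) x l)"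
        by (simp add: sum.distrib sum_distrib_left)
      then show "nabla_rep m \<eta> X (wedge \<omega> \<tau>) x l =
          wedge (nabla_rep m \<eta> X \<omega>) \<tau> x l + (- 1) ^ (1 * k) * wedge \<omega> (nabla_rep m \<eta> X \<tau>) x l"
        unfolding apply_rep[OF form_wedge[OF w' t]] apply_rep[OF w'] apply_rep[OF t]
        by (simp add: wedge_eq shuffle_prod_sum_left shuffle_prod_sum_right)
    qed
  qed
qed

text \<open>Localizing a representation of \<open>K\<close> over \<open>U\<close> by a function \<open>\<rho>\<close> supported in \<open>U\<close> gives a global derivation,
  whose values on functions and 1-forms depend only on \<open>K\<close> and \<open>\<rho>\<close>.\<close>

context
  fixes K U m \<eta> X \<rho>
  assumes rep: "represents K U m \<eta> X" and K: "K \<in> bundle_maps_TM E"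
    and \<rho>: "\<rho> \<in> Cinf E" "\<And>y. y \<notin> U \<Longrightarrow> \<rho> y = 0"
begin

lemma localized_kform: "i < m \<Longrightarrow> (\<lambda>x l. \<rho> x * \<eta> i x l) \<in> kforms E 1"
  using representsD(2)[OF rep, of i] form_scale[OF _ \<rho>(1), of "\<eta> i"] by (simp add: kforms_def)

lemma localized_derivation: "derivation E 1 (nabla_rep m (\<lambda>i x l. \<rho> x * \<eta> i x l) X)"
  by (rule nabla_rep_derivation[OF localized_kform representsD(3)[OF rep]])

lemma localized_represents:
  "a \<in> fibre E x \<Longrightarrow> (\<Sum>i<m. \<rho> x * \<eta> i x [a] * X i x f) = \<rho> x * K x a f"
  using representsD(4)[OF rep, of x a f] \<rho>(2)[of x] by (cases "x \<in> U") (simp_all add: sum_distrib_left mult.assoc)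

lemma localized_fun_form:
  assumes f: "f \<in> Cinf E" and A: "A \<in> sections E"
  shows "nabla_rep m (\<lambda>i x l. \<rho> x * \<eta> i x l) X (fun_form f) x [A x] = \<rho> x * K x (A x) f"
proof -
  have "wedge (\<lambda>x l. \<rho> x * \<eta> i x l) (nabla_form (X i) (fun_form f)) x [A x] = X i x f * (\<rho> x * \<eta> i x [A x])"
    if "i < m" for i
    unfolding nabla_form_fun_form[OF representsD(3)[OF rep that] f]
    unfolding wedge_eq fun_form_def shuffle_prod_scalar_right ..
  then have "nabla_rep m (\<lambda>i x l. \<rho> x * \<eta> i x l) X (fun_form f) x [A x] = (\<Sum>i<m. X i x f * (\<rho> x * \<eta> i x [A x]))"
    using kform_form[OF fun_form_kform[OF f]] by (simp add: nabla_rep_def)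
  then show ?thesis
    using localized_represents[OF section_in_fibre[OF A], of x f] by (simp add: mult_ac)
qed

text \<open>\<open>nab\<close> is linear over functions only for globally defined fields. The factor
  \<rho> makes the local representation of \<open>K\<close> hold everywhere, since both sides vanish
  outside \<open>U\<close>.\<close>

lemma localized_nab:
  assumes A: "A \<in> sections E" and B: "B \<in> sections E"
  shows "(\<Sum>i<m. (\<rho> x * \<eta> i x [A x]) *\<^sub>R nab (X i) B x) = \<rho> x *\<^sub>R nab (\<lambda>x. K x (A x)) B x"
proof -
  have s: "(\<lambda>x. \<rho> x * \<eta> i x [A x]) \<in> Cinf E" if "i < m" for i
    using form_smooth[OF kform_form[OF localized_kform[OF that]], of "[A]"] A by simp
  have "(\<lambda>x. \<Sum>i<m. (\<rho> x * \<eta> i x [A x]) *\<^sub>R nab (X i) B x) = nab (\<lambda>x f. \<Sum>i<m. (\<rho> x * \<eta> i x [A x]) * X i x f) B"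
    by (rule nab_sum_field[OF B, symmetric]) (simp add: s representsD(3)[OF rep])
  also have "(\<lambda>x f. \<Sum>i<m. (\<rho> x * \<eta> i x [A x]) * X i x f) = (\<lambda>x f. \<rho> x * K x (A x) f)"
    by (intro ext localized_represents section_in_fibre A)
  also have "nab (\<lambda>x f. \<rho> x * K x (A x) f) B = (\<lambda>x. \<rho> x *\<^sub>R nab (\<lambda>x. K x (A x)) B x)"
    by (rule nab_scale_field[OF \<rho>(1) bundle_map_section[OF K A] B])
  finally show ?thesis by (rule fun_cong)
qed

lemma localized_1form:
  assumes \<alpha>: "\<alpha> \<in> kforms E 1" and A: "A \<in> sections E" "B \<in> sections E"
  shows "nabla_rep m (\<lambda>i x l. \<rho> x * \<eta> i x l) X \<alpha> x [A x, B x] =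
    \<rho> x * (K x (A x) (\<lambda>y. \<alpha> y [B y]) - \<alpha> x [nab (\<lambda>x. K x (A x)) B x]) -
    \<rho> x * (K x (B x) (\<lambda>y. \<alpha> y [A y]) - \<alpha> x [nab (\<lambda>x. K x (B x)) A x])"
proof -
  have lin: "lin_on (fibre E x) (\<lambda>a. \<alpha> x [a])"
    using alternating_on_lin[OF form_alternating[OF kform_form[OF \<alpha>]], of "[]" x "[]"] by simp
  have main: "(\<Sum>i<m. \<rho> x * \<eta> i x [A x] * (X i x (\<lambda>y. \<alpha> y [B y]) - \<alpha> x [nab (X i) B x])) =
      \<rho> x * (K x (A x) (\<lambda>y. \<alpha> y [B y]) - \<alpha> x [nab (\<lambda>x. K x (A x)) B x])"
    if A: "A \<in> sections E" and B: "B \<in> sections E" for A B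
  proof -
    have nB: "nab (X i) B x \<in> fibre E x" if "i < m" for i
      by (rule section_in_fibre[OF nab_section[OF representsD(3)[OF rep that] B]])
    have nK: "nab (\<lambda>x. K x (A x)) B x \<in> fibre E x"
      by (rule section_in_fibre[OF nab_section[OF bundle_map_section[OF K A] B]])
    have "(\<Sum>i<m. (\<rho> x * \<eta> i x [A x]) *\<^sub>R \<alpha> x [nab (X i) B x]) = \<alpha> x [\<Sum>i<m. (\<rho> x * \<eta> i x [A x]) *\<^sub>R nab (X i) B x]"
      by (rule lin_on_sum[OF subspace_fibre lin, symmetric]) (simp add: nB)
    also have "\<dots> = \<rho> x * \<alpha> x [nab (\<lambda>x. K x (A x)) B x]"
      unfolding localized_nab[OF A B] using lin_on_scale[OF subspace_fibre lin nK] by simp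
    finally show ?thesis
      using localized_represents[OF section_in_fibre[OF A], of x "\<lambda>y. \<alpha> y [B y]"]
      by (simp add: right_diff_distrib sum_subtractf)
  qed
  have "wedge (\<lambda>x l. \<rho> x * \<eta> i x l) (nabla_form (X i) \<alpha>) x [A x, B x] =
      \<rho> x * \<eta> i x [A x] * (X i x (\<lambda>y. \<alpha> y [B y]) - \<alpha> x [nab (X i) B x]) -
      \<rho> x * \<eta> i x [B x] * (X i x (\<lambda>y. \<alpha> y [A y]) - \<alpha> x [nab (X i) A x])" if "i < m" for i
    unfolding wedge_eq nabla_form_1form[OF representsD(3)[OF rep that] \<alpha> A(1), symmetric]
      nabla_form_1form[OF representsD(3)[OF rep that] \<alpha> A(2), symmetric]
    by (rule shuffle_prod_1form_pair) (rule kform_degree[OF localized_kform[OF that]])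
  then have "nabla_rep m (\<lambda>i x l. \<rho> x * \<eta> i x l) X \<alpha> x [A x, B x] =
      (\<Sum>i<m. \<rho> x * \<eta> i x [A x] * (X i x (\<lambda>y. \<alpha> y [B y]) - \<alpha> x [nab (X i) B x])) -
      (\<Sum>i<m. \<rho> x * \<eta> i x [B x] * (X i x (\<lambda>y. \<alpha> y [A y]) - \<alpha> x [nab (X i) A x]))"
    using kform_form[OF \<alpha>] by (simp add: nabla_rep_def sum_subtractf)
  then show ?thesis unfolding main[OF A] main[OF A(2,1)] .
qed

end

text \<open>The cutoff multiplies \<open>\<eta>\<close> only, and the product with
  \<open>\<eta>\<close> is computed pointwise.\<close>

lemma localized_at:
  assumes "\<rho> x = 1"
  shows "nabla_rep m (\<lambda>i x l. \<rho> x * \<eta> i x l) X \<omega> x = nabla_rep m \<eta> X \<omega> x"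
  using assms by (simp add: nabla_rep_def wedge_eq)

text \<open>A bump function vanishing outside both domains turns the two local expressions into
  global derivations with the same values on functions and 1-forms, so \<open>derivation_eqI\<close>
  applies; at \<open>x\<close> the cutoff is invisible.\<close>

lemma nabla_rep_unique:
  assumes K: "K \<in> bundle_maps_TM E" and rep: "represents K U m \<eta> X" "represents K U' m' \<eta>' X'" and x: "x \<in> U" "x \<in> U'"
  shows "nabla_rep m \<eta> X \<omega> x = nabla_rep m' \<eta>' X' \<omega> x"
proof -
  have o: "open (U \<inter> U')" using representsD(1)[OF rep(1)] representsD(1)[OF rep(2)] by (rule open_Int)
  obtain \<rho> C N where b: "\<rho> \<in> Cinf E" "closed C" "C \<subseteq> U \<inter> U'" "open N" "x \<in> N"
    "\<And>y. y \<in> N \<Longrightarrow> \<rho> y = 1" "\<And>y. y \<notin> C \<Longrightarrow> \<rho> y = 0"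
    using bump_exists[OF o, of x] x by (metis IntI)
  have z: "y \<notin> U \<Longrightarrow> \<rho> y = 0" "y \<notin> U' \<Longrightarrow> \<rho> y = 0" for y using b(3,7) by auto
  let ?P = "nabla_rep m (\<lambda>i x l. \<rho> x * \<eta> i x l) X" and ?P' = "nabla_rep m' (\<lambda>i x l. \<rho> x * \<eta>' i x l) X'"
  have l: "derivation E 1 ?P" by (rule localized_derivation[OF rep(1) K b(1)]) (rule z(1))
  have l': "derivation E 1 ?P'" by (rule localized_derivation[OF rep(2) K b(1)]) (rule z(2))
  have "?P = ?P'"
  proof (rule derivation_eqI[OF l l'])
    fix f assume f: "f \<in> Cinf E"
    note k = derivation_degree[OF _ fun_form_kform[OF f], unfolded add_0]
    show "?P (fun_form f) = ?P' (fun_form f)"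
    proof (rule kform1_eqI[OF k[OF l] k[OF l']])
      fix A x assume A: "A \<in> sections E"
      have "?P (fun_form f) x [A x] = \<rho> x * K x (A x) f"
        by (rule localized_fun_form[OF rep(1) K b(1) _ f A]) (rule z(1))
      also have "\<dots> = ?P' (fun_form f) x [A x]"
        by (rule localized_fun_form[OF rep(2) K b(1) _ f A, symmetric]) (rule z(2))
      finally show "?P (fun_form f) x [A x] = ?P' (fun_form f) x [A x]" .
    qed
  next
    fix \<alpha> assume \<alpha>: "\<alpha> \<in> kforms E 1"
    have k: "R \<alpha> \<in> kforms E 2" if "derivation E 1 R" for R
      using derivation_degree[OF that \<alpha>] unfolding one_add_one .
    show "?P \<alpha> = ?P' \<alpha>"
    proof (rule kform2_eqI[OF k[OF l] k[OF l']])
      fix A B x assume A: "A \<in> sections E" "B \<in> sections E"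
      have "?P \<alpha> x [A x, B x] =
          \<rho> x * (K x (A x) (\<lambda>y. \<alpha> y [B y]) - \<alpha> x [nab (\<lambda>x. K x (A x)) B x]) -
          \<rho> x * (K x (B x) (\<lambda>y. \<alpha> y [A y]) - \<alpha> x [nab (\<lambda>x. K x (B x)) A x])"
        by (rule localized_1form[OF rep(1) K b(1) _ \<alpha> A]) (rule z(1))
      also have "\<dots> = ?P' \<alpha> x [A x, B x]"
        by (rule localized_1form[OF rep(2) K b(1) _ \<alpha> A, symmetric]) (rule z(2))
      finally show "?P \<alpha> x [A x, B x] = ?P' \<alpha> x [A x, B x]" .
    qed
  qed
  moreover have "\<rho> x = 1" by (rule b(6)[OF b(5)])
  ultimately show ?thesis
    using localized_at[of \<rho> x m \<eta> X \<omega>] localized_at[of \<rho> x m' \<eta>' X' \<omega>] by simp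
qed

section \<open>Gluing the local derivations\<close>

definition nabla_map :: "('m \<Rightarrow> 'e \<Rightarrow> 'm tangent) \<Rightarrow> ('m, 'e) form \<Rightarrow> ('m, 'e) form" where
  "nabla_map K = (\<lambda>\<omega>\<in>forms E. \<lambda>x. SOME w. \<exists>U m \<eta> X. x \<in> U \<and> represents K U m \<eta> X \<and> w = nabla_rep m \<eta> X \<omega> x)"

context
  fixes K assumes K: "K \<in> bundle_maps_TM E"
begin

lemma nabla_map_eq:
  assumes "represents K U m \<eta> X" "x \<in> U" "\<omega> \<in> forms E"
  shows "nabla_map K \<omega> x = nabla_rep m \<eta> X \<omega> x"
proof -
  have "(SOME w. \<exists>U m \<eta> X. x \<in> U \<and> represents K U m \<eta> X \<and> w = nabla_rep m \<eta> X \<omega> x) = nabla_rep m \<eta> X \<omega> x"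
  proof (rule some_equality)
    show "\<exists>U' m' \<eta>' X'. x \<in> U' \<and> represents K U' m' \<eta>' X' \<and> nabla_rep m \<eta> X \<omega> x = nabla_rep m' \<eta>' X' \<omega> x"
      by (rule exI[of _ U], rule exI[of _ m], rule exI[of _ \<eta>], rule exI[of _ X]) (use assms(1,2) in simp)
    show "w = nabla_rep m \<eta> X \<omega> x"
      if w: "\<exists>U' m' \<eta>' X'. x \<in> U' \<and> represents K U' m' \<eta>' X' \<and> w = nabla_rep m' \<eta>' X' \<omega> x" for w
    proof -
      obtain U' m' \<eta>' X' where "x \<in> U'" "represents K U' m' \<eta>' X'" "w = nabla_rep m' \<eta>' X' \<omega> x"
        using w by (elim exE conjE)
      then show ?thesis using nabla_rep_unique[OF K _ assms(1) _ assms(2)] by simp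
    qed
  qed
  then show ?thesis using assms(3) by (simp add: nabla_map_def)
qed

text \<open>One derivation \<open>R\<close> computes \<open>nabla_map K\<close> for all forms
  throughout a neighbourhood, so the laws of a derivation, which can be checked point by point,
  carry over from \<open>R\<close>.\<close>

lemma nabla_map_locally:
  obtains U R where "open U" "x \<in> U" "derivation E 1 R" "\<forall>y\<in>U. \<forall>\<omega>\<in>forms E. nabla_map K \<omega> y = R \<omega> y"
proof -
  obtain U m \<eta> X where r: "x \<in> U" "represents K U m \<eta> X"
    using represents_exists[OF K, of x] by (elim exE conjE)
  have "derivation E 1 (nabla_rep m \<eta> X)"
    by (rule nabla_rep_derivation[OF representsD(2)[OF r(2)] representsD(3)[OF r(2)]])
  then show ?thesis
    using that[OF representsD(1)[OF r(2)] r(1)] nabla_map_eq[OF r(2)] by blast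
qed

lemma nabla_map_derivation: "derivation E 1 (nabla_map K)"
proof -
  have form: "nabla_map K \<omega> \<in> forms E" if w: "\<omega> \<in> forms E" for \<omega>
  proof (rule forms_local)
    fix x
    obtain U R where r: "open U" "x \<in> U" "derivation E 1 R" "\<forall>y\<in>U. \<forall>\<omega>\<in>forms E. nabla_map K \<omega> y = R \<omega> y"
      by (rule nabla_map_locally)
    show "\<exists>N \<omega>'. open N \<and> x \<in> N \<and> \<omega>' \<in> forms E \<and> (\<forall>y\<in>N. nabla_map K \<omega> y = \<omega>' y)"
      by (rule exI[of _ U], rule exI[of _ "R \<omega>"])
        (intro conjI ballI r(1,2) derivation_form[OF r(3) w] r(4)[rule_format, OF _ w])
  qed
  show ?thesis
    unfolding derivation_def
  proof (intro conjI ballI allI)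
    show "nabla_map K \<in> forms E \<rightarrow>\<^sub>E forms E"
    proof (rule PiE_I)
      show "nabla_map K \<omega> = undefined" if "\<omega> \<notin> forms E" for \<omega> using that by (simp add: nabla_map_def)
    qed (rule form)
  next
    fix \<omega> \<tau> a b assume w: "\<omega> \<in> forms E" "\<tau> \<in> forms E"
    have l: "(\<lambda>x l. a * \<omega> x l + b * \<tau> x l) \<in> forms E" by (rule form_linear[OF w Cinf_on_const Cinf_on_const])
    show "nabla_map K (\<lambda>x l. a * \<omega> x l + b * \<tau> x l) = (\<lambda>x l. a * nabla_map K \<omega> x l + b * nabla_map K \<tau> x l)"
    proof
      fix x
      obtain U R where r: "open U" "x \<in> U" "derivation E 1 R" "\<forall>y\<in>U. \<forall>\<omega>\<in>forms E. nabla_map K \<omega> y = R \<omega> y"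
        by (rule nabla_map_locally)
      show "nabla_map K (\<lambda>x l. a * \<omega> x l + b * \<tau> x l) x = (\<lambda>l. a * nabla_map K \<omega> x l + b * nabla_map K \<tau> x l)"
        unfolding r(4)[rule_format, OF r(2) l] r(4)[rule_format, OF r(2) w(1)] r(4)[rule_format, OF r(2) w(2)] derivation_linear[OF r(3) w] ..
    qed
  next
    fix k \<omega> assume w: "\<omega> \<in> kforms E k"
    note w' = kform_form[OF w]
    show "nabla_map K \<omega> \<in> kforms E (k + 1)"
    proof (rule kformI[OF form[OF w']])
      fix x and l :: "'e list" assume l: "length l \<noteq> k + 1"
      obtain U R where r: "open U" "x \<in> U" "derivation E 1 R" "\<forall>y\<in>U. \<forall>\<omega>\<in>forms E. nabla_map K \<omega> y = R \<omega> y"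
        by (rule nabla_map_locally)
      show "nabla_map K \<omega> x l = 0"
        unfolding r(4)[rule_format, OF r(2) w'] by (rule kform_degree[OF derivation_degree[OF r(3) w] l])
    qed
    fix \<tau> assume t: "\<tau> \<in> forms E"
    show "nabla_map K (wedge \<omega> \<tau>) =
        (\<lambda>x l. wedge (nabla_map K \<omega>) \<tau> x l + (- 1) ^ (1 * k) * wedge \<omega> (nabla_map K \<tau>) x l)"
    proof
      fix x
      obtain U R where r: "open U" "x \<in> U" "derivation E 1 R" "\<forall>y\<in>U. \<forall>\<omega>\<in>forms E. nabla_map K \<omega> y = R \<omega> y"
        by (rule nabla_map_locally)
      show "nabla_map K (wedge \<omega> \<tau>) x =
          (\<lambda>l. wedge (nabla_map K \<omega>) \<tau> x l + (- 1) ^ (1 * k) * wedge \<omega> (nabla_map K \<tau>) x l)"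
        unfolding r(4)[rule_format, OF r(2) form_wedge[OF w' t]] derivation_wedge[OF r(3) w t]
        unfolding wedge_eq r(4)[rule_format, OF r(2) w'] r(4)[rule_format, OF r(2) t] ..
    qed
  qed
qed

text \<open>The values of the localized derivations are known in terms of \<open>K\<close> and
  \<rho>; evaluation at a point where \<rho> is 1 removes the cutoff.\<close>

lemma nabla_map_values:
  shows nabla_map_fun_form: "f \<in> Cinf E \<Longrightarrow> A \<in> sections E \<Longrightarrow> nabla_map K (fun_form f) x [A x] = K x (A x) f"
    and nabla_map_1form: "\<alpha> \<in> kforms E 1 \<Longrightarrow> A \<in> sections E \<Longrightarrow> B \<in> sections E \<Longrightarrow>
      nabla_map K \<alpha> x [A x, B x] = K x (A x) (\<lambda>y. \<alpha> y [B y]) - \<alpha> x [nab (\<lambda>x. K x (A x)) B x] -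
        (K x (B x) (\<lambda>y. \<alpha> y [A y]) - \<alpha> x [nab (\<lambda>x. K x (B x)) A x])"
proof -
  obtain U m \<eta> X where r: "x \<in> U" "represents K U m \<eta> X"
    using represents_exists[OF K, of x] by (elim exE conjE)
  obtain \<rho> C N where b: "\<rho> \<in> Cinf E" "closed C" "C \<subseteq> U" "open N" "x \<in> N"
    "\<And>y. y \<in> N \<Longrightarrow> \<rho> y = 1" "\<And>y. y \<notin> C \<Longrightarrow> \<rho> y = 0"
    using bump_exists[OF representsD(1)[OF r(2)] r(1)] by metis
  have z: "y \<notin> U \<Longrightarrow> \<rho> y = 0" for y using b(3,7) by auto
  have one: "\<rho> x = 1" by (rule b(6)[OF b(5)])
  have l: "nabla_map K \<omega> x = nabla_rep m (\<lambda>i x l. \<rho> x * \<eta> i x l) X \<omega> x" if "\<omega> \<in> forms E" for \<omega>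
    using nabla_map_eq[OF r(2,1) that] localized_at[of \<rho> x m \<eta> X \<omega>] one by simp
  show "nabla_map K (fun_form f) x [A x] = K x (A x) f" if f: "f \<in> Cinf E" and A: "A \<in> sections E"
  proof -
    have "nabla_map K (fun_form f) x [A x] = \<rho> x * K x (A x) f"
      unfolding l[OF kform_form[OF fun_form_kform[OF f]]]
      by (rule localized_fun_form[OF r(2) K b(1) _ f A]) (rule z)
    then show ?thesis by (simp add: one)
  qed
  show "nabla_map K \<alpha> x [A x, B x] = K x (A x) (\<lambda>y. \<alpha> y [B y]) - \<alpha> x [nab (\<lambda>x. K x (A x)) B x] -
        (K x (B x) (\<lambda>y. \<alpha> y [A y]) - \<alpha> x [nab (\<lambda>x. K x (B x)) A x])"
    if \<alpha>: "\<alpha> \<in> kforms E 1" and A: "A \<in> sections E" and B: "B \<in> sections E"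
  proof -
    have "nabla_map K \<alpha> x [A x, B x] =
        \<rho> x * (K x (A x) (\<lambda>y. \<alpha> y [B y]) - \<alpha> x [nab (\<lambda>x. K x (A x)) B x]) -
        \<rho> x * (K x (B x) (\<lambda>y. \<alpha> y [A y]) - \<alpha> x [nab (\<lambda>x. K x (B x)) A x])"
      unfolding l[OF kform_form[OF \<alpha>]]
      by (rule localized_1form[OF r(2) K b(1) _ \<alpha> A B]) (rule z)
    then show ?thesis by (simp add: one)
  qed
qed

text \<open>Every point lies in the domain of some representation, so at most one form satisfies the
  specification; that \<open>nabla_map K\<close> satisfies it for all representations at once is
  \<open>nabla_map_eq\<close>.\<close>

lemma form_connection_along_eq:
  assumes w: "\<omega> \<in> forms E"
  shows "form_connection_along E nab K \<omega> = nabla_map K \<omega>"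
proof -
  have rep_eq: "nabla_rep m \<eta> X \<omega> x = (\<lambda>l. \<Sum>i<m. wedge (\<eta> i) (form_connection E nab (X i) \<omega>) x l)"
    if "\<And>i. i < m \<Longrightarrow> X i \<in> vector_fields E" for m \<eta> X x
    using w that by (simp add: nabla_rep_def form_connection_eq)
  show ?thesis
    unfolding form_connection_along_def
  proof (rule the_equality)
    show "nabla_map K \<omega> \<in> forms E \<and>
     (\<forall>U (m::nat) \<eta> X.
        open U \<and> (\<forall>i<m. \<eta> i \<in> kforms E 1 \<and> X i \<in> vector_fields E) \<and>
        (\<forall>x\<in>U. \<forall>a\<in>fibre E x. K x a = (\<lambda>f. \<Sum>i<m. \<eta> i x [a] * X i x f)) \<longrightarrow>
        (\<forall>x\<in>U. nabla_map K \<omega> x = (\<lambda>l. \<Sum>i<m. wedge (\<eta> i) (form_connection E nab (X i) \<omega>) x l)))"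
      unfolding represents_def[symmetric]
    proof (intro conjI allI impI ballI)
      show "nabla_map K \<omega> \<in> forms E" by (rule derivation_form[OF nabla_map_derivation w])
      fix U m \<eta> X x assume r: "represents K U m \<eta> X" and x: "x \<in> U"
      show "nabla_map K \<omega> x = (\<lambda>l. \<Sum>i<m. wedge (\<eta> i) (form_connection E nab (X i) \<omega>) x l)"
        unfolding nabla_map_eq[OF r x w] by (rule rep_eq) (rule representsD(3)[OF r])
    qed
  next
    fix \<theta> assume "\<theta> \<in> forms E \<and>
     (\<forall>U (m::nat) \<eta> X.
        open U \<and> (\<forall>i<m. \<eta> i \<in> kforms E 1 \<and> X i \<in> vector_fields E) \<and>
        (\<forall>x\<in>U. \<forall>a\<in>fibre E x. K x a = (\<lambda>f. \<Sum>i<m. \<eta> i x [a] * X i x f)) \<longrightarrow>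
        (\<forall>x\<in>U. \<theta> x = (\<lambda>l. \<Sum>i<m. wedge (\<eta> i) (form_connection E nab (X i) \<omega>) x l)))"
    then have \<theta>: "\<forall>U m \<eta> X. represents K U m \<eta> X \<longrightarrow>
        (\<forall>x\<in>U. \<theta> x = (\<lambda>l. \<Sum>i<m. wedge (\<eta> i) (form_connection E nab (X i) \<omega>) x l))"
      unfolding represents_def[symmetric] by (elim conjE)
    show "\<theta> = nabla_map K \<omega>"
    proof
      fix x
      obtain U m \<eta> X where r: "x \<in> U" "represents K U m \<eta> X"
    using represents_exists[OF K, of x] by (elim exE conjE)
      have "nabla_rep m \<eta> X \<omega> x = (\<lambda>l. \<Sum>i<m. wedge (\<eta> i) (form_connection E nab (X i) \<omega>) x l)"
        by (rule rep_eq) (rule representsD(3)[OF r(2)])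
      then show "\<theta> x = nabla_map K \<omega> x"
        unfolding nabla_map_eq[OF r(2,1) w] using \<theta>[rule_format, OF r(2,1)] by simp
    qed
  qed
qed

end

end

section \<open>The algebroid differential\<close>

locale algebroid_connection = bundle_connection E nab
  for E :: "('m::{t2_space,second_countable_topology}, 'b::real_inner, 'e::real_vector) lie_algebroid"
    and nab :: "('m, 'e) connection" +
  assumes algebroid: "is_lie_algebroid E"
begin

lemma anchor_bundle_map: "anchor E \<in> bundle_maps_TM E"
  using algebroid unfolding is_lie_algebroid_def by (elim conjE)

lemma anchored_field: "A \<in> sections E \<Longrightarrow> anchored E A \<in> vector_fields E"
  unfolding anchored_def by (rule bundle_map_section[OF anchor_bundle_map])

lemma anchored_linear:
  assumes "A \<in> sections E" "B \<in> sections E"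
  shows "anchored E (\<lambda>x. f x *\<^sub>R A x + g x *\<^sub>R B x) = (\<lambda>x h. f x * anchored E A x h + g x * anchored E B x h)"
  using lin_onD[OF bundle_map_linear[OF anchor_bundle_map] section_in_fibre[OF assms(1)] section_in_fibre[OF assms(2)]]
  by (simp add: anchored_def fun_eq_iff)

lemma anchored_scale:
  assumes "A \<in> sections E"
  shows "anchored E (\<lambda>x. f x *\<^sub>R A x) = (\<lambda>x h. f x * anchored E A x h)"
  using anchored_linear[OF assms assms, of f "\<lambda>x. 0"] by simp

lemma bracket_section: "A \<in> sections E \<Longrightarrow> B \<in> sections E \<Longrightarrow> bracket E A B \<in> sections E"
  using algebroid by (simp add: is_lie_algebroid_def)

lemma bracket_linear:
  assumes "A \<in> sections E" "B \<in> sections E" "C \<in> sections E"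
  shows "bracket E (\<lambda>x. c *\<^sub>R A x + d *\<^sub>R B x) C = (\<lambda>x. c *\<^sub>R bracket E A C x + d *\<^sub>R bracket E B C x)"
    "bracket E C (\<lambda>x. c *\<^sub>R A x + d *\<^sub>R B x) = (\<lambda>x. c *\<^sub>R bracket E C A x + d *\<^sub>R bracket E C B x)"
  using algebroid assms by (simp_all add: is_lie_algebroid_def)

lemma bracket_self: "A \<in> sections E \<Longrightarrow> bracket E A A = (\<lambda>x. 0)"
  using algebroid by (simp add: is_lie_algebroid_def)

text \<open>Polarization of \<open>bracket_self\<close>.\<close>

lemma bracket_antisym:
  assumes A: "A \<in> sections E" and B: "B \<in> sections E"
  shows "bracket E A B x = - bracket E B A x"
proof -
  let ?S = "\<lambda>x. 1 *\<^sub>R A x + 1 *\<^sub>R B x"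
  have S: "?S \<in> sections E" by (rule section_linear[OF Cinf_on_const Cinf_on_const A B])
  have "bracket E ?S ?S x = 0" using bracket_self[OF S] by simp
  then show ?thesis
    unfolding bracket_linear(1)[OF A B S] bracket_linear(2)[OF A B A] bracket_linear(2)[OF A B B]
    using bracket_self[OF A] bracket_self[OF B] by (simp add: eq_neg_iff_add_eq_0)
qed

lemma bracket_leibniz:
  "f \<in> Cinf E \<Longrightarrow> A \<in> sections E \<Longrightarrow> B \<in> sections E \<Longrightarrow>
    bracket E A (\<lambda>x. f x *\<^sub>R B x) = (\<lambda>x. f x *\<^sub>R bracket E A B x + anchored E A x f *\<^sub>R B x)"
  using algebroid by (simp add: is_lie_algebroid_def anchored_def)

lemma induced_E_connection: "is_E_connection E (induced_E_connection E nab)"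
  unfolding is_E_connection_def induced_E_connection_def
proof (intro conjI ballI allI)
  fix A B assume A: "A \<in> sections E" and B: "B \<in> sections E"
  note q = anchored_field[OF A]
  show "nab (anchored E A) B \<in> sections E" by (rule nab_section[OF q B])
  fix f assume f: "f \<in> Cinf E"
  show "nab (anchored E (\<lambda>x. f x *\<^sub>R A x)) B = (\<lambda>x. f x *\<^sub>R nab (anchored E A) B x)"
    unfolding anchored_scale[OF A] by (rule nab_scale_field[OF f q B])
  show "nab (anchored E A) (\<lambda>x. f x *\<^sub>R B x) = (\<lambda>x. anchor E x (A x) f *\<^sub>R B x + f x *\<^sub>R nab (anchored E A) B x)"
    unfolding nab_leibniz[OF f q B] by (simp add: anchored_def)
next
  fix A B C c d assume A: "A \<in> sections E" and B: "B \<in> sections E" and C: "C \<in> sections E"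
  have s: "(\<lambda>x h. c * anchored E A x h) \<in> vector_fields E" "(\<lambda>x h. d * anchored E B x h) \<in> vector_fields E"
    by (rule vector_field_scale[OF anchored_field[OF A] Cinf_on_const],
        rule vector_field_scale[OF anchored_field[OF B] Cinf_on_const])
  show "nab (anchored E (\<lambda>x. c *\<^sub>R A x + d *\<^sub>R B x)) C =
      (\<lambda>x. c *\<^sub>R nab (anchored E A) C x + d *\<^sub>R nab (anchored E B) C x)"
    unfolding anchored_linear[OF A B] nab_add_field[OF s C]
      nab_scale_field[OF Cinf_on_const anchored_field[OF A] C] nab_scale_field[OF Cinf_on_const anchored_field[OF B] C] ..
  show "nab (anchored E C) (\<lambda>x. c *\<^sub>R A x + d *\<^sub>R B x) =
      (\<lambda>x. c *\<^sub>R nab (anchored E C) A x + d *\<^sub>R nab (anchored E C) B x)"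
    by (rule nab_const_linear[OF anchored_field[OF C] A B])
qed

section \<open>The torsion as a tensor\<close>

abbreviation tor :: "('m \<Rightarrow> 'e) \<Rightarrow> ('m \<Rightarrow> 'e) \<Rightarrow> 'm \<Rightarrow> 'e" where
  "tor \<equiv> torsion E (induced_E_connection E nab)"

lemma tor_eq: "tor A B = (\<lambda>x. nab (anchored E A) B x - nab (anchored E B) A x - bracket E A B x)"
  by (simp add: torsion_def induced_E_connection_def)

lemma tor_section: "A \<in> sections E \<Longrightarrow> B \<in> sections E \<Longrightarrow> tor A B \<in> sections E"
  unfolding tor_eq by (intro section_diff nab_section[OF anchored_field] bracket_section)

lemma tor_antisym: "A \<in> sections E \<Longrightarrow> B \<in> sections E \<Longrightarrow> tor A B x = - tor B A x"
  unfolding tor_eq using bracket_antisym[of A B x] by simp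

lemma tor_add:
  assumes A: "A \<in> sections E" and B: "B \<in> sections E" and C: "C \<in> sections E"
  shows "tor A (\<lambda>x. B x + C x) x = tor A B x + tor A C x"
proof -
  have "(\<lambda>x. B x + C x) = (\<lambda>x. 1 *\<^sub>R B x + 1 *\<^sub>R C x)" by simp
  then have b: "bracket E A (\<lambda>x. B x + C x) x = bracket E A B x + bracket E A C x"
    using bracket_linear(2)[OF B C A, of 1 1] by simp
  have "anchored E (\<lambda>x. B x + C x) = (\<lambda>x h. anchored E B x h + anchored E C x h)"
    using anchored_linear[OF B C, of "\<lambda>x. 1" "\<lambda>x. 1"] by simp
  then show ?thesis
    unfolding tor_eq
    by (simp add: b nab_add[OF anchored_field[OF A] B C] nab_add_field[OF anchored_field[OF B] anchored_field[OF C] A])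
qed

text \<open>The connection contributes \<open>(qA)(f) B\<close> through its Leibniz rule, the
  bracket contributes the same term, and the torsion takes their difference.\<close>

lemma tor_scale:
  assumes f: "f \<in> Cinf E" and A: "A \<in> sections E" and B: "B \<in> sections E"
  shows "tor A (\<lambda>x. f x *\<^sub>R B x) x = f x *\<^sub>R tor A B x"
  unfolding tor_eq anchored_scale[OF B] nab_scale_field[OF f anchored_field[OF B] A]
    nab_leibniz[OF f anchored_field[OF A] B] bracket_leibniz[OF f A B]
  by (simp add: algebra_simps)

text \<open>Linearity over functions is applied to the decomposition of
  \<open>section_vanishing\<close>, one summand at a time.\<close>

lemma tor_vanishing:
  assumes A: "A \<in> sections E" and B: "B \<in> sections E" "B x = 0"
  shows "tor A B x = 0"
proof -
  obtain n :: nat and g C where "\<forall>j. g j \<in> Cinf E \<and> g j x = 0 \<and> C j \<in> sections E"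
    and B_eq: "B = (\<lambda>y. \<Sum>j<n. g j y *\<^sub>R C j y)"
    using section_vanishing[OF B] by (elim exE conjE)
  then have v: "g j \<in> Cinf E" "g j x = 0" "C j \<in> sections E" for j by simp_all
  have "tor A (\<lambda>y. \<Sum>j<m. g j y *\<^sub>R C j y) x = 0" for m
  proof (induction m)
    case 0
    show ?case using tor_scale[OF Cinf_on_const[of 0] A A] by simp
  next
    case (Suc m)
    have s: "(\<lambda>y. \<Sum>j<m. g j y *\<^sub>R C j y) \<in> sections E"
      by (rule section_sum, rule section_scale[OF v(1) v(3)])
    show ?case
      using tor_add[OF A s section_scale[OF v(1) v(3)], of m m x] tor_scale[OF v(1) A v(3), of m m x] Suc v(2)[of m]
      by simp
  qed
  then show ?thesis unfolding B_eq by simp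
qed

lemma tor_pointwise_right:
  assumes A: "A \<in> sections E" and B: "B \<in> sections E" "B' \<in> sections E" "B x = B' x"
  shows "tor A B x = tor A B' x"
proof -
  have n: "(\<lambda>x. - 1 *\<^sub>R B' x) \<in> sections E" by (rule section_scale[OF Cinf_on_const B(2)])
  have s: "(\<lambda>x. B x + - 1 *\<^sub>R B' x) \<in> sections E" by (rule section_add[OF B(1) n])
  have "tor A (\<lambda>x. B x + - 1 *\<^sub>R B' x) x = 0" by (rule tor_vanishing[OF A s]) (simp add: B(3))
  then show ?thesis
    unfolding tor_add[OF A B(1) n] tor_scale[OF Cinf_on_const A B(2)] by simp
qed

text \<open>The second slot is changed directly, the first through antisymmetry.\<close>

lemma tor_pointwise:
  assumes "A \<in> sections E" "A' \<in> sections E" "A x = A' x" "B \<in> sections E" "B' \<in> sections E" "B x = B' x"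
  shows "tor A B x = tor A' B' x"
  using tor_pointwise_right[OF assms(1,4,5,6)] tor_pointwise_right[OF assms(5,1,2,3)]
    tor_antisym[OF assms(1,5)] tor_antisym[OF assms(2,5)] by simp

definition tor_tensor :: "'m \<Rightarrow> 'e \<Rightarrow> 'e \<Rightarrow> 'e" where
  "tor_tensor x a b = (if a \<in> fibre E x \<and> b \<in> fibre E x then tor (extend x a) (extend x b) x else 0)"

lemma tor_tensor_apply:
  assumes A: "A \<in> sections E" and B: "B \<in> sections E"
  shows "tor_tensor x (A x) (B x) = tor A B x"
proof -
  have f: "A x \<in> fibre E x" "B x \<in> fibre E x" using A B by simp_all
  show ?thesis
    using tor_pointwise[OF extend(1)[OF f(1)] A extend(2)[OF f(1)] extend(1)[OF f(2)] B extend(2)[OF f(2)]] f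
    by (simp add: tor_tensor_def)
qed

lemma tor_tensor_antisym:
  assumes "a \<in> fibre E x" "b \<in> fibre E x"
  shows "tor_tensor x a b = - tor_tensor x b a"
  using tor_antisym[OF extend(1)[OF assms(1)] extend(1)[OF assms(2)]] assms by (simp add: tor_tensor_def)

lemma tor_tensor_linear:
  assumes a: "a \<in> fibre E x"
  shows "lin_on (fibre E x) (\<lambda>b. tor_tensor x a b)"
  unfolding lin_on_def
proof (intro ballI allI)
  fix b c s t assume b: "b \<in> fibre E x" and c: "c \<in> fibre E x"
  note A = extend[OF a] and B = extend[OF b] and C = extend[OF c]
  have S: "(\<lambda>y. s *\<^sub>R extend x b y) \<in> sections E" "(\<lambda>y. t *\<^sub>R extend x c y) \<in> sections E"
    by (rule section_scale[OF Cinf_on_const B(1)], rule section_scale[OF Cinf_on_const C(1)])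
  have "tor_tensor x a (s *\<^sub>R b + t *\<^sub>R c) = tor (extend x a) (\<lambda>y. s *\<^sub>R extend x b y + t *\<^sub>R extend x c y) x"
    using tor_tensor_apply[OF A(1) section_add[OF S], of x] unfolding A(2) B(2) C(2) .
  also have "\<dots> = s *\<^sub>R tor (extend x a) (extend x b) x + t *\<^sub>R tor (extend x a) (extend x c) x"
    unfolding tor_add[OF A(1) S] tor_scale[OF Cinf_on_const A(1) B(1)] tor_scale[OF Cinf_on_const A(1) C(1)] ..
  finally show "tor_tensor x a (s *\<^sub>R b + t *\<^sub>R c) = s *\<^sub>R tor_tensor x a b + t *\<^sub>R tor_tensor x a c"
    using a b c by (simp add: tor_tensor_def)
qed

lemma tor_tensor_2form: "tor_tensor \<in> E_valued_2forms E"
  unfolding E_valued_2forms_def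
proof (intro CollectI conjI allI ballI impI)
  fix x a b assume a: "a \<in> fibre E x" and b: "b \<in> fibre E x"
  have "tor_tensor x a b = tor (extend x a) (extend x b) x" using a b by (simp add: tor_tensor_def)
  then show "tor_tensor x a b \<in> fibre E x"
    using section_in_fibre[OF tor_section[OF extend(1)[OF a] extend(1)[OF b]]] by simp
next
  fix x a assume a: "a \<in> fibre E x"
  show "lin_on (fibre E x) (\<lambda>b. tor_tensor x a b)" by (rule tor_tensor_linear[OF a])
  show "lin_on (fibre E x) (\<lambda>b. tor_tensor x b a)"
    unfolding lin_on_def
  proof (intro ballI allI)
    fix b c s t assume b: "b \<in> fibre E x" and c: "c \<in> fibre E x"
    have "s *\<^sub>R b + t *\<^sub>R c \<in> fibre E x"
      using b c by (simp add: subspace_add[OF subspace_fibre] subspace_scale[OF subspace_fibre])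
    then show "tor_tensor x (s *\<^sub>R b + t *\<^sub>R c) a = s *\<^sub>R tor_tensor x b a + t *\<^sub>R tor_tensor x c a"
      using lin_onD[OF tor_tensor_linear[OF a] b c, of s t] tor_tensor_antisym[OF _ a] b c by simp
  qed
  have "tor_tensor x a a = - tor_tensor x a a" by (rule tor_tensor_antisym[OF a a])
  then have "2 *\<^sub>R tor_tensor x a a = 0" by (simp add: scaleR_2 eq_neg_iff_add_eq_0)
  then show "tor_tensor x a a = 0" by simp
next
  fix x a b assume "a \<notin> fibre E x \<or> b \<notin> fibre E x"
  then show "tor_tensor x a b = 0" by (auto simp: tor_tensor_def)
next
  fix p assume p: "p \<in> trivs E"
  obtain U e where pe: "p = (U, e)" by (cases p)
  have t: "(U, e) \<in> trivs E" using p pe by simp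
  show "case p of (U, e) \<Rightarrow> \<forall>i<rk E. \<forall>j<rk E. (\<lambda>x. tor_tensor x (e i x) (e j x)) \<in> sections_on E U"
    unfolding pe prod.case
  proof (intro allI impI)
    fix i j assume ij: "i < rk E" "j < rk E"
    show "(\<lambda>x. tor_tensor x (e i x) (e j x)) \<in> sections_on E U"
    proof (rule sections_on_local[OF triv_open[OF t]])
      fix x assume x: "x \<in> U"
      obtain \<rho> C N where b: "\<rho> \<in> Cinf E" "closed C" "C \<subseteq> U" "open N" "x \<in> N"
        "\<And>y. y \<in> N \<Longrightarrow> \<rho> y = 1" "\<And>y. y \<notin> C \<Longrightarrow> \<rho> y = 0"
        using bump_exists[OF triv_open[OF t] x] by metis
      let ?s = "\<lambda>i y. \<rho> y *\<^sub>R e i y"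
      have s: "?s k \<in> sections E" if "k < rk E" for k
        by (rule bump_section[OF b(1,2,3) triv_open[OF t] b(7) frame_section[OF t that]])
      \<comment> \<open>On \<open>N\<close> the cutoff frame has the values of \<open>e\<close>, so
        the tensor agrees there with the torsion of two global sections, which is smooth.\<close>
      have "\<forall>y\<in>N. tor_tensor y (e i y) (e j y) = tor (?s i) (?s j) y"
      proof
        fix y assume "y \<in> N"
        then show "tor_tensor y (e i y) (e j y) = tor (?s i) (?s j) y"
          using tor_tensor_apply[OF s[OF ij(1)] s[OF ij(2)], of y] b(6)[of y] by simp
      qed
      then show "\<exists>V s'. open V \<and> x \<in> V \<and> s' \<in> sections E \<and> (\<forall>y\<in>V. tor_tensor y (e i y) (e j y) = s' y)"
        using b(4,5) tor_section[OF s[OF ij(1)] s[OF ij(2)]] by (intro exI[of _ N] exI[of _ "tor (?s i) (?s j)"] conjI)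
    qed
  qed
qed

lemma insertion_tor_tensor:
  assumes D: "algebroid_differential E D"
  shows "insertion E tor_tensor = (\<lambda>\<omega>\<in>forms E. \<lambda>x l. D \<omega> x l - nabla_map (anchor E) \<omega> x l)" (is "_ = ?J")
proof -
  note q = anchor_bundle_map
  have D1: "derivation E 1 D" using D unfolding algebroid_differential_def by (elim conjE)
  have Df: "D (fun_form f) x [A x] = anchor E x (A x) f" if "f \<in> Cinf E" "A \<in> sections E" for f A x
    using D that unfolding algebroid_differential_def anchored_def by simp
  have Da: "D \<alpha> x [A x, B x] =
      anchor E x (A x) (\<lambda>y. \<alpha> y [B y]) - anchor E x (B x) (\<lambda>y. \<alpha> y [A y]) - \<alpha> x [bracket E A B x]"
    if "\<alpha> \<in> kforms E 1" "A \<in> sections E" "B \<in> sections E" for \<alpha> A B x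
    using D that unfolding algebroid_differential_def anchored_def by simp
  have J: "derivation E 1 ?J" by (rule derivation_diff[OF D1 nabla_map_derivation[OF q]])
  have Jf: "?J (fun_form f) = (\<lambda>x l. 0)" if f: "f \<in> Cinf E" for f
  proof -
    have k: "R (fun_form f) \<in> kforms E 1" if "derivation E 1 R" for R
      using derivation_degree[OF that fun_form_kform[OF f]] unfolding add_0 .
    have "D (fun_form f) = nabla_map (anchor E) (fun_form f)"
      by (rule kform1_eqI[OF k[OF D1] k[OF nabla_map_derivation[OF q]]])
        (simp only: Df[OF f] nabla_map_fun_form[OF q f])
    then show ?thesis using kform_form[OF fun_form_kform[OF f]] by simp
  qed
  have Ja: "?J \<alpha> x [A x, B x] = \<alpha> x [tor_tensor x (A x) (B x)]"
    if \<alpha>: "\<alpha> \<in> kforms E 1" and A: "A \<in> sections E" and B: "B \<in> sections E" for \<alpha> A B x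
  proof -
    have lin: "lin_on (fibre E x) (\<lambda>a. \<alpha> x [a])"
      using alternating_on_lin[OF form_alternating[OF kform_form[OF \<alpha>]], of "[]" x "[]"] by simp
    let ?u = "nab (anchored E A) B x" and ?v = "nab (anchored E B) A x" and ?w = "bracket E A B x"
    have m: "?u \<in> fibre E x" "?v \<in> fibre E x" "?w \<in> fibre E x"
      by (intro section_in_fibre nab_section[OF anchored_field] bracket_section A B)+
    have "\<alpha> x [1 *\<^sub>R ?u + (-1) *\<^sub>R ?v] = \<alpha> x [?u] - \<alpha> x [?v]"
      using lin_onD[OF lin m(1,2), of 1 "-1"] by simp
    moreover have "1 *\<^sub>R ?u + (-1) *\<^sub>R ?v \<in> fibre E x"
      by (intro subspace_add subspace_scale subspace_fibre m)
    then have "\<alpha> x [1 *\<^sub>R (1 *\<^sub>R ?u + (-1) *\<^sub>R ?v) + (-1) *\<^sub>R ?w] = \<alpha> x [1 *\<^sub>R ?u + (-1) *\<^sub>R ?v] - \<alpha> x [?w]"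
      using lin_onD[OF lin _ m(3), of "1 *\<^sub>R ?u + (-1) *\<^sub>R ?v" 1 "-1"] by simp
    ultimately have "\<alpha> x [tor A B x] = \<alpha> x [?u] - \<alpha> x [?v] - \<alpha> x [?w]" unfolding tor_eq by simp
    \<comment> \<open>The terms in which the anchor differentiates \<open>\<alpha>\<close> on a
      section occur alike in \<open>D\<close> and in \<open>nabla_map\<close>, and cancel; the
      covariant derivatives and the bracket remain.\<close>
    then show ?thesis
      using kform_form[OF \<alpha>]
      by (simp add: tor_tensor_apply[OF A B] Da[OF \<alpha> A B] nabla_map_1form[OF q \<alpha> A B] anchored_def[symmetric])
  qed
  show ?thesis
    unfolding insertion_def
  proof (rule the_equality)
    show "derivation E 1 ?J \<and>
     (\<forall>f\<in>Cinf E. ?J (fun_form f) = (\<lambda>x l. 0)) \<and>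
     (\<forall>\<alpha>\<in>kforms E 1. \<forall>A\<in>sections E. \<forall>B\<in>sections E. \<forall>x.
        ?J \<alpha> x [A x, B x] = \<alpha> x [tor_tensor x (A x) (B x)])"
      by (intro conjI ballI allI J Jf Ja)
  next
    fix P assume P: "derivation E 1 P \<and>
     (\<forall>f\<in>Cinf E. P (fun_form f) = (\<lambda>x l. 0)) \<and>
     (\<forall>\<alpha>\<in>kforms E 1. \<forall>A\<in>sections E. \<forall>B\<in>sections E. \<forall>x.
        P \<alpha> x [A x, B x] = \<alpha> x [tor_tensor x (A x) (B x)])"
    then have P1: "derivation E 1 P" by (elim conjE)
    show "P = ?J"
    proof (rule derivation_eqI[OF P1 J])
      show "P (fun_form f) = ?J (fun_form f)" if "f \<in> Cinf E" for f
        unfolding Jf[OF that] using P that by blast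
      fix \<alpha> assume \<alpha>: "\<alpha> \<in> kforms E 1"
      have k: "R \<alpha> \<in> kforms E 2" if "derivation E 1 R" for R
        using derivation_degree[OF that \<alpha>] unfolding one_add_one .
      show "P \<alpha> = ?J \<alpha>"
      proof (rule kform2_eqI[OF k[OF P1] k[OF J]])
        show "P \<alpha> x [A x, B x] = ?J \<alpha> x [A x, B x]" if "A \<in> sections E" "B \<in> sections E" for A B x
          unfolding Ja[OF \<alpha> that] using P \<alpha> that by blast
      qed
    qed
  qed
qed

end

theorem theorem3p4:
  fixes E :: "('m::{t2_space,second_countable_topology}, 'b::real_inner, 'e::real_vector) lie_algebroid"
    and D :: "('m, 'e) form \<Rightarrow> ('m, 'e) form"
    and nab :: "('m, 'e) connection"
  assumes "is_lie_algebroid E"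
    and "algebroid_differential E D"
    and "is_connection E nab"
  shows "is_E_connection E (induced_E_connection E nab) \<and>
    (\<exists>L\<in>E_valued_2forms E.
       (\<forall>A\<in>sections E. \<forall>B\<in>sections E.
          (\<lambda>x. L x (A x) (B x)) = torsion E (induced_E_connection E nab) A B) \<and>
       (\<forall>A\<in>sections E. \<forall>B\<in>sections E.
          (\<lambda>x. L x (A x) (B x)) =
            (\<lambda>x. nab (anchored E A) B x - nab (anchored E B) A x - bracket E A B x)) \<and>
       (\<forall>\<omega>\<in>forms E.
          D \<omega> = (\<lambda>x l. form_connection_along E nab (anchor E) \<omega> x l + insertion E L \<omega> x l)))"
proof -
  have "is_vbundle E" using assms(1) unfolding is_lie_algebroid_def by (elim conjE)
  then interpret algebroid_connection E nab
    using assms(1,3) by unfold_locales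
  show ?thesis
  proof (intro conjI bexI[of _ tor_tensor] ballI)
    show "is_E_connection E (induced_E_connection E nab)" by (rule induced_E_connection)
    show "tor_tensor \<in> E_valued_2forms E" by (rule tor_tensor_2form)
    fix A B assume A: "A \<in> sections E" and B: "B \<in> sections E"
    show "(\<lambda>x. tor_tensor x (A x) (B x)) = tor A B"
      by (rule ext) (rule tor_tensor_apply[OF A B])
    then show "(\<lambda>x. tor_tensor x (A x) (B x)) =
        (\<lambda>x. nab (anchored E A) B x - nab (anchored E B) A x - bracket E A B x)"
      unfolding tor_eq .
  next
    fix \<omega> assume w: "\<omega> \<in> forms E"
    show "D \<omega> = (\<lambda>x l. form_connection_along E nab (anchor E) \<omega> x l + insertion E tor_tensor \<omega> x l)"
      unfolding insertion_tor_tensor[OF assms(2)] form_connection_along_eq[OF anchor_bundle_map w]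
      using w by simp
  qed
qed

end
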